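(* Let $L$ be a positive-definite even lattice of rank $d$, and let $P$ be a homogeneous spherical harmonic of degree $k$ with respect to $L$. Then there is a primary field $v_P$ in the lattice VOA $V_L$ with the property that $$Z(v_P,q)=\theta_L(P,q)/\eta(q)^d.$$
   Context: Spherical harmonics: let $\mathfrak h=L\otimes_{\mathbb Z}\mathbb C$ with orthonormal basis $h_1,\dots,h_d$. A homogeneous spherical harmonic of degree $k$ with respect to $L$ is a homogeneous polynomial $P(x_1,\dots,x_d)$ of degree $k$ over $\mathbb C$ with $\sum_{i=1}^d\partial^2P/\partial x_i^2=0$. For $\alpha\in L$, $P(\alpha)=P((h_1,\alpha),\dots,(h_d,\alpha))$, and $\theta_L(P,q)=\sum_{\alpha\in L}P(\alpha)q^{(\alpha,\alpha)/2}$. Lattice VOA: let $M(1)$ be the Fock space of the Heisenberg algebra with generators $h(n)$ ($h\in\mathfrak h$, $n\in\mathbb Z$), $[h(m),h'(n)]=m(h,h')\delta_{m+n,0}$, generated by a vacuum $\mathbf 1$ with $h(n)\mathbf 1=0$ for $n\ge0$. $V_L=M(1)\otimes\mathbb C[L]$, where $\mathbb C[L]$ has basis $e^\alpha$ ($\alpha\in L$); $h(n)$ for $n\ne0$ acts on $M(1)$ and $h(0)(u\otimes e^\alpha)=(h,\alpha)u\otimes e^\alpha$. Fix a normalized 2-cocycle $c:L\times L\to\mathbb C^\times$ with $c(\alpha,\beta)/c(\beta,\alpha)=(-1)^{(\alpha,\beta)}$, and let $e_\alpha$ act by $u\otimes e^\beta\mapsto c(\alpha,\beta)u\otimes e^{\alpha+\beta}$.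 Then $Y(\mathbf 1\otimes e^\alpha,z)=\exp\big(\sum_{n\ge1}\frac{\alpha(-n)}nz^n\big)\exp\big(-\sum_{n\ge1}\frac{\alpha(n)}nz^{-n}\big)e_\alpha z^{\alpha(0)}$, and $Y(a_1(-n_1)\cdots a_k(-n_k)e^\alpha,z)={:}\partial^{(n_1-1)}a_1(z)\cdots\partial^{(n_k-1)}a_k(z)Y(e^\alpha,z){:}$, where $\partial^{(n)}=\frac1{n!}(d/dz)^n$, $a(z)=\sum_na(n)z^{-n-1}$ (${:}\ {:}$ is normal ordering). The vacuum is $\mathbf 1\otimes e^0$, the Virasoro element is $\omega=\frac12\sum_{i=1}^dh_i(-1)^2\mathbf 1$, $Y(\omega,z)=\sum_nL(n)z^{-n-2}$, and the central charge is $d$. A primary field (primary state) is a homogeneous vector $v$ with $L(n)v=0$ for all integers $n\ge1$. Trace functions: for $v$ homogeneous of $L(0)$-weight $m$ with $Y(v,z)=\sum_nv(n)z^{-n-1}$ put $o(v)=v(m-1)$; extend linearly. $Z(v,q)=\mathrm{tr}_{V_L}o(v)q^{L(0)-d/24}$. $\eta(q)=q^{1/24}\prod_{n\ge1}(1-q^n)$. *)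

theory Defs
  imports
    "HOL-Library.Poly_Mapping"
    "HOL-Computational_Algebra.Formal_Laurent_Series"
    "HOL-Analysis.Infinite_Products"
begin

section \<open>Polynomials in several variables\<close>

text \<open>A polynomial with variables in \<^typ>\<open>'x\<close> is a finitely supported function on monomials,
  a monomial being a finitely supported exponent function.\<close>

type_synonym 'x cpoly = "('x \<Rightarrow>\<^sub>0 nat) \<Rightarrow>\<^sub>0 complex"

definition pvar :: "'x \<Rightarrow> 'x cpoly" where
  "pvar x = Poly_Mapping.single (Poly_Mapping.single x 1) 1"

definition pscale :: "complex \<Rightarrow> 'x cpoly \<Rightarrow> 'x cpoly" where
  "pscale a p = Poly_Mapping.map ((*) a) p"

definition pdiff :: "'x \<Rightarrow> 'x cpoly \<Rightarrow> 'x cpoly" where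
  "pdiff x p = (\<Sum>m\<in>Poly_Mapping.keys p.
     Poly_Mapping.single (m - Poly_Mapping.single x 1)
       (of_nat (Poly_Mapping.lookup m x) * Poly_Mapping.lookup p m))"

definition peval :: "('x \<Rightarrow> complex) \<Rightarrow> 'x cpoly \<Rightarrow> complex" where
  "peval f p = (\<Sum>m\<in>Poly_Mapping.keys p.
     Poly_Mapping.lookup p m * (\<Prod>x\<in>Poly_Mapping.keys m. f x ^ Poly_Mapping.lookup m x))"

definition pvars :: "'x cpoly \<Rightarrow> 'x set" where
  "pvars p = (\<Union>m\<in>Poly_Mapping.keys p. Poly_Mapping.keys m)"

definition phomogeneous :: "nat \<Rightarrow> 'x cpoly \<Rightarrow> bool" where
  "phomogeneous k p \<longleftrightarrow> (\<forall>m\<in>Poly_Mapping.keys p.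
     (\<Sum>x\<in>Poly_Mapping.keys m. Poly_Mapping.lookup m x) = k)"

text \<open>The variables \<open>x\<^sub>1, \<dots>, x\<^sub>d\<close> are numbered from \<open>0\<close>. As usual the zero polynomial
  is homogeneous of every degree.\<close>

definition spherical_harmonic :: "nat \<Rightarrow> nat \<Rightarrow> nat cpoly \<Rightarrow> bool" where
  "spherical_harmonic d k P \<longleftrightarrow>
     pvars P \<subseteq> {..<d} \<and> phomogeneous k P \<and> (\<Sum>i<d. pdiff i (pdiff i P)) = 0"


section \<open>Trace of an operator on a finite-dimensional subspace\<close>

text \<open>The result does not depend on the chosen basis \<open>B\<close> of \<open>W\<close>.\<close>

definition (in vector_space) trace_on :: "'b set \<Rightarrow> ('b \<Rightarrow> 'b) \<Rightarrow> 'a" where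
  "trace_on W T =
     (let B = (SOME B. independent B \<and> span B = W) in \<Sum>b\<in>B. representation B (T b) b)"


section \<open>The space \<open>M(1) \<otimes> \<complex>[L]\<close>\<close>

text \<open>\<open>M(1)\<close> is the polynomial algebra in variables \<open>x\<^bsub>(i,n)\<^esub>\<close>, \<open>i < d\<close>, \<open>n \<ge> 1\<close>, where
  \<open>x\<^bsub>(i,n)\<^esub>\<close> stands for \<open>h\<^sub>i(-n)\<close>. The vector \<open>u \<otimes> e\<^sup>\<alpha>\<close> is \<^term>\<open>Poly_Mapping.single \<alpha> u\<close>.
  The bounds on \<open>i\<close>, \<open>n\<close> and the condition \<open>\<alpha> \<in> L\<close> are imposed by the carrier set
  \<open>VL\<close> below.\<close>

type_synonym fock = "(nat \<times> nat) cpoly"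
type_synonym 'h fspace = "'h \<Rightarrow>\<^sub>0 fock"

definition vscale :: "complex \<Rightarrow> 'h fspace \<Rightarrow> 'h fspace" where
  "vscale a v = Poly_Mapping.map (pscale a) v"

lemma lookup_pscale [simp]:
  "Poly_Mapping.lookup (pscale a p) m = a * Poly_Mapping.lookup p m"
  by (simp add: pscale_def Poly_Mapping.map.rep_eq when_def)

lemma lookup_vscale [simp]:
  "Poly_Mapping.lookup (vscale a v) \<alpha> = pscale a (Poly_Mapping.lookup v \<alpha>)"
proof -
  have "pscale a 0 = (0 :: fock)"
    by (rule poly_mapping_eqI) simp
  then show ?thesis
    by (simp add: vscale_def Poly_Mapping.map.rep_eq when_def)
qed

global_interpretation fspace: vector_space "vscale :: complex \<Rightarrow> 'h fspace \<Rightarrow> 'h fspace"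
  by unfold_locales
    (rule poly_mapping_eqI, rule poly_mapping_eqI, simp add: lookup_add algebra_simps)+


section \<open>Operator-valued formal distributions\<close>

text \<open>The distribution \<open>\<Sum>\<^sub>j A\<^sub>j z\<^sup>j\<close> is represented by its coefficients \<open>j \<mapsto> A\<^sub>j\<close>. All infinite
  sums of operators below have only finitely many nonzero terms once applied to a vector
  of \<open>V\<^sub>L\<close>.\<close>

type_synonym 'v dist = "int \<Rightarrow> 'v \<Rightarrow> 'v"

definition dist_mult :: "('v::comm_monoid_add) dist \<Rightarrow> 'v dist \<Rightarrow> 'v dist" where
  "dist_mult A B = (\<lambda>j v. Sum_any (\<lambda>i. A i (B (j - i) v)))"

text \<open>\<open>\<partial>\<^bsup>(n)\<^esup> = (1/n!) (d/dz)\<^sup>n\<close> sends \<open>z\<^bsup>j+n\<^esup>\<close> to \<open>binom(j+n, n) z\<^sup>j\<close>.\<close>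

definition dist_deriv :: "nat \<Rightarrow> 'h fspace dist \<Rightarrow> 'h fspace dist" where
  "dist_deriv n A = (\<lambda>j v. vscale (of_int (j + int n) gchoose n) (A (j + int n) v))"

text \<open>Coefficient of \<open>z\<^sup>j\<close> in \<open>exp (\<Sum>\<^bsub>n\<ge>1\<^esub> X\<^sub>n z\<^sup>n)\<close>: the sum of
  \<open>X\<^bsub>n\<^sub>1\<^esub> \<cdots> X\<^bsub>n\<^sub>k\<^esub> / k!\<close> over all compositions \<open>n\<^sub>1 + \<dots> + n\<^sub>k = j\<close> into positive parts.\<close>

definition exp_coeff :: "(nat \<Rightarrow> 'h fspace \<Rightarrow> 'h fspace) \<Rightarrow> nat \<Rightarrow> 'h fspace \<Rightarrow> 'h fspace" where
  "exp_coeff X j v = (\<Sum>ns | sum_list ns = j \<and> 0 \<notin> set ns.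
     vscale (1 / fact (length ns)) (foldr X ns v))"


section \<open>Lattice vertex operator algebras\<close>

text \<open>The type \<^typ>\<open>'h\<close> carries the complex vector space \<open>\<hh> = L \<otimes> \<complex>\<close>: \<open>L\<close> is the integral
  span of a complex basis of \<open>\<hh>\<close>, and \<open>form\<close> is the bilinear extension to \<open>\<hh>\<close> of the form on
  \<open>L\<close>. The orthonormal basis of \<open>\<hh>\<close> is \<open>h 0, \<dots>, h (d - 1)\<close>.\<close>

locale lattice_voa = vector_space scale
  for scale :: "complex \<Rightarrow> 'h::ab_group_add \<Rightarrow> 'h" +
  fixes form :: "'h \<Rightarrow> 'h \<Rightarrow> complex"
    and L :: "'h set"
    and d :: nat
    and h :: "nat \<Rightarrow> 'h"
    and c :: "'h \<Rightarrow> 'h \<Rightarrow> complex"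
  assumes form_sym: "form x y = form y x"
    and form_add: "form (x + y) z = form x z + form y z"
    and form_scale: "form (scale a x) z = a * form x z"
    and lattice: "\<exists>B. finite B \<and> card B = d \<and> independent B \<and> span B = UNIV \<and>
           L = {\<Sum>b\<in>B. scale (of_int (m b)) b | m :: 'h \<Rightarrow> int. True}"
    and integral: "\<lbrakk>\<alpha> \<in> L; \<beta> \<in> L\<rbrakk> \<Longrightarrow> form \<alpha> \<beta> \<in> \<int>"
    and form_even: "\<alpha> \<in> L \<Longrightarrow> \<exists>k :: int. form \<alpha> \<alpha> = of_int (2 * k)"
    and positive_definite: "\<lbrakk>\<alpha> \<in> L; \<alpha> \<noteq> 0\<rbrakk> \<Longrightarrow> Re (form \<alpha> \<alpha>) > 0"
    and orthonormal: "\<lbrakk>i < d; j < d\<rbrakk> \<Longrightarrow> form (h i) (h j) = (if i = j then 1 else 0)"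
    and orthonormal_span: "span (h ` {..<d}) = UNIV"
    and cocycle_nonzero: "\<lbrakk>\<alpha> \<in> L; \<beta> \<in> L\<rbrakk> \<Longrightarrow> c \<alpha> \<beta> \<noteq> 0"
    and cocycle: "\<lbrakk>\<alpha> \<in> L; \<beta> \<in> L; \<gamma> \<in> L\<rbrakk> \<Longrightarrow>
           c \<alpha> \<beta> * c (\<alpha> + \<beta>) \<gamma> = c \<beta> \<gamma> * c \<alpha> (\<beta> + \<gamma>)"
    and cocycle_normalized: "\<alpha> \<in> L \<Longrightarrow> c 0 \<alpha> = 1 \<and> c \<alpha> 0 = 1"
    and cocycle_commutator: "\<lbrakk>\<alpha> \<in> L; \<beta> \<in> L; form \<alpha> \<beta> = of_int k\<rbrakk> \<Longrightarrow>
           c \<alpha> \<beta> / c \<beta> \<alpha> = (- 1) powi k"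
begin

definition VL :: "'h fspace set" where
  "VL = {v. Poly_Mapping.keys v \<subseteq> L \<and>
            (\<forall>\<alpha>. pvars (Poly_Mapping.lookup v \<alpha>) \<subseteq> {..<d} \<times> {1..})}"

definition vacuum :: "'h fspace" where
  "vacuum = Poly_Mapping.single 0 1"

text \<open>On \<open>M(1)\<close>, \<open>h\<^sub>i(-n)\<close> is multiplication by \<open>x\<^bsub>(i,n)\<^esub>\<close> and \<open>h\<^sub>i(n)\<close> is
  \<open>n \<partial>/\<partial>x\<^bsub>(i,n)\<^esub>\<close> for \<open>n \<ge> 1\<close>; a general \<open>a(n)\<close> is obtained from
  \<open>a = \<Sum>\<^sub>i (a, h\<^sub>i) h\<^sub>i\<close>.\<close>

definition fock_mode :: "'h \<Rightarrow> int \<Rightarrow> fock \<Rightarrow> fock" where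
  "fock_mode a n u =
     (if n < 0 then \<Sum>i<d. pscale (form a (h i)) (pvar (i, nat (- n)) * u)
      else \<Sum>i<d. pscale (form a (h i) * of_int n) (pdiff (i, nat n) u))"

definition heis :: "'h \<Rightarrow> int \<Rightarrow> 'h fspace \<Rightarrow> 'h fspace" where
  "heis a n v =
     (if n = 0 then Poly_Mapping.mapp (\<lambda>\<beta> u. pscale (form a \<beta>) u) v
      else Poly_Mapping.map (fock_mode a n) v)"

definition lattice_shift :: "'h \<Rightarrow> 'h fspace \<Rightarrow> 'h fspace" where
  "lattice_shift \<alpha> v = (\<Sum>\<beta>\<in>Poly_Mapping.keys v.
     Poly_Mapping.single (\<alpha> + \<beta>) (pscale (c \<alpha> \<beta>) (Poly_Mapping.lookup v \<beta>)))"

text \<open>\<open>z\<^bsup>\<alpha>(0)\<^esup>\<close> multiplies \<open>u \<otimes> e\<^sup>\<beta>\<close> by \<open>z\<^bsup>(\<alpha>,\<beta>)\<^esup>\<close>, so its coefficient of \<open>z\<^sup>j\<close> is the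
  projection onto the components with \<open>(\<alpha>,\<beta>) = j\<close>.\<close>

definition z_power :: "'h \<Rightarrow> 'h fspace dist" where
  "z_power \<alpha> j v = Poly_Mapping.mapp (\<lambda>\<beta> u. if form \<alpha> \<beta> = of_int j then u else 0) v"

definition exp_creation :: "'h \<Rightarrow> 'h fspace dist" where
  "exp_creation \<alpha> j v =
     (if j \<ge> 0 then exp_coeff (\<lambda>n w. vscale (1 / of_nat n) (heis \<alpha> (- int n) w)) (nat j) v
      else 0)"

definition exp_annihilation :: "'h \<Rightarrow> 'h fspace dist" where
  "exp_annihilation \<alpha> j v =
     (if j \<le> 0 then exp_coeff (\<lambda>n w. vscale (- 1 / of_nat n) (heis \<alpha> (int n) w)) (nat (- j)) v
      else 0)"

text \<open>The vertex operator \<open>Y(1 \<otimes> e\<^sup>\<alpha>, z)\<close>.\<close>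

definition vertex_exp :: "'h \<Rightarrow> 'h fspace dist" where
  "vertex_exp \<alpha> = dist_mult (exp_creation \<alpha>)
     (dist_mult (exp_annihilation \<alpha>) (\<lambda>j v. lattice_shift \<alpha> (z_power \<alpha> j v)))"

text \<open>The parts of \<open>a(z) = \<Sum>\<^sub>n a(n) z\<^bsup>-n-1\<^esup>\<close> with \<open>n < 0\<close> and with \<open>n \<ge> 0\<close>.\<close>

definition current_creation :: "'h \<Rightarrow> 'h fspace dist" where
  "current_creation a j v = (if j \<ge> 0 then heis a (- j - 1) v else 0)"

definition current_annihilation :: "'h \<Rightarrow> 'h fspace dist" where
  "current_annihilation a j v = (if j < 0 then heis a (- j - 1) v else 0)"

text \<open>Normal ordering puts all modes \<open>a(n)\<close> with \<open>n < 0\<close> to the left of, and all those with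
  \<open>n \<ge> 0\<close> to the right of, the remaining factors. The word \<open>[(a\<^sub>1,n\<^sub>1), \<dots>, (a\<^sub>k,n\<^sub>k)]\<close> stands for
  \<open>a\<^sub>1(-n\<^sub>1) \<cdots> a\<^sub>k(-n\<^sub>k)\<close>.\<close>

fun vertex_word :: "('h \<times> nat) list \<Rightarrow> 'h \<Rightarrow> 'h fspace dist" where
  "vertex_word [] \<alpha> = vertex_exp \<alpha>"
| "vertex_word ((a, n) # w) \<alpha> = (\<lambda>j v.
     dist_mult (dist_deriv (n - 1) (current_creation a)) (vertex_word w \<alpha>) j v +
     dist_mult (vertex_word w \<alpha>) (dist_deriv (n - 1) (current_annihilation a)) j v)"

text \<open>The factors of the monomial \<open>m\<close>, listed with multiplicity in an arbitrary order, which is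
  immaterial because the \<open>h\<^sub>i(-n)\<close> commute and so do the factors of a normally ordered
  product.\<close>

definition word_of :: "(nat \<times> nat \<Rightarrow>\<^sub>0 nat) \<Rightarrow> (nat \<times> nat) list" where
  "word_of m = (SOME w. \<forall>x. count_list w x = Poly_Mapping.lookup m x)"

text \<open>\<open>Y(v, z)\<close>, extended linearly from the vectors
  \<open>h\<^bsub>i\<^sub>1\<^esub>(-n\<^sub>1) \<cdots> h\<^bsub>i\<^sub>k\<^esub>(-n\<^sub>k) e\<^sup>\<alpha>\<close>.\<close>

definition Y :: "'h fspace \<Rightarrow> 'h fspace dist" where
  "Y v j w = (\<Sum>\<alpha>\<in>Poly_Mapping.keys v. \<Sum>m\<in>Poly_Mapping.keys (Poly_Mapping.lookup v \<alpha>).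
     vscale (Poly_Mapping.lookup (Poly_Mapping.lookup v \<alpha>) m)
       (vertex_word (map (\<lambda>(i, n). (h i, n)) (word_of m)) \<alpha> j w))"

text \<open>\<open>mode v n\<close> is \<open>v(n)\<close> in \<open>Y(v, z) = \<Sum>\<^sub>n v(n) z\<^bsup>-n-1\<^esup>\<close>.\<close>

definition mode :: "'h fspace \<Rightarrow> int \<Rightarrow> 'h fspace \<Rightarrow> 'h fspace" where
  "mode v n = Y v (- n - 1)"

definition omega :: "'h fspace" where
  "omega = vscale (1 / 2) (\<Sum>i<d. heis (h i) (- 1) (heis (h i) (- 1) vacuum))"

text \<open>\<open>Y(\<omega>, z) = \<Sum>\<^sub>n L(n) z\<^bsup>-n-2\<^esup>\<close>, that is, \<open>L(n) = \<omega>(n+1)\<close>.\<close>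

definition Vir :: "int \<Rightarrow> 'h fspace \<Rightarrow> 'h fspace" where
  "Vir n = mode omega (n + 1)"

text \<open>As \<open>L\<close> is even and positive definite, the \<open>L(0)\<close>-weights of \<open>V\<^sub>L\<close> are natural numbers.\<close>

definition weight_space :: "nat \<Rightarrow> 'h fspace set" where
  "weight_space m = {v \<in> VL. Vir 0 v = vscale (of_nat m) v}"

definition primary :: "'h fspace \<Rightarrow> bool" where
  "primary v \<longleftrightarrow> (\<exists>m. v \<in> weight_space m) \<and> (\<forall>n\<ge>1. Vir n v = 0)"

definition homogeneous_parts :: "'h fspace \<Rightarrow> nat \<Rightarrow>\<^sub>0 'h fspace" where
  "homogeneous_parts v = (THE f. (\<forall>m. Poly_Mapping.lookup f m \<in> weight_space m) \<and>
     v = (\<Sum>m\<in>Poly_Mapping.keys f. Poly_Mapping.lookup f m))"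

definition zero_mode :: "'h fspace \<Rightarrow> 'h fspace \<Rightarrow> 'h fspace" where
  "zero_mode v w = (\<Sum>m\<in>Poly_Mapping.keys (homogeneous_parts v).
     mode (Poly_Mapping.lookup (homogeneous_parts v) m) (int m - 1) w)"

end


section \<open>Formal \<open>q\<close>-series\<close>

text \<open>Formal series in \<open>q\<close> with exponents in \<open>(1/24) \<int>\<close> are Laurent series in
  \<open>q\<^bsup>1/24\<^esup> =\<close> \<^term>\<open>fls_X\<close>; a power series in \<open>q\<close> is embedded by \<open>q \<mapsto> (q\<^bsup>1/24\<^esup>)\<^bsup>24\<^esup>\<close>.\<close>

definition q_series :: "complex fps \<Rightarrow> complex fls" where
  "q_series f = fps_to_fls (fps_compose f (fps_X ^ 24))"

definition eta :: "complex fls" where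
  "eta = fls_X * q_series (prodinf (\<lambda>n. 1 - fps_X ^ Suc n))"

context lattice_voa
begin

definition theta :: "nat cpoly \<Rightarrow> complex fls" where
  "theta P = q_series (Abs_fps (\<lambda>m.
     \<Sum>\<alpha> | \<alpha> \<in> L \<and> form \<alpha> \<alpha> / 2 = of_nat m. peval (\<lambda>i. form (h i) \<alpha>) P))"

definition Z :: "'h fspace \<Rightarrow> complex fls" where
  "Z v = fls_X powi (- int d) *
     q_series (Abs_fps (\<lambda>m. fspace.trace_on (weight_space m) (zero_mode v)))"

end

end

theory Submission
  imports Defs
begin

unbundle no vec_syntax

text \<open>Take \<open>v\<^sub>P = P(h\<^sub>1(-1), \<dots>, h\<^sub>d(-1)) \<otimes> e\<^sup>0\<close>. Of the modes \<open>h\<^sub>i(n)\<close> with \<open>n \<ge> 0\<close> only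
  \<open>h\<^sub>i(1)\<close> acts on such vectors nontrivially, namely as \<open>\<partial>\<^sub>i\<close>, so among the \<open>L(n)\<close> with
  \<open>n \<ge> 1\<close> only \<open>L(2)\<close> could fail to kill \<open>v\<^sub>P\<close>, and \<open>L(2)\<close> acts as half the Laplacian.
  The trace \<open>T\<close> of the zero mode of a normally ordered polynomial in the currents, taken over
  \<open>M(1) \<otimes> e\<^sup>\<beta>\<close>, satisfies \<open>T(x\<^sub>i Q) = (h\<^sub>i, \<beta>) T(Q) + K T(\<partial>\<^sub>i Q)\<close> with a power series \<open>K\<close> in \<open>q\<close>
  that does not depend on \<open>i\<close>, by cyclicity of the trace and
  \<open>h(n) q\<^bsup>L(0)\<^esup> = q\<^sup>n q\<^bsup>L(0)\<^esup> h(n)\<close>. Euler's identity then gives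
  \<open>k T(P) = \<Sum>\<^sub>i (h\<^sub>i, \<beta>) T(\<partial>\<^sub>i P) + K T(\<Delta> P)\<close>, and induction on the degree
  yields \<open>T(P) = P(\<beta>) T(1)\<close> for harmonic \<open>P\<close>.\<close>

section \<open>Normally ordered products of Heisenberg modes\<close>

text \<open>Where \<open>K\<close> comes from: a mode of index n carried once around the trace
  returns with a factor q^n and a commutator proportional to n, and solving this linear equation
  gives n q^n/(1 - q^n). The creation and the annihilation half of a current contribute equally, so
  \<open>K\<close> is multiplication by the sum over n of 2 n q^n/(1 - q^n), which is (1 - E_2)/12.
  A single monomial sees this term; it can only vanish in the combination over all i that forms a
  Laplacian, which is why Euler's identity enters. The formal obstacle is that products of currents
  are infinite sums, finite only on each vector. Identities between them are proved for all large
  cutoffs \<open>R\<close> and transported along the filter \<open>sequentially\<close>. A trace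
  also needs finite-dimensional weight spaces, hence finitely many lattice vectors of given norm.
  Since \<open>form\<close> is complex valued and positive only on \<open>L\<close>, this is derived
  from integral combinations of lattice vectors rather than from a real inner product.\<close>

lemma Sum_any_reindex_nat:
  fixes g :: "'a \<Rightarrow> 'b::comm_monoid_add" and f :: "nat \<Rightarrow> 'a"
  assumes "inj f" "\<And>x. x \<notin> f ` {..R} \<Longrightarrow> g x = 0"
  shows "Sum_any g = (\<Sum>n\<le>R. g (f n))"
proof -
  have "Sum_any g = sum g (f ` {..R})"
    using assms(2) by (intro Sum_any.expand_superset) auto
  also have "\<dots> = (\<Sum>n\<le>R. g (f n))"
    by (subst sum.reindex) (use assms(1) in \<open>auto simp: inj_on_def inj_def\<close>)
  finally show ?thesis .
qed

text \<open>Normal ordering uses only linearity, the commutation relations and the fact that high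
  modes kill a given vector. It is isolated here so that the sign cases of the Fock model are met
  only once, in \<open>osc_commutator\<close>.\<close>

locale heisenberg_module = vector_space scale
  for scale :: "complex \<Rightarrow> 'v::ab_group_add \<Rightarrow> 'v" (infixr \<open>\<odot>\<close> 75) +
  fixes a :: "'i \<Rightarrow> int \<Rightarrow> 'v \<Rightarrow> 'v"
  assumes a_add: "a i n (v + w) = a i n v + a i n w"
    and a_scale: "a i n (r \<odot> v) = r \<odot> a i n v"
    and commutator: "a i m (a j n v) =
           a j n (a i m v) + (if i = j \<and> m + n = 0 then of_int m \<odot> v else 0)"
    and smooth: "\<exists>N. \<forall>n\<ge>N. a i n v = 0"
begin

lemma a_zero [simp]: "a i n 0 = 0"
  using a_scale[of i n 0 0] by simp

lemma a_sum: "a i n (sum f A) = (\<Sum>x\<in>A. a i n (f x))"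
  by (induction A rule: infinite_finite_induct) (auto simp: a_add)

text \<open>The coefficient of \<open>z\<^sup>j\<close> in the normally ordered product of the currents
  \<open>\<Sum>\<^sub>n a\<^sub>i(n) z\<^bsup>-n-1\<^esup>\<close>, \<open>i\<close> running through the given word.\<close>

fun nord :: "'i list \<Rightarrow> int \<Rightarrow> 'v \<Rightarrow> 'v" where
  "nord [] j v = (if j = 0 then v else 0)"
| "nord (i # w) j v =
     Sum_any (\<lambda>l. if l \<ge> 0 then a i (- l - 1) (nord w (j - l) v) else 0) +
     Sum_any (\<lambda>l. if j - l < 0 then nord w l (a i (- (j - l) - 1) v) else 0)"

declare nord.simps(2) [simp del]

lemma nord_zero [simp]: "nord w j 0 = 0"
  by (induction w arbitrary: j) (auto simp: nord.simps(2) cong: if_cong)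

text \<open>In the creation half the mode -n-1 carries z^n; in the annihilation half the mode n
  leaves the exponent j+1+n to the remaining factors. The two hypotheses say that both sums stop at
  \<open>R\<close>.\<close>

lemma nord_Cons:
  assumes "\<And>n. n > R \<Longrightarrow> nord w (j - int n) v = 0"
    and "\<And>n. n > R \<Longrightarrow> a i (int n) v = 0"
  shows "nord (i # w) j v =
    (\<Sum>n\<le>R. a i (- int n - 1) (nord w (j - int n) v)) +
    (\<Sum>n\<le>R. nord w (j + 1 + int n) (a i (int n) v))"
proof -
  have "Sum_any (\<lambda>l. if l \<ge> 0 then a i (- l - 1) (nord w (j - l) v) else 0) =
    (\<Sum>n\<le>R. if int n \<ge> 0 then a i (- int n - 1) (nord w (j - int n) v) else 0)"
  proof (rule Sum_any_reindex_nat)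
    fix l assume l: "l \<notin> int ` {..R}"
    show "(if l \<ge> 0 then a i (- l - 1) (nord w (j - l) v) else 0) = 0"
    proof (cases "l \<ge> 0")
      case True
      then obtain n where n: "l = int n" by (metis nonneg_int_cases)
      with l have "n \<notin> {..R}" by blast
      with n assms(1)[of n] show ?thesis by simp
    qed simp
  qed (auto simp: inj_def)
  moreover have "Sum_any (\<lambda>l. if j - l < 0 then nord w l (a i (- (j - l) - 1) v) else 0) =
    (\<Sum>n\<le>R. if j - (j + 1 + int n) < 0
        then nord w (j + 1 + int n) (a i (- (j - (j + 1 + int n)) - 1) v) else 0)"
  proof (rule Sum_any_reindex_nat)
    fix l assume l: "l \<notin> (\<lambda>n. j + 1 + int n) ` {..R}"
    show "(if j - l < 0 then nord w l (a i (- (j - l) - 1) v) else 0) = 0"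
    proof (cases "j - l < 0")
      case True
      then obtain n where "l - j - 1 = int n" using zero_le_imp_eq_int[of "l - j - 1"] by auto
      hence n: "l = j + 1 + int n" by simp
      with l have "n \<notin> {..R}" by blast
      with n assms(2)[of n] show ?thesis by simp
    qed simp
  qed (auto simp: inj_def)
  ultimately show ?thesis
    by (simp add: nord.simps(2))
qed

section \<open>Truncation and linearity of normally ordered products\<close>

lemma smooth_nat: "\<forall>\<^sub>F R in sequentially. \<forall>n>R. a i (int n) v = 0"
proof -
  obtain N where N: "\<forall>n\<ge>N. a i n v = 0" using smooth by blast
  show ?thesis
    unfolding eventually_sequentially by (rule exI[of _ "nat N"]) (auto intro!: N[rule_format])
qed

lemma nord_truncated: "\<exists>J. \<forall>j<J. nord w j v = 0"
proof (induction w arbitrary: v)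
  case Nil
  show ?case by (rule exI[of _ 0]) auto
next
  case (Cons i w)
  obtain J0 where J0: "\<And>j. j < J0 \<Longrightarrow> nord w j v = 0" using Cons by blast
  obtain N where N: "\<And>n. n > N \<Longrightarrow> a i (int n) v = 0"
    using smooth_nat[of i v] by (auto simp: eventually_sequentially)
  have "\<forall>n. \<exists>J. \<forall>j<J. nord w j (a i (int n) v) = 0" using Cons by blast
  from choice[OF this] obtain f where f: "\<And>n j. j < f n \<Longrightarrow> nord w j (a i (int n) v) = 0"
    by blast
  \<comment> \<open>The annihilation half involves only finitely many vectors
    \<open>a i (int n) v\<close>, each with its own bound; the shift by N + 1 covers the exponents j
    + 1 + n for n up to N.\<close>
  define J where "J = Min (insert J0 (f ` {..N})) - int N - 1"
  have J: "J + int N + 1 \<le> J0" "\<And>n. n \<le> N \<Longrightarrow> J + int N + 1 \<le> f n"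
    using Min_le[of "insert J0 (f ` {..N})"] by (force simp: J_def)+
  show ?case
  proof (intro exI[of _ J] allI impI)
    fix j assume j: "j < J"
    have "nord (i # w) j v =
      (\<Sum>n\<le>N. a i (- int n - 1) (nord w (j - int n) v)) +
      (\<Sum>n\<le>N. nord w (j + 1 + int n) (a i (int n) v))"
      using N J(1) j by (intro nord_Cons J0) auto
    also have "\<dots> = 0"
    proof -
      have "nord w (j - int n) v = 0" for n using J(1) j by (intro J0) auto
      moreover have "nord w (j + 1 + int n) (a i (int n) v) = 0" if "n \<le> N" for n
        using J(2)[OF that] j that by (intro f) auto
      ultimately show ?thesis by simp
    qed
    finally show "nord (i # w) j v = 0" .
  qed
qed

lemma nord_truncated_nat: "\<forall>\<^sub>F R in sequentially. \<forall>n>R. nord w (j - int n) v = 0"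
proof -
  obtain J where J: "\<forall>j<J. nord w j v = 0" using nord_truncated by blast
  show ?thesis
    unfolding eventually_sequentially
    by (rule exI[of _ "nat (j - J)"]) (auto intro!: J[rule_format])
qed

text \<open>Stated for an unspecified large cutoff so that several expansions can share one
  \<open>R\<close>; an equation free of \<open>R\<close> that holds eventually holds
  outright.\<close>

lemma eventually_nord_Cons:
  "\<forall>\<^sub>F R in sequentially. nord (i # w) j v =
    (\<Sum>n\<le>R. a i (- int n - 1) (nord w (j - int n) v)) +
    (\<Sum>n\<le>R. nord w (j + 1 + int n) (a i (int n) v))"
  using nord_truncated_nat[of w j v] smooth_nat[of i v]
  by eventually_elim (rule nord_Cons, auto)

lemma nord_add: "nord w j (u + v) = nord w j u + nord w j v"
proof (induction w arbitrary: j u v)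
  case (Cons i w)
  have "\<forall>\<^sub>F R in sequentially. nord (i # w) j (u + v) = nord (i # w) j u + nord (i # w) j v"
    using eventually_nord_Cons[of i w j "u + v"] eventually_nord_Cons[of i w j u]
      eventually_nord_Cons[of i w j v]
    by eventually_elim (simp add: Cons a_add sum.distrib)
  then show ?case by simp
qed auto

lemma nord_scale: "nord w j (r \<odot> v) = r \<odot> nord w j v"
proof (induction w arbitrary: j v)
  case (Cons i w)
  have "\<forall>\<^sub>F R in sequentially. nord (i # w) j (r \<odot> v) = r \<odot> nord (i # w) j v"
    using eventually_nord_Cons[of i w j "r \<odot> v"] eventually_nord_Cons[of i w j v]
    by eventually_elim (simp add: Cons a_scale scale_sum_right scale_right_distrib)
  then show ?case by simp
qed auto

section \<open>Independence of the order of the factors\<close>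

lemma eventually_nord_Cons_uniform:
  "\<forall>\<^sub>F R in sequentially. \<forall>n. \<forall>m>R. nord w (j + int n - int m) (a i (int n) v) = 0"
proof -
  obtain N where N: "\<And>n. n > N \<Longrightarrow> a i (int n) v = 0"
    using smooth_nat[of i v] by (auto simp: eventually_sequentially)
  have "\<forall>\<^sub>F R in sequentially. \<forall>n\<in>{..N}. \<forall>m>R. nord w (j + int n - int m) (a i (int n) v) = 0"
    by (rule eventually_ball_finite) (auto intro!: nord_truncated_nat)
  then show ?thesis
    by eventually_elim (metis N atMost_iff not_le nord_zero)
qed

lemma eventually_smooth_uniform:
  "\<forall>\<^sub>F R in sequentially. \<forall>n. \<forall>m>R. a k (int m) (a i (int n) v) = 0"
proof -
  obtain N where N: "\<And>n. n > N \<Longrightarrow> a i (int n) v = 0"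
    using smooth_nat[of i v] by (auto simp: eventually_sequentially)
  have "\<forall>\<^sub>F R in sequentially. \<forall>n\<in>{..N}. \<forall>m>R. a k (int m) (a i (int n) v) = 0"
    by (rule eventually_ball_finite) (auto intro!: smooth_nat)
  then show ?thesis
    by eventually_elim (metis N atMost_iff not_le a_zero)
qed

text \<open>One cutoff must serve all inner sums at once. This is possible because only finitely
  many of the vectors \<open>a x (int n) v\<close> are nonzero.\<close>

lemma eventually_nord_Cons_Cons:
  "\<forall>\<^sub>F R in sequentially. nord (x # y # w) j v =
    (\<Sum>n\<le>R. \<Sum>m\<le>R. a x (- int n - 1) (a y (- int m - 1) (nord w (j - int n - int m) v))) +
    (\<Sum>n\<le>R. \<Sum>m\<le>R. a x (- int n - 1) (nord w (j - int n + 1 + int m) (a y (int m) v))) +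
    ((\<Sum>n\<le>R. \<Sum>m\<le>R. a y (- int m - 1) (nord w (j + 1 + int n - int m) (a x (int n) v))) +
    (\<Sum>n\<le>R. \<Sum>m\<le>R. nord w (j + 1 + int n + 1 + int m) (a y (int m) (a x (int n) v))))"
  using eventually_nord_Cons[of x "y # w" j v] nord_truncated_nat[of w j v] smooth_nat[of y v]
    eventually_nord_Cons_uniform[of w "j + 1" x v] eventually_smooth_uniform[of y x v]
proof eventually_elim
  case (elim R)
  have 1: "nord (y # w) (j - int n) v =
      (\<Sum>m\<le>R. a y (- int m - 1) (nord w (j - int n - int m) v)) +
      (\<Sum>m\<le>R. nord w (j - int n + 1 + int m) (a y (int m) v))" for n
  proof (rule nord_Cons)
    \<comment> \<open>The inner exponent depends only on n + m, and n + m exceeds \<open>R\<close>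
      as well.\<close>
    fix m assume "m > R"
    with elim(2)[rule_format, of "n + m"] show "nord w (j - int n - int m) v = 0"
      by (simp add: algebra_simps)
  qed (use elim(3) in auto)
  have 2: "nord (y # w) (j + 1 + int n) (a x (int n) v) =
      (\<Sum>m\<le>R. a y (- int m - 1) (nord w (j + 1 + int n - int m) (a x (int n) v))) +
      (\<Sum>m\<le>R. nord w (j + 1 + int n + 1 + int m) (a y (int m) (a x (int n) v)))" for n
    by (rule nord_Cons) (use elim(4,5) in auto)
  show ?case
    by (simp only: elim(1) 1 2 a_add a_sum sum.distrib)
qed

text \<open>Terms with two creation or two annihilation modes agree because such modes commute. The
  mixed terms are merely exchanged: creation already stands left of annihilation in them, so no
  contraction appears.\<close>

lemma nord_swap: "nord (x # y # w) j v = nord (y # x # w) j v"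
proof -
  have 1: "a x (- int n - 1) (a y (- int m - 1) u) = a y (- int m - 1) (a x (- int n - 1) u)" for n m u
    by (subst commutator) auto
  have 2: "a x (int n) (a y (int m) u) = a y (int m) (a x (int n) u)" for n m u
    by (subst commutator) auto
  have "\<forall>\<^sub>F R in sequentially. nord (x # y # w) j v = nord (y # x # w) j v"
    using eventually_nord_Cons_Cons[of x y w j v] eventually_nord_Cons_Cons[of y x w j v]
  proof eventually_elim
    case (elim R)
    have A: "(\<Sum>n\<le>R. \<Sum>m\<le>R. a x (- int n - 1) (a y (- int m - 1) (nord w (j - int n - int m) v))) =
      (\<Sum>n\<le>R. \<Sum>m\<le>R. a y (- int n - 1) (a x (- int m - 1) (nord w (j - int n - int m) v)))"
      by (subst sum.swap) (simp add: 1 algebra_simps)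
    have B: "(\<Sum>n\<le>R. \<Sum>m\<le>R. nord w (j + 1 + int n + 1 + int m) (a y (int m) (a x (int n) v))) =
      (\<Sum>n\<le>R. \<Sum>m\<le>R. nord w (j + 1 + int n + 1 + int m) (a x (int m) (a y (int n) v)))"
      by (subst sum.swap) (simp add: 2 algebra_simps)
    have C: "(\<Sum>n\<le>R. \<Sum>m\<le>R. a z (- int n - 1) (nord w (j - int n + 1 + int m) (a z' (int m) v))) =
      (\<Sum>n\<le>R. \<Sum>m\<le>R. a z (- int m - 1) (nord w (j + 1 + int n - int m) (a z' (int n) v)))" for z z'
      by (subst sum.swap) (simp add: algebra_simps)
    show ?case
      unfolding elim A B C[of x y] C[of y x] by (simp add: ac_simps)
  qed
  then show ?thesis by simp
qed

lemma nord_Cons_cong: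
  assumes "nord w = nord w'"
  shows "nord (i # w) = nord (i # w')"
  by (intro ext) (simp only: nord.simps(2) assms)

text \<open>Induction on the length rather than on the list: if the heads differ, the tails are
  rearranged by induction until both heads stand in front, and then the two are swapped.\<close>

lemma nord_mset:
  assumes "mset w = mset w'"
  shows "nord w = nord w'"
  using assms
proof (induction "length w" arbitrary: w w' rule: less_induct)
  case less
  show ?case
  proof (cases w)
    case Nil
    with less.prems show ?thesis by simp
  next
    case (Cons x u)
    show ?thesis
    proof (cases w')
      case Nil
      with less.prems Cons show ?thesis by simp
    next
      case (Cons y u')
      note w = \<open>w = x # u\<close> and w' = \<open>w' = y # u'\<close>
      show ?thesis
      proof (cases "x = y")
        case True
        with less.prems w w' have "mset u = mset u'" by simp
        with less.hyps[of u u'] w w' True show ?thesis by (auto intro: nord_Cons_cong)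
      next
        case False
        with less.prems w w' have y: "y \<in> set u"
          by (metis insert_iff list.set(2) set_mset_mset mset.simps(2) set_mset_add_mset_insert)
        define u2 where "u2 = remove1 y u"
        have u: "mset u = mset (y # u2)" using y by (simp add: u2_def)
        have len: "length (x # u2) < length w" "length u < length w"
          using y w length_pos_if_in_set[OF y] by (auto simp: u2_def length_remove1)
        have "nord w = nord (x # y # u2)"
          using less.hyps[OF len(2) u] w by (auto intro: nord_Cons_cong)
        also have "\<dots> = nord (y # x # u2)" by (intro ext) (rule nord_swap)
        also have "mset (x # u2) = mset u'"
          using less.prems w w' u by (simp add: add_mset_commute)
        from less.hyps[OF len(1) this] have "nord (y # x # u2) = nord (y # u')"
          by (rule nord_Cons_cong)
        finally show ?thesis using w' by simp
      qed
    qed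
  qed
qed

text \<open>The commutator of \<open>a i p\<close> with the current of \<open>i\<close> is p
  z^(p-1), and commuting is a derivation of the normally ordered product. Each occurrence of
  \<open>i\<close> thus yields one copy of the shorter word, with the exponent lowered by
  p-1.\<close>

lemma commutator_nord:
  "a i p (nord w j v) = nord w j (a i p v) +
     (of_int p * of_nat (count_list w i)) \<odot> nord (remove1 i w) (j - p + 1) v"
proof (induction w arbitrary: j v)
  case (Cons b w)
  let ?k = "of_int p * of_nat (count_list w i) :: complex"
  let ?w = "remove1 i w"
  let ?\<delta> = "if i = b then of_int p \<odot> nord w (j - p + 1) v else 0"
  have "\<forall>\<^sub>F R in sequentially. a i p (nord (b # w) j v) =
    nord (b # w) j (a i p v) + ?k \<odot> nord (b # ?w) (j - p + 1) v + ?\<delta>"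
    using eventually_nord_Cons[of b w j v] eventually_nord_Cons[of b w j "a i p v"]
      eventually_nord_Cons[of b ?w "j - p + 1" v] eventually_ge_at_top[of "nat \<bar>p\<bar>"]
  proof eventually_elim
    case (elim R)
    let ?c = "\<lambda>n. if i = b \<and> p + (- int n - 1) = 0 then of_int p \<odot> nord w (j - int n) v else 0"
    let ?d = "\<lambda>n. if i = b \<and> p + int n = 0 then of_int p \<odot> nord w (j + 1 + int n) v else 0"
    have 1: "a i p (a b (- int n - 1) (nord w (j - int n) v)) =
       a b (- int n - 1) (nord w (j - int n) (a i p v)) +
       ?k \<odot> a b (- int n - 1) (nord ?w (j - p + 1 - int n) v) + ?c n" for n
    proof -
      have "j - int n - p + 1 = j - p + 1 - int n" by simp
      then show ?thesis
        by (simp only: commutator[of i p b] Cons[of "j - int n" v] a_add a_scale)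
    qed
    have 2: "a i p (nord w (j + 1 + int n) (a b (int n) v)) =
       nord w (j + 1 + int n) (a b (int n) (a i p v)) +
       ?k \<odot> nord ?w (j - p + 1 + 1 + int n) (a b (int n) v) + ?d n" for n
    proof -
      have "j + 1 + int n - p + 1 = j - p + 1 + 1 + int n" by simp
      moreover have "nord w (j + 1 + int n) (if i = b \<and> p + int n = 0 then of_int p \<odot> v else 0) = ?d n"
        by (simp add: nord_scale)
      ultimately show ?thesis
        by (simp only: Cons commutator[of i p b] nord_add add.assoc add.commute add.left_commute)
    qed
    \<comment> \<open>Only the mode -p can contribute. It sits in the creation half at n = p-1 if p
      is at least 1, and otherwise in the annihilation half at n = -p; the cutoff is at least |p|,
      so this index is in range.\<close>
    have 3: "(\<Sum>n\<le>R. ?c n) + (\<Sum>n\<le>R. ?d n) = ?\<delta>"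
    proof (cases "i = b")
      case True
      show ?thesis
      proof (cases "p \<ge> 1")
        case True
        then have "(\<Sum>n\<le>R. ?d n) = 0" by (intro sum.neutral) auto
        moreover have "(\<Sum>n\<le>R. ?c n) = (\<Sum>n\<le>R. if n = nat (p - 1) then ?\<delta> else 0)"
          using True \<open>i = b\<close> by (intro sum.cong) (auto simp: algebra_simps)
        ultimately show ?thesis using elim(4) True by (auto simp: sum.delta)
      next
        case False
        then have "(\<Sum>n\<le>R. ?c n) = 0" by (intro sum.neutral) auto
        moreover have "(\<Sum>n\<le>R. ?d n) = (\<Sum>n\<le>R. if n = nat (- p) then ?\<delta> else 0)"
          using False \<open>i = b\<close> by (intro sum.cong) (auto simp: algebra_simps)
        ultimately show ?thesis using elim(4) False by (auto simp: sum.delta)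
      qed
    qed simp
    have "a i p (nord (b # w) j v) =
       (\<Sum>n\<le>R. a i p (a b (- int n - 1) (nord w (j - int n) v))) +
       (\<Sum>n\<le>R. a i p (nord w (j + 1 + int n) (a b (int n) v)))"
      by (simp only: elim(1) a_add a_sum)
    also have "\<dots> = nord (b # w) j (a i p v) + ?k \<odot> nord (b # ?w) (j - p + 1) v +
       ((\<Sum>n\<le>R. ?c n) + (\<Sum>n\<le>R. ?d n))"
      unfolding 1 2 elim(2,3) sum.distrib scale_right_distrib scale_sum_right
      by (simp only: add.assoc add.commute add.left_commute)
    finally show ?case unfolding 3 .
  qed
  then have *: "a i p (nord (b # w) j v) =
    nord (b # w) j (a i p v) + ?k \<odot> nord (b # ?w) (j - p + 1) v + ?\<delta>"
    by simp
  show ?case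
  proof (cases "i = b")
    case True
    \<comment> \<open>\<open>i # remove1 i w\<close> is a rearrangement of \<open>w\<close> if
      \<open>i\<close> occurs in it; otherwise the count is 0.\<close>
    have "?k \<odot> nord (i # ?w) (j - p + 1) v = ?k \<odot> nord w (j - p + 1) v"
    proof (cases "i \<in> set w")
      case True
      then have "nord (i # ?w) = nord w" by (intro nord_mset) simp
      then show ?thesis by simp
    qed (simp add: count_notin)
    with * True show ?thesis
      by (simp add: scale_left_distrib algebra_simps)
  next
    case False
    with * show ?thesis by simp
  qed
qed auto

text \<open>The modes in a term of the coefficient of z^j add up to -j - length w, as each current
  is shifted by one, and a mode n lowers the degree by n. At j = -length w the degree is
  preserved.\<close>

lemma nord_graded:
  assumes "\<And>s. subspace (G s)"
    and "\<And>i n s v. i \<in> I \<Longrightarrow> v \<in> G s \<Longrightarrow> a i n v \<in> G (s - n)"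
    and "set w \<subseteq> I" "v \<in> G s"
  shows "nord w j v \<in> G (s + j + int (length w))"
  using assms(3,4)
proof (induction w arbitrary: j v s)
  case Nil
  then show ?case using assms(1)[THEN subspace_0] by simp
next
  case (Cons i w)
  have "\<forall>\<^sub>F R in sequentially. nord (i # w) j v \<in> G (s + j + int (length (i # w)))"
    using eventually_nord_Cons[of i w j v]
  proof eventually_elim
    case (elim R)
    have "a i (- int n - 1) (nord w (j - int n) v) \<in> G (s + j + int (length (i # w)))" for n
      using assms(2)[OF _ Cons.IH[of v s "j - int n"], of i "- int n - 1"] Cons.prems
      by (simp add: algebra_simps)
    moreover have "nord w (j + 1 + int n) (a i (int n) v) \<in> G (s + j + int (length (i # w)))" for n
      using Cons.IH[OF _ assms(2)[of i v s "int n"], of "j + 1 + int n"] Cons.prems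
      by (simp add: algebra_simps)
    ultimately show ?case
      unfolding elim by (intro subspace_add subspace_sum assms(1)) auto
  qed
  then show ?case by simp
qed

lemma nord_singleton: "nord [i] j v = a i (- j - 1) v"
proof -
  have "\<forall>\<^sub>F R in sequentially. nord [i] j v = a i (- j - 1) v"
    using eventually_nord_Cons[of i "[]" j v] eventually_ge_at_top[of "nat \<bar>j\<bar>"]
  proof eventually_elim
    case (elim R)
    show ?case
    proof (cases "j \<ge> 0")
      case True
      have "(\<Sum>n\<le>R. a i (- int n - 1) (nord [] (j - int n) v)) =
          (\<Sum>n\<le>R. if n = nat j then a i (- j - 1) v else 0)"
        by (intro sum.cong) (use True in auto)
      moreover have "(\<Sum>n\<le>R. nord [] (j + 1 + int n) (a i (int n) v)) = 0"
        by (intro sum.neutral) (use True in auto)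
      ultimately show ?thesis using elim True by auto
    next
      case False
      have "(\<Sum>n\<le>R. nord [] (j + 1 + int n) (a i (int n) v)) =
          (\<Sum>n\<le>R. if n = nat (- j - 1) then a i (- j - 1) v else 0)"
        by (intro sum.cong) (use False in auto)
      moreover have "(\<Sum>n\<le>R. a i (- int n - 1) (nord [] (j - int n) v)) = 0"
        by (intro sum.neutral) (use False in auto)
      ultimately show ?thesis using elim False by auto
    qed
  qed
  then show ?thesis by simp
qed

lemma eventually_nord_pair:
  "\<forall>\<^sub>F R in sequentially. nord [i, i] j v =
    (\<Sum>n\<le>R. a i (- int n - 1) (a i (int n - j - 1) v)) +
    (\<Sum>n\<le>R. a i (- j - 2 - int n) (a i (int n) v))"
  using eventually_nord_Cons[of i "[i]" j v]
  by eventually_elim (simp add: nord_singleton algebra_simps)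

end

section \<open>Harmonic polynomials\<close>

lemma diff_single_add_single:
  fixes m :: "'x \<Rightarrow>\<^sub>0 nat"
  assumes "Poly_Mapping.lookup m x > 0"
  shows "m - Poly_Mapping.single x 1 + Poly_Mapping.single x 1 = m"
  by (rule poly_mapping_eqI)
    (use assms in \<open>auto simp: lookup_add lookup_minus lookup_single when_def\<close>)

lemma lookup_pdiff:
  "Poly_Mapping.lookup (pdiff x p) m =
     of_nat (Poly_Mapping.lookup m x + 1) * Poly_Mapping.lookup p (m + Poly_Mapping.single x 1)"
proof -
  let ?m = "m + Poly_Mapping.single x 1"
  have "Poly_Mapping.lookup (pdiff x p) m = (\<Sum>m'\<in>Poly_Mapping.keys p.
      (of_nat (Poly_Mapping.lookup m' x) * Poly_Mapping.lookup p m'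
        when m' - Poly_Mapping.single x 1 = m))"
    by (simp add: pdiff_def lookup_sum lookup_single)
  also have "\<dots> = (\<Sum>m'\<in>Poly_Mapping.keys p.
      if m' = ?m then of_nat (Poly_Mapping.lookup ?m x) * Poly_Mapping.lookup p ?m else 0)"
  proof (intro sum.cong refl)
    fix m'
    \<comment> \<open>Subtraction of exponents is truncated, so a monomial without \<open>x\<close>
      may also be sent to \<open>m\<close>; its coefficient carries the factor 0.\<close>
    show "(of_nat (Poly_Mapping.lookup m' x) * Poly_Mapping.lookup p m'
        when m' - Poly_Mapping.single x 1 = m) =
      (if m' = ?m then of_nat (Poly_Mapping.lookup ?m x) * Poly_Mapping.lookup p ?m else 0)"
      using diff_single_add_single[of m' x] by (cases "Poly_Mapping.lookup m' x = 0")
        (auto simp: when_def lookup_add)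
  qed
  also have "\<dots> = of_nat (Poly_Mapping.lookup ?m x) * Poly_Mapping.lookup p ?m"
    by (auto simp: sum.delta in_keys_iff)
  finally show ?thesis by (simp add: lookup_add)
qed

lemma pdiff_add: "pdiff x (p + q) = pdiff x p + pdiff x q"
  by (rule poly_mapping_eqI) (simp add: lookup_pdiff lookup_add algebra_simps)

lemma pdiff_zero [simp]: "pdiff x 0 = 0"
  by (simp add: pdiff_def)

lemma pdiff_sum: "pdiff x (sum f A) = (\<Sum>y\<in>A. pdiff x (f y))"
  by (induction A rule: infinite_finite_induct) (auto simp: pdiff_add)

lemma pdiff_single:
  "pdiff x (Poly_Mapping.single m c) =
     Poly_Mapping.single (m - Poly_Mapping.single x 1) (of_nat (Poly_Mapping.lookup m x) * c)"
  by (simp add: pdiff_def)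

lemma pdiff_commute: "pdiff x (pdiff y p) = pdiff y (pdiff x p)"
  by (rule poly_mapping_eqI)
    (auto simp: lookup_pdiff lookup_add lookup_single when_def ac_simps)

locale complex_vector_space = vector_space scale
  for scale :: "complex \<Rightarrow> 'b::ab_group_add \<Rightarrow> 'b"
begin

text \<open>Used with values in the Fock module for states and vertex operators, in the complex
  numbers for evaluation, and in power series for traces.\<close>

definition lin_ext :: "('m \<Rightarrow> 'b) \<Rightarrow> ('m \<Rightarrow>\<^sub>0 complex) \<Rightarrow> 'b" where
  "lin_ext t p = (\<Sum>m\<in>Poly_Mapping.keys p. scale (Poly_Mapping.lookup p m) (t m))"

lemma lin_ext_superset:
  assumes "finite A" "Poly_Mapping.keys p \<subseteq> A"
  shows "lin_ext t p = (\<Sum>m\<in>A. scale (Poly_Mapping.lookup p m) (t m))"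
  unfolding lin_ext_def using assms by (intro sum.mono_neutral_left) (auto simp: in_keys_iff)

lemma lin_ext_add: "lin_ext t (p + q) = lin_ext t p + lin_ext t q"
proof -
  let ?A = "Poly_Mapping.keys p \<union> Poly_Mapping.keys q"
  have "lin_ext t (p + q) = (\<Sum>m\<in>?A. scale (Poly_Mapping.lookup (p + q) m) (t m))"
    by (rule lin_ext_superset) (use Poly_Mapping.keys_add[of p q] in auto)
  moreover have "lin_ext t p = (\<Sum>m\<in>?A. scale (Poly_Mapping.lookup p m) (t m))"
    by (rule lin_ext_superset) auto
  moreover have "lin_ext t q = (\<Sum>m\<in>?A. scale (Poly_Mapping.lookup q m) (t m))"
    by (rule lin_ext_superset) auto
  ultimately show ?thesis
    by (simp add: lookup_add scale_left_distrib sum.distrib)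
qed

lemma lin_ext_zero [simp]: "lin_ext t 0 = 0"
  by (simp add: lin_ext_def)

lemma lin_ext_sum: "lin_ext t (sum f A) = (\<Sum>x\<in>A. lin_ext t (f x))"
  by (induction A rule: infinite_finite_induct) (auto simp: lin_ext_add)

lemma lin_ext_single [simp]: "lin_ext t (Poly_Mapping.single m c) = scale c (t m)"
  by (cases "c = 0") (auto simp: lin_ext_def)

end

definition msize :: "('x \<Rightarrow>\<^sub>0 nat) \<Rightarrow> nat" where
  "msize m = (\<Sum>x\<in>Poly_Mapping.keys m. Poly_Mapping.lookup m x)"

lemma msize_add: "msize (m + m') = msize m + msize m'"
  unfolding msize_def by (rule setsum_keys_plus_distrib) auto

lemma msize_superset:
  assumes "finite A" "Poly_Mapping.keys m \<subseteq> A"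
  shows "msize m = (\<Sum>x\<in>A. Poly_Mapping.lookup m x)"
  unfolding msize_def using assms by (intro sum.mono_neutral_left) (auto simp: in_keys_iff)

lemma phomogeneous_iff: "phomogeneous k p \<longleftrightarrow> (\<forall>m\<in>Poly_Mapping.keys p. msize m = k)"
  by (simp add: phomogeneous_def msize_def)

text \<open>Keeps the induction on the degree inside the harmonic polynomials: partial derivatives
  commute, so the Laplacian kills the derivative as well.\<close>

lemma spherical_harmonic_pdiff:
  assumes "spherical_harmonic d (Suc k) P"
  shows "spherical_harmonic d k (pdiff i P)"
  unfolding spherical_harmonic_def
proof (intro conjI)
  have keys: "m + Poly_Mapping.single i 1 \<in> Poly_Mapping.keys P"
    if "m \<in> Poly_Mapping.keys (pdiff i P)" for m
    using that by (auto simp: in_keys_iff lookup_pdiff)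
  have "Poly_Mapping.keys m \<subseteq> {..<d}" if m: "m \<in> Poly_Mapping.keys (pdiff i P)" for m
  proof
    fix x assume "x \<in> Poly_Mapping.keys m"
    then have "x \<in> Poly_Mapping.keys (m + Poly_Mapping.single i 1)"
      by (auto simp: in_keys_iff lookup_add)
    with keys[OF m] assms show "x \<in> {..<d}"
      by (auto simp: spherical_harmonic_def pvars_def)
  qed
  then show "pvars (pdiff i P) \<subseteq> {..<d}" by (auto simp: pvars_def)
  show "phomogeneous k (pdiff i P)"
    unfolding phomogeneous_iff
  proof
    fix m assume "m \<in> Poly_Mapping.keys (pdiff i P)"
    from keys[OF this] assms have "msize (m + Poly_Mapping.single i 1) = Suc k"
      unfolding spherical_harmonic_def phomogeneous_iff by blast
    then show "msize m = k" unfolding msize_add by (simp add: msize_def)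
  qed
  have "(\<Sum>j<d. pdiff j (pdiff j (pdiff i P))) = pdiff i (\<Sum>j<d. pdiff j (pdiff j P))"
    unfolding pdiff_sum by (intro sum.cong refl) (metis pdiff_commute)
  then show "(\<Sum>j<d. pdiff j (pdiff j (pdiff i P))) = 0"
    using assms by (simp add: spherical_harmonic_def)
qed

text \<open>Euler's identity \<open>k P = \<Sum>\<^sub>i x\<^sub>i \<partial>\<^sub>i P\<close> seen through a functional that satisfies
  \<open>t (x\<^sub>i Q) = b\<^sub>i t Q + K (t (\<partial>\<^sub>i Q))\<close>.\<close>

lemma lin_ext_euler:
  fixes scale :: "complex \<Rightarrow> 'b::ab_group_add \<Rightarrow> 'b" and t :: "(nat \<Rightarrow>\<^sub>0 nat) \<Rightarrow> 'b"
  assumes "complex_vector_space scale"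
    and K_add: "\<And>u v. K (u + v) = K u + K v"
    and K_scale: "\<And>c v. K (scale c v) = scale c (K v)"
    and t: "\<And>m i. \<lbrakk>i < d; Poly_Mapping.keys m \<subseteq> {..<d}; Poly_Mapping.lookup m i > 0\<rbrakk> \<Longrightarrow>
       t m = scale (b i) (t (m - Poly_Mapping.single i 1)) +
         scale (of_nat (Poly_Mapping.lookup m i - 1))
           (K (t (m - Poly_Mapping.single i 1 - Poly_Mapping.single i 1)))"
    and P: "pvars P \<subseteq> {..<d}" "phomogeneous k P"
  shows "scale (of_nat k) (complex_vector_space.lin_ext scale t P) =
    (\<Sum>i<d. scale (b i) (complex_vector_space.lin_ext scale t (pdiff i P))) +
    K (complex_vector_space.lin_ext scale t (\<Sum>i<d. pdiff i (pdiff i P)))"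
proof -
  interpret complex_vector_space scale by fact
  have K0: "K 0 = 0" using K_scale[of 0 0] by simp
  have K_sum: "K (sum f A) = (\<Sum>x\<in>A. K (f x))" for f :: "'c \<Rightarrow> 'b" and A
    by (induction A rule: infinite_finite_induct) (auto simp: K0 K_add)
  let ?e = "\<lambda>i. Poly_Mapping.single i 1 :: nat \<Rightarrow>\<^sub>0 nat"
  let ?l = "Poly_Mapping.lookup"
  have A: "lin_ext t (pdiff i P) =
      (\<Sum>m\<in>Poly_Mapping.keys P. scale (of_nat (?l m i) * ?l P m) (t (m - ?e i)))" for i
    unfolding pdiff_def[of i P] by (simp only: lin_ext_sum lin_ext_single)
  have B: "lin_ext t (pdiff i (pdiff i P)) =
      (\<Sum>m\<in>Poly_Mapping.keys P.
         scale (of_nat (?l m i - 1) * (of_nat (?l m i) * ?l P m)) (t (m - ?e i - ?e i)))" for i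
    unfolding pdiff_def[of i P]
    by (simp only: pdiff_sum pdiff_single lin_ext_sum lin_ext_single lookup_minus lookup_single_eq)
  \<comment> \<open>Euler's identity for one monomial: k is the sum of the exponents, and the copies
    of \<open>t m\<close> belonging to \<open>i\<close> are reduced in the variable
    \<open>i\<close>. The exponent times its predecessor is the coefficient of the second
    derivative.\<close>
  have C: "scale (of_nat k * ?l P m) (t m) = (\<Sum>i<d.
      scale (b i) (scale (of_nat (?l m i) * ?l P m) (t (m - ?e i))) +
      K (scale (of_nat (?l m i - 1) * (of_nat (?l m i) * ?l P m)) (t (m - ?e i - ?e i))))"
    if m: "m \<in> Poly_Mapping.keys P" for m
  proof -
    have keys: "Poly_Mapping.keys m \<subseteq> {..<d}" using P(1) m by (auto simp: pvars_def)
    then have "k = (\<Sum>i<d. ?l m i)"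
      using P(2) m msize_superset[of "{..<d}" m] by (auto simp: phomogeneous_iff)
    then have "scale (of_nat k * ?l P m) (t m) = (\<Sum>i<d. scale (of_nat (?l m i) * ?l P m) (t m))"
      by (simp add: sum_distrib_right scale_sum_left)
    also have "\<dots> = (\<Sum>i<d.
      scale (b i) (scale (of_nat (?l m i) * ?l P m) (t (m - ?e i))) +
      K (scale (of_nat (?l m i - 1) * (of_nat (?l m i) * ?l P m)) (t (m - ?e i - ?e i))))"
    proof (intro sum.cong refl)
      fix i assume i: "i \<in> {..<d}"
      show "scale (of_nat (?l m i) * ?l P m) (t m) =
        scale (b i) (scale (of_nat (?l m i) * ?l P m) (t (m - ?e i))) +
        K (scale (of_nat (?l m i - 1) * (of_nat (?l m i) * ?l P m)) (t (m - ?e i - ?e i)))"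
      proof (cases "?l m i = 0")
        case False
        then have "t m = scale (b i) (t (m - ?e i)) +
            scale (of_nat (?l m i - 1)) (K (t (m - ?e i - ?e i)))"
          using i keys by (intro t) auto
        then show ?thesis
          by (simp only: K_scale scale_right_distrib scale_scale) (simp only: ac_simps)
      qed (simp add: K0)
    qed
    finally show ?thesis .
  qed
  have "scale (of_nat k) (lin_ext t P) =
      (\<Sum>m\<in>Poly_Mapping.keys P. scale (of_nat k * ?l P m) (t m))"
    by (simp add: lin_ext_def scale_sum_right)
  also have "\<dots> = (\<Sum>m\<in>Poly_Mapping.keys P. \<Sum>i<d.
      scale (b i) (scale (of_nat (?l m i) * ?l P m) (t (m - ?e i))) +
      K (scale (of_nat (?l m i - 1) * (of_nat (?l m i) * ?l P m)) (t (m - ?e i - ?e i))))"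
    by (intro sum.cong refl C)
  also have "\<dots> = (\<Sum>i<d. scale (b i) (lin_ext t (pdiff i P))) +
      K (lin_ext t (\<Sum>i<d. pdiff i (pdiff i P)))"
    unfolding lin_ext_sum A B K_sum scale_sum_right
    by (subst sum.swap) (simp only: sum.distrib)
  finally show ?thesis .
qed

lemma peval_eq_lin_ext:
  "peval b P = complex_vector_space.lin_ext (*) (\<lambda>m. \<Prod>x\<in>Poly_Mapping.keys m. b x ^ Poly_Mapping.lookup m x) P"
proof -
  interpret complex_vector_space "(*) :: complex \<Rightarrow> complex \<Rightarrow> complex"
    by unfold_locales (auto simp: algebra_simps)
  show ?thesis by (simp add: lin_ext_def peval_def)
qed

text \<open>Evaluation is multiplicative, so it satisfies the recursion of
  \<open>lin_ext_euler\<close> with \<open>K = 0\<close>.\<close>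

lemma peval_euler:
  fixes P :: "nat cpoly"
  assumes "pvars P \<subseteq> {..<d}" "phomogeneous k P"
  shows "of_nat k * peval b P = (\<Sum>i<d. b i * peval b (pdiff i P))"
proof -
  have vs: "complex_vector_space ((*) :: complex \<Rightarrow> complex \<Rightarrow> complex)"
    by unfold_locales (auto simp: algebra_simps)
  let ?t = "\<lambda>m :: nat \<Rightarrow>\<^sub>0 nat. \<Prod>x\<in>Poly_Mapping.keys m. b x ^ Poly_Mapping.lookup m x"
  let ?e = "\<lambda>i. Poly_Mapping.single i 1 :: nat \<Rightarrow>\<^sub>0 nat"
  have t: "?t m = b i * ?t (m - ?e i)" if i: "Poly_Mapping.lookup m i > 0" for m and i :: nat
  proof -
    let ?f = "\<lambda>(m :: nat \<Rightarrow>\<^sub>0 nat) x. b x ^ Poly_Mapping.lookup m x"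
    have i': "i \<in> Poly_Mapping.keys m" using i by (simp add: in_keys_iff)
    have "?t (m - ?e i) = (\<Prod>x\<in>Poly_Mapping.keys m. ?f (m - ?e i) x)"
      by (intro prod.mono_neutral_left) (auto simp: in_keys_iff lookup_minus)
    also have "\<dots> = ?f (m - ?e i) i * (\<Prod>x\<in>Poly_Mapping.keys m - {i}. ?f (m - ?e i) x)"
      using i' by (intro prod.remove) auto
    also have "(\<Prod>x\<in>Poly_Mapping.keys m - {i}. ?f (m - ?e i) x) =
        (\<Prod>x\<in>Poly_Mapping.keys m - {i}. ?f m x)"
      by (intro prod.cong refl) (auto simp: lookup_minus lookup_single when_def)
    also have "b i * (?f (m - ?e i) i * (\<Prod>x\<in>Poly_Mapping.keys m - {i}. ?f m x)) =
        ?f m i * (\<Prod>x\<in>Poly_Mapping.keys m - {i}. ?f m x)"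
      using i by (cases "Poly_Mapping.lookup m i") (auto simp: lookup_minus)
    also have "\<dots> = ?t m"
      using i' by (intro prod.remove[symmetric]) auto
    finally show ?thesis by simp
  qed
  show ?thesis
    using lin_ext_euler[OF vs, of "\<lambda>_. 0" d ?t b P k] t assms
    by (simp add: peval_eq_lin_ext)
qed

text \<open>Without its \<open>K\<close> term the recursion of \<open>lin_ext_euler\<close> becomes
  that of \<open>peval_euler\<close>; the degree is then cancelled as a nonzero scalar.\<close>

lemma lin_ext_spherical_harmonic:
  fixes scale :: "complex \<Rightarrow> 'b::ab_group_add \<Rightarrow> 'b" and t :: "(nat \<Rightarrow>\<^sub>0 nat) \<Rightarrow> 'b"
  assumes "complex_vector_space scale"
    and "\<And>u v. K (u + v) = K u + K v"
    and "\<And>c v. K (scale c v) = scale c (K v)"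
    and "\<And>m i. \<lbrakk>i < d; Poly_Mapping.keys m \<subseteq> {..<d}; Poly_Mapping.lookup m i > 0\<rbrakk> \<Longrightarrow>
       t m = scale (b i) (t (m - Poly_Mapping.single i 1)) +
         scale (of_nat (Poly_Mapping.lookup m i - 1))
           (K (t (m - Poly_Mapping.single i 1 - Poly_Mapping.single i 1)))"
    and "spherical_harmonic d k P"
  shows "complex_vector_space.lin_ext scale t P = scale (peval b P) (t 0)"
  using assms(5)
proof (induction k arbitrary: P)
  interpret complex_vector_space scale by fact
  case 0
  then have "m = 0" if "m \<in> Poly_Mapping.keys P" for m
    using that by (auto simp: spherical_harmonic_def phomogeneous_iff msize_def in_keys_iff
        intro!: poly_mapping_eqI)
  then have keys: "Poly_Mapping.keys P \<subseteq> {0}" by blast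
  have "lin_ext t P = scale (Poly_Mapping.lookup P 0) (t 0)"
    using lin_ext_superset[OF _ keys, of t] by simp
  moreover have "peval b P = Poly_Mapping.lookup P 0"
    unfolding peval_def using keys by (subst sum.mono_neutral_left[of "{0}"]) (auto simp: in_keys_iff)
  ultimately show ?case by simp
next
  interpret complex_vector_space scale by fact
  case (Suc k)
  let ?k = "of_nat (Suc k) :: complex"
  have P: "pvars P \<subseteq> {..<d}" "phomogeneous (Suc k) P" "(\<Sum>i<d. pdiff i (pdiff i P)) = 0"
    using Suc.prems by (auto simp: spherical_harmonic_def)
  have K0: "K 0 = 0" using assms(3)[of 0 0] by simp
  have "scale ?k (lin_ext t P) = (\<Sum>i<d. scale (b i) (lin_ext t (pdiff i P)))"
    using lin_ext_euler[of scale K d t b P "Suc k", OF assms(1-4) P(1,2)] P(3) K0 by simp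
  also have "\<dots> = (\<Sum>i<d. scale (b i) (scale (peval b (pdiff i P)) (t 0)))"
    by (intro sum.cong refl) (simp only: Suc.IH[OF spherical_harmonic_pdiff[OF Suc.prems]])
  also have "\<dots> = scale (\<Sum>i<d. b i * peval b (pdiff i P)) (t 0)"
    by (simp add: scale_sum_left)
  also have "\<dots> = scale ?k (scale (peval b P) (t 0))"
    using peval_euler[OF P(1,2), of b] by simp
  finally show ?case
    by (subst (asm) scale_cancel_left) (simp del: of_nat_Suc)
qed

section \<open>Counting Fock space monomials\<close>

definition mdeg :: "('x \<Rightarrow> nat) \<Rightarrow> ('x \<Rightarrow>\<^sub>0 nat) \<Rightarrow> nat" where
  "mdeg wt m = (\<Sum>x\<in>Poly_Mapping.keys m. wt x * Poly_Mapping.lookup m x)"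

text \<open>The Fock space is the case \<open>wt = snd\<close>: the variable (i, n) stands for a
  creation operator of weight n.\<close>

definition mons :: "('x \<Rightarrow> nat) \<Rightarrow> 'x set \<Rightarrow> nat \<Rightarrow> ('x \<Rightarrow>\<^sub>0 nat) set" where
  "mons wt K N = {m. Poly_Mapping.keys m \<subseteq> K \<and> mdeg wt m = N}"

lemma mdeg_add: "mdeg wt (m + m') = mdeg wt m + mdeg wt m'"
  unfolding mdeg_def by (rule setsum_keys_plus_distrib) (auto simp: algebra_simps)

lemma mdeg_zero [simp]: "mdeg wt 0 = 0"
  by (simp add: mdeg_def)

lemma mdeg_single [simp]: "mdeg wt (Poly_Mapping.single x n) = wt x * n"
  by (cases "n = 0") (auto simp: mdeg_def)

lemma keys_add_nat: "Poly_Mapping.keys (m + m' :: 'x \<Rightarrow>\<^sub>0 nat) = Poly_Mapping.keys m \<union> Poly_Mapping.keys m'"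
  by (auto simp: in_keys_iff lookup_add)

text \<open>Sorting monomials by divisibility by \<open>x\<close> is the recursion behind
  finiteness, behind the generating function and, through \<open>sum_mons_shift\<close>, behind the
  cyclicity of the trace.\<close>

lemma mons_split:
  assumes "x \<in> K"
  shows "mons wt K N = mons wt (K - {x}) N \<union>
    (if wt x \<le> N then (\<lambda>m. m + Poly_Mapping.single x 1) ` mons wt K (N - wt x) else {})"
proof (intro equalityI subsetI)
  fix m assume m: "m \<in> mons wt K N"
  show "m \<in> mons wt (K - {x}) N \<union>
    (if wt x \<le> N then (\<lambda>m. m + Poly_Mapping.single x 1) ` mons wt K (N - wt x) else {})"
  proof (cases "Poly_Mapping.lookup m x = 0")
    case True
    with m show ?thesis by (auto simp: mons_def in_keys_iff)
  next
    case False
    define m' where "m' = m - Poly_Mapping.single x 1"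
    have m_eq: "m = m' + Poly_Mapping.single x 1"
      using False diff_single_add_single[of m x] by (simp add: m'_def)
    have "mdeg wt m' + wt x = N" "Poly_Mapping.keys m' \<subseteq> K"
      using m unfolding m_eq by (auto simp: mons_def mdeg_add keys_add_nat)
    then have "m' \<in> mons wt K (N - wt x)" "wt x \<le> N" by (auto simp: mons_def)
    with m_eq show ?thesis by auto
  qed
next
  fix m assume "m \<in> mons wt (K - {x}) N \<union>
    (if wt x \<le> N then (\<lambda>m. m + Poly_Mapping.single x 1) ` mons wt K (N - wt x) else {})"
  with assms show "m \<in> mons wt K N"
    by (auto simp: mons_def mdeg_add keys_add_nat split: if_splits)
qed

lemma mons_empty: "mons wt {} N = (if N = 0 then {0} else {})"
  by (auto simp: mons_def)

lemma finite_mons: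
  assumes "finite K" "\<And>x. x \<in> K \<Longrightarrow> wt x > 0"
  shows "finite (mons wt K N)"
  using assms
proof (induction K arbitrary: N rule: finite_induct)
  case (insert x K)
  show ?case
  \<comment> \<open>The same variable can be divided out repeatedly; its positive weight makes
    \<open>N\<close> drop each time.\<close>
  proof (induction N rule: less_induct)
    case (less N)
    have "finite (mons wt (insert x K) (N - wt x))" if "wt x \<le> N"
      using that insert.prems[of x] by (intro less) auto
    moreover have "finite (mons wt K N)" using insert by auto
    ultimately show ?case
      using insert.hyps by (subst mons_split[of x]) auto
  qed
qed (auto simp: mons_empty)

text \<open>The split gives G = G' + q^(wt x) G for the series with and without the variable
  \<open>x\<close>: a geometric series summed without division.\<close>

lemma mons_gf_prod:
  assumes "finite K" "\<And>x. x \<in> K \<Longrightarrow> wt x > 0"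
  shows "Abs_fps (\<lambda>N. of_nat (card (mons wt K N))) * (\<Prod>x\<in>K. 1 - fps_X ^ wt x) =
    (1 :: 'a::comm_ring_1 fps)"
  using assms
proof (induction K rule: finite_induct)
  case empty
  show ?case by (rule fps_ext) (auto simp: mons_empty)
next
  case (insert x K)
  let ?G = "\<lambda>K. Abs_fps (\<lambda>N. of_nat (card (mons wt K N))) :: 'a fps"
  let ?e = "Poly_Mapping.single x 1 :: 'b \<Rightarrow>\<^sub>0 nat"
  have "?G (insert x K) = ?G K + fps_X ^ wt x * ?G (insert x K)"
  proof (rule fps_ext)
    fix N
    have fin: "finite (mons wt K' N)" if "K' \<subseteq> insert x K" for K' N
      using that insert by (intro finite_mons) (auto intro: finite_subset)
    have "card (mons wt (insert x K) N) = card (mons wt K N) +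
      (if wt x \<le> N then card (mons wt (insert x K) (N - wt x)) else 0)"
    proof -
      let ?S = "if wt x \<le> N then (\<lambda>m. m + ?e) ` mons wt (insert x K) (N - wt x) else {}"
      have "mons wt (insert x K) N = mons wt K N \<union> ?S"
        using mons_split[of x "insert x K" wt N] insert.hyps by simp
      moreover have "mons wt K N \<inter> ?S = {}"
        using insert.hyps by (auto simp: mons_def keys_add_nat)
      moreover have "card ?S = (if wt x \<le> N then card (mons wt (insert x K) (N - wt x)) else 0)"
        by (auto simp: card_image inj_on_def)
      moreover have "finite ?S" using fin by auto
      ultimately show ?thesis using fin[of K N] by (simp add: card_Un_disjoint subset_insertI)
    qed
    then show "?G (insert x K) $ N = (?G K + fps_X ^ wt x * ?G (insert x K)) $ N"
      by (auto simp: fps_X_power_mult_nth)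
  qed
  then have "?G (insert x K) * (1 - fps_X ^ wt x) = ?G K"
    by (simp add: algebra_simps)
  with insert show ?case
    by (simp add: mult.assoc[symmetric])
qed

section \<open>Euler's product\<close>

abbreviation euler_prod :: "nat \<Rightarrow> complex fps" where
  "euler_prod R \<equiv> \<Prod>n<R. 1 - fps_X ^ Suc n"

lemma euler_prod_nth:
  assumes "N \<le> R"
  shows "euler_prod R $ N = euler_prod N $ N"
  using assms
proof (induction R rule: dec_induct)
  case (step R)
  then show ?case
    by (simp add: right_diff_distrib fps_X_power_mult_right_nth del: power_Suc)
qed simp

lemma prodinf_euler_nth:
  "prodinf (\<lambda>n. 1 - fps_X ^ Suc n :: complex fps) $ N = euler_prod N $ N"
proof -
  \<comment> \<open>The coefficient of q^N is settled after the first N factors, so the diagonal is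
    the limit.\<close>
  define F where "F = Abs_fps (\<lambda>N. euler_prod N $ N)"
  have "(\<lambda>n. \<Prod>i\<le>n. 1 - fps_X ^ Suc (i + 0) :: complex fps) \<longlonglongrightarrow> F"
  proof (rule tendsto_fpsI)
    fix N
    have "(\<Prod>i\<le>n. 1 - fps_X ^ Suc (i + 0) :: complex fps) $ N = F $ N" if "n \<ge> N" for n
      using euler_prod_nth[of N "Suc n"] that
      by (simp add: F_def lessThan_Suc_atMost del: power_Suc prod.lessThan_Suc)
    then show "\<forall>\<^sub>F n in sequentially. (\<Prod>i\<le>n. 1 - fps_X ^ Suc (i + 0) :: complex fps) $ N = F $ N"
      using eventually_sequentially by blast
  qed
  \<comment> \<open>Convergence of an infinite product includes that the limit is nonzero.\<close>
  moreover have "F $ 0 = 1" by (simp add: F_def)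
  then have "F \<noteq> 0" by auto
  ultimately have "(\<lambda>n. 1 - fps_X ^ Suc n :: complex fps) has_prod F"
    unfolding has_prod_def raw_has_prod_def by blast
  then have "prodinf (\<lambda>n. 1 - fps_X ^ Suc n :: complex fps) = F"
    by (metis has_prod_unique)
  then show ?thesis by (simp add: F_def)
qed

lemma fps_mult_nth_cong:
  assumes "\<And>n. n \<le> N \<Longrightarrow> f $ n = f' $ n" "\<And>n. n \<le> N \<Longrightarrow> g $ n = g' $ n"
  shows "(f * g) $ N = (f' * g') $ N"
  unfolding fps_mult_nth using assms by (intro sum.cong) auto

lemma fps_power_nth_cong:
  fixes f g :: "'a::comm_ring_1 fps"
  assumes "\<And>n. n \<le> N \<Longrightarrow> f $ n = g $ n" "n \<le> N"
  shows "(f ^ k) $ n = (g ^ k) $ n"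
  using assms(2)
proof (induction k arbitrary: n)
  case (Suc k)
  then show ?case
    unfolding power_Suc by (intro fps_mult_nth_cong) (auto intro: assms(1))
qed simp

text \<open>A variable of index above N already has weight above N.\<close>

lemma mons_restrict:
  fixes d :: nat
  shows "mons snd ({..<d} \<times> {1..}) N = mons snd ({..<d} \<times> {1..N}) N"
proof -
  have "snd x \<le> mdeg snd m" if "x \<in> Poly_Mapping.keys m" for x :: "nat \<times> nat" and m
  proof -
    have "snd x * 1 \<le> snd x * Poly_Mapping.lookup m x"
      using that by (intro mult_left_mono) (auto simp: in_keys_iff)
    also have "\<dots> \<le> mdeg snd m"
      unfolding mdeg_def using that by (intro member_le_sum) auto
    finally show ?thesis by simp
  qed
  then show ?thesis by (fastforce simp: mons_def)
qed

lemma finite_fock_mons: "finite (mons snd ({..<d :: nat} \<times> {1..}) N)"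
  unfolding mons_restrict by (rule finite_mons) auto

text \<open>Up to q^N only variables of index at most N and the first N factors count, which reduces
  the claim to finitely many variables.\<close>

lemma fock_gf:
  fixes d :: nat
  shows "Abs_fps (\<lambda>N. of_nat (card (mons snd ({..<d} \<times> {1..}) N))) *
     prodinf (\<lambda>n. 1 - fps_X ^ Suc n :: complex fps) ^ d = 1"
proof (rule fps_ext)
  fix N
  have card: "card (mons snd ({..<d} \<times> {1..}) n) = card (mons snd ({..<d} \<times> {1..N}) n)"
    if "n \<le> N" for n
  proof -
    have "mons snd ({..<d} \<times> {1..n}) n \<subseteq> mons snd ({..<d} \<times> {1..N}) n"
      using that by (fastforce simp: mons_def)
    moreover have "mons snd ({..<d} \<times> {1..N}) n \<subseteq> mons snd ({..<d} \<times> {1..}) n"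
      by (auto simp: mons_def)
    ultimately show ?thesis using mons_restrict[of d n] by simp
  qed
  have prod: "prodinf (\<lambda>n. 1 - fps_X ^ Suc n :: complex fps) $ n = euler_prod N $ n"
    if "n \<le> N" for n
    by (simp only: prodinf_euler_nth euler_prod_nth[OF that])
  have "(\<Prod>x\<in>{..<d} \<times> {1..N}. 1 - fps_X ^ snd x :: complex fps) = euler_prod N ^ d"
  proof -
    have "(\<Prod>x\<in>{..<d} \<times> {1..N}. 1 - fps_X ^ snd x :: complex fps) =
        (\<Prod>(i, n)\<in>{..<d} \<times> {1..N}. 1 - fps_X ^ n)"
      by (simp only: case_prod_unfold)
    also have "\<dots> = (\<Prod>i<d. \<Prod>n\<in>{1..N}. 1 - fps_X ^ n)"
      by (rule prod.cartesian_product[symmetric])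
    also have "(\<Prod>n\<in>{1..N}. 1 - fps_X ^ n :: complex fps) = euler_prod N"
      by (rule prod.reindex_bij_witness[of _ Suc "\<lambda>n. n - 1"]) auto
    also have "(\<Prod>i<d. euler_prod N) = euler_prod N ^ d"
      by (simp only: prod_constant card_lessThan)
    finally show ?thesis .
  qed
  with mons_gf_prod[of "{..<d} \<times> {1..N}" snd, where 'a = complex]
  have G: "Abs_fps (\<lambda>n. of_nat (card (mons snd ({..<d} \<times> {1..N}) n))) * euler_prod N ^ d = 1"
    by fastforce
  have "(Abs_fps (\<lambda>N. of_nat (card (mons snd ({..<d} \<times> {1..}) N))) *
     prodinf (\<lambda>n. 1 - fps_X ^ Suc n :: complex fps) ^ d) $ N =
     (Abs_fps (\<lambda>n. of_nat (card (mons snd ({..<d} \<times> {1..N}) n))) * euler_prod N ^ d) $ N"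
    by (intro fps_mult_nth_cong fps_power_nth_cong[where N = N] prod) (simp_all add: card del: One_nat_def)
  then show "(Abs_fps (\<lambda>N. of_nat (card (mons snd ({..<d} \<times> {1..}) N))) *
     prodinf (\<lambda>n. 1 - fps_X ^ Suc n :: complex fps) ^ d) $ N = 1 $ N"
    unfolding G .
qed

section \<open>Series in q^(1/24) and the eta function\<close>

lemma q_series_mult: "q_series (f * g) = q_series f * q_series g"
  by (simp add: q_series_def fps_compose_mult_distrib fls_times_fps_to_fls)

lemma q_series_one [simp]: "q_series 1 = 1"
  by (simp add: q_series_def)

lemma q_series_power: "q_series (f ^ n) = q_series f ^ n"
  by (induction n) (auto simp: q_series_mult)

text \<open>\<open>fls_X\<close> is q^(1/24): the factor q^(-d/24) of the trace function is exactly
  what completes the d-th power of Euler's product to \<open>eta ^ d\<close>.\<close>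

lemma q_series_fock_gf_eta:
  fixes d :: nat
  shows "fls_X powi (- int d) *
     q_series (f * Abs_fps (\<lambda>N. of_nat (card (mons snd ({..<d} \<times> {1..}) N)))) =
   q_series f / eta ^ d"
proof -
  let ?G = "q_series (Abs_fps (\<lambda>N. of_nat (card (mons snd ({..<d} \<times> {1..}) N))))"
  let ?F = "q_series (prodinf (\<lambda>n. 1 - fps_X ^ Suc n))"
  have "?G * ?F ^ d = 1"
    by (simp only: q_series_mult[symmetric] q_series_power[symmetric] fock_gf q_series_one)
  then have GF: "q_series f * ?G * ?F ^ d = q_series f" "?F ^ d \<noteq> 0"
    by (auto simp only: mult.assoc mult_1_right mult_zero_right zero_neq_one)
  have eta: "eta ^ d = fls_X ^ d * ?F ^ d"
    by (simp only: eta_def power_mult_distrib)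
  have "fls_X ^ d \<noteq> (0 :: complex fls)" by simp
  have "fls_X powi (- int d) * q_series (f * Abs_fps (\<lambda>N. of_nat (card (mons snd ({..<d} \<times> {1..}) N)))) =
      inverse (fls_X ^ d) * (q_series f * ?G)"
    by (simp only: q_series_mult power_int_minus power_int_of_nat)
  also have "\<dots> = inverse (fls_X ^ d) * ((q_series f * ?G * ?F ^ d) / ?F ^ d)"
    by (subst nonzero_mult_div_cancel_right[OF GF(2)]) (rule refl)
  also have "\<dots> = q_series f / eta ^ d"
    unfolding GF(1) eta by (simp only: divide_inverse inverse_mult_distrib ac_simps)
  finally show ?thesis .
qed

section \<open>Lattice vectors of bounded norm\<close>

context lattice_voa
begin

section \<open>The form on the lattice\<close>

lemma form_add_right: "form x (y + z) = form x y + form x z"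
  by (metis form_sym form_add)

lemma form_scale_right: "form x (scale r y) = r * form x y"
  by (metis form_sym form_scale)

lemma form_zero [simp]: "form 0 x = 0" "form x 0 = 0"
proof -
  show "form 0 x = 0" using form_scale[of 0 0 x] by simp
  then show "form x 0 = 0" by (simp add: form_sym[of x])
qed

lemma form_sum: "form (sum f A) y = (\<Sum>x\<in>A. form (f x) y)"
  by (induction A rule: infinite_finite_induct) (auto simp: form_add)

lemma form_sum_right: "form y (sum f A) = (\<Sum>x\<in>A. form y (f x))"
  by (simp add: form_sym[of y] form_sum)

lemma form_diff: "form (x - y) z = form x z - form y z"
  using form_add[of "x - y" y z] by simp

lemma form_diff_right: "form x (y - z) = form x y - form x z"
  by (metis form_sym form_diff)

lemma lattice_basis:
  obtains B where "finite B" "independent B"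
    "\<And>m :: 'h \<Rightarrow> int. (\<Sum>b\<in>B. scale (of_int (m b)) b) \<in> L"
    "\<And>x. x \<in> L \<Longrightarrow> \<exists>m :: 'h \<Rightarrow> int. x = (\<Sum>b\<in>B. scale (of_int (m b)) b)"
  using lattice by auto

lemma zero_in_L: "0 \<in> L"
proof -
  obtain B where "\<And>m :: 'h \<Rightarrow> int. (\<Sum>b\<in>B. scale (of_int (m b)) b) \<in> L"
    using lattice_basis by metis
  from this[of "\<lambda>_. 0"] show ?thesis by simp
qed

lemma add_in_L:
  assumes "x \<in> L" "y \<in> L"
  shows "x + y \<in> L"
proof -
  obtain B where B: "\<And>m :: 'h \<Rightarrow> int. (\<Sum>b\<in>B. scale (of_int (m b)) b) \<in> L"
    "\<And>x. x \<in> L \<Longrightarrow> \<exists>m :: 'h \<Rightarrow> int. x = (\<Sum>b\<in>B. scale (of_int (m b)) b)"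
    by (rule lattice_basis) metis
  from B(2)[OF assms(1)] B(2)[OF assms(2)] obtain m m' :: "'h \<Rightarrow> int" where
    "x = (\<Sum>b\<in>B. scale (of_int (m b)) b)" "y = (\<Sum>b\<in>B. scale (of_int (m' b)) b)"
    by blast
  with B(1)[of "\<lambda>b. m b + m' b"] show ?thesis
    by (simp add: scale_left_distrib sum.distrib)
qed

lemma scale_in_L:
  assumes "x \<in> L"
  shows "scale (of_int n) x \<in> L"
proof -
  obtain B where B: "\<And>m :: 'h \<Rightarrow> int. (\<Sum>b\<in>B. scale (of_int (m b)) b) \<in> L"
    "\<And>x. x \<in> L \<Longrightarrow> \<exists>m :: 'h \<Rightarrow> int. x = (\<Sum>b\<in>B. scale (of_int (m b)) b)"
    by (rule lattice_basis) metis
  from B(2)[OF assms] obtain m :: "'h \<Rightarrow> int" where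
    "x = (\<Sum>b\<in>B. scale (of_int (m b)) b)"
    by blast
  with B(1)[of "\<lambda>b. n * m b"] show ?thesis
    by (simp add: scale_sum_right)
qed

text \<open>Gram--Schmidt without denominators.\<close>

lemma integral_orthogonalization:
  assumes "finite S" "S \<subseteq> L" "b \<in> L"
  shows "\<exists>x\<in>L. \<exists>N :: int. N \<noteq> 0 \<and> x - scale (of_int N) b \<in> span S \<and> (\<forall>s\<in>S. form x s = 0)"
  using assms
proof (induction S arbitrary: b rule: finite_induct)
  case empty
  then show ?case by (intro bexI[of _ b] exI[of _ 1]) auto
next
  case (insert u S)
  obtain y N' where y: "y \<in> L" "N' \<noteq> 0" "y - scale (of_int N') u \<in> span S" "\<forall>s\<in>S. form y s = 0"
    using insert.IH[of u] insert.prems by auto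
  obtain x N where x: "x \<in> L" "N \<noteq> 0" "x - scale (of_int N) b \<in> span S" "\<forall>s\<in>S. form x s = 0"
    using insert.IH[of b] insert.prems by auto
  have form_span: "form z w = 0" if "w \<in> span S" "\<forall>s\<in>S. form z s = 0" for z w
    using that(1)
  proof (induction rule: span_induct_alt)
    case (step c x' y')
    then show ?case using that(2) by (simp add: form_add_right form_scale_right)
  qed simp
  \<comment> \<open>\<open>u\<close> is recovered from \<open>y\<close> and an element of
    \<open>span S\<close>, so orthogonality to \<open>S\<close> and \<open>y\<close> implies
    orthogonality to \<open>u\<close>.\<close>
  have u_eq: "u = scale (1 / of_int N') (y - (y - scale (of_int N') u))"
    using y(2) by simp
  have orth_u: "form z u = 0" if "\<forall>s\<in>S. form z s = 0" "form z y = 0" for z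
  proof -
    let ?w = "y - scale (of_int N') u"
    have "form z (scale (of_int N') u) + form z ?w = form z y"
      by (simp flip: form_add_right)
    then have "of_int N' * form z u = 0"
      using form_span[OF y(3) that(1)] that(2) by (simp add: form_scale_right)
    then show ?thesis using y(2) by simp
  qed
  show ?case
  proof (cases "y = 0")
    \<comment> \<open>Here \<open>u\<close> lies in the span of \<open>S\<close>, so whatever is
      orthogonal to \<open>S\<close> is orthogonal to \<open>u\<close>.\<close>
    case True
    have "\<forall>s\<in>insert u S. form x s = 0" using x(4) orth_u[OF x(4)] True by simp
    moreover have "x - scale (of_int N) b \<in> span (insert u S)"
      using x(3) span_mono[of S "insert u S"] by blast
    ultimately show ?thesis using x by blast
  next
    case False
    obtain p where p: "form y y = of_int p" using integral[OF y(1) y(1)] by (auto elim: Ints_cases)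
    obtain q where q: "form x y = of_int q" using integral[OF x(1) y(1)] by (auto elim: Ints_cases)
    have "p \<noteq> 0" using positive_definite[OF y(1) False] p by auto
    \<comment> \<open>The component of \<open>x\<close> orthogonal to \<open>y\<close>, multiplied
      by (y,y) to stay in the lattice.\<close>
    define z where "z = scale (of_int p) x + scale (of_int (- q)) y"
    have "z \<in> L" unfolding z_def by (intro add_in_L scale_in_L x y)
    moreover have zS: "\<forall>s\<in>S. form z s = 0"
      using x(4) y(4) by (simp add: z_def form_add form_scale form_diff)
    moreover have "form z y = 0" by (simp add: z_def form_add form_scale form_diff p q)
    then have "form z u = 0" by (rule orth_u[OF zS])
    moreover have "z - scale (of_int (p * N)) b \<in> span (insert u S)"
    proof -
      have sub: "span S \<subseteq> span (insert u S)" by (rule span_mono) auto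
      have "y \<in> span (insert u S)"
      proof -
        have "y - scale (of_int N') u + scale (of_int N') u \<in> span (insert u S)"
          using y(3) sub by (intro span_add span_scale) (auto intro: span_base)
        then show ?thesis by simp
      qed
      moreover have "z - scale (of_int (p * N)) b =
          scale (of_int p) (x - scale (of_int N) b) + scale (of_int (- q)) y"
        by (simp add: z_def scale_right_diff_distrib algebra_simps)
      ultimately show ?thesis
        using x(3) sub by (metis span_add span_scale subsetD)
    qed
    moreover have "p * N \<noteq> 0" using \<open>p \<noteq> 0\<close> x(2) by simp
    ultimately show ?thesis by (intro bexI[of _ z] exI[of _ "p * N"]) auto
  qed
qed

text \<open>Positivity is available only for lattice vectors, so the usual argument is run on the
  integral combination p y - q x, whose norm is p (p r - q^2).\<close>

lemma lattice_cauchy_schwarz: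
  assumes "x \<in> L" "y \<in> L" "form x x = of_int p" "form y y = of_int r" "form x y = of_int q"
  shows "q\<^sup>2 \<le> p * r"
proof (cases "x = 0")
  case True
  with assms(3-5) show ?thesis by simp
next
  case False
  then have "p > 0" using positive_definite[OF assms(1)] assms(3) by simp
  define z where "z = scale (of_int p) y + scale (of_int (- q)) x"
  have "z \<in> L" unfolding z_def by (intro add_in_L scale_in_L assms)
  then have "Re (form z z) \<ge> 0"
    using positive_definite[of z] by (cases "z = 0") auto
  also have "form z z = of_int (p * (p * r - q\<^sup>2))"
    using assms(3-5) form_sym[of y x]
    by (simp add: z_def form_diff form_diff_right form_add form_add_right form_scale
        form_scale_right algebra_simps power2_eq_square)
  finally have "p * (p * r - q\<^sup>2) \<ge> 0" by (simp only: complex_Re_of_int of_int_0_le_iff)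
  with \<open>p > 0\<close> show ?thesis by (simp add: zero_le_mult_iff)
qed

text \<open>For each basis vector \<open>b\<close> some lattice vector \<open>x\<close> is
  orthogonal to the other basis vectors and has a nonzero integral product with \<open>b\<close>.
  Pairing with \<open>x\<close> isolates the coordinate at \<open>b\<close>, and Cauchy-Schwarz
  bounds it.\<close>

lemma finite_lattice_norm: "finite {\<alpha> \<in> L. form \<alpha> \<alpha> = of_int r}"
proof -
  obtain B where B: "finite B" "independent B"
      "\<And>m :: 'h \<Rightarrow> int. (\<Sum>b\<in>B. scale (of_int (m b)) b) \<in> L"
      "\<And>x. x \<in> L \<Longrightarrow> \<exists>m :: 'h \<Rightarrow> int. x = (\<Sum>b\<in>B. scale (of_int (m b)) b)"
    by (rule lattice_basis) blast
  have BL: "b \<in> L" if "b \<in> B" for b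
  proof -
    have "b = (\<Sum>b'\<in>B. scale (of_int (if b' = b then 1 else 0)) b')"
      using that B(1) by (simp add: if_distrib[of "\<lambda>n. scale (of_int n) _"] sum.delta cong: if_cong)
    with B(3)[of "\<lambda>b'. if b' = b then 1 else 0"] show ?thesis by simp
  qed
  have "\<exists>C :: int. \<forall>m :: 'h \<Rightarrow> int.
      form (\<Sum>b\<in>B. scale (of_int (m b)) b) (\<Sum>b\<in>B. scale (of_int (m b)) b) = of_int r \<longrightarrow>
      \<bar>m b\<bar> \<le> C" if b: "b \<in> B" for b
  proof -
    obtain x N where x: "x \<in> L" "N \<noteq> 0" "x - scale (of_int N) b \<in> span (B - {b})"
        "\<forall>s\<in>B - {b}. form x s = 0"
    proof -
      have "B - {b} \<subseteq> L" using BL by blast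
      from integral_orthogonalization[OF _ this BL[OF b]] B(1) that show ?thesis by blast
    qed
    have "x \<noteq> 0"
    proof
      assume "x = 0"
      with x(3) have "scale (of_int N) b \<in> span (B - {b})" using span_neg by fastforce
      then have "scale (1 / of_int N) (scale (of_int N) b) \<in> span (B - {b})" by (rule span_scale)
      with x(2) have "b \<in> span (B - {b})" by simp
      with B(2) b show False by (auto simp: dependent_def)
    qed
    have form_span: "form x w = 0" if "w \<in> span (B - {b})" for w
      using that
    proof (induction rule: span_induct_alt)
      case (step c x' y')
      then show ?case using x(4) by (simp add: form_add_right form_scale_right)
    qed simp
    obtain p where p: "form x x = of_int p" using integral[OF x(1) x(1)] by (auto elim: Ints_cases)
    obtain q where q: "form x b = of_int q" using integral[OF x(1) BL[OF b]] by (auto elim: Ints_cases)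
    have "form x x = form x (scale (of_int N) b) + form x (x - scale (of_int N) b)"
      by (simp flip: form_add_right)
    then have "form x x = of_int N * form x b" using form_span[OF x(3)] by (simp add: form_scale_right)
    then have "form x b \<noteq> 0" using positive_definite[OF x(1) \<open>x \<noteq> 0\<close>] by auto
    then have "q \<noteq> 0" using q by simp
    show ?thesis
    proof (intro exI[of _ "p * r"] allI impI)
      fix m :: "'h \<Rightarrow> int"
      let ?a = "\<Sum>b\<in>B. scale (of_int (m b)) b"
      assume a: "form ?a ?a = of_int r"
      have "form x ?a = (\<Sum>b'\<in>B. of_int (m b') * form x b')"
        by (simp add: form_sum_right form_scale_right)
      also have "\<dots> = (\<Sum>b'\<in>B. if b' = b then of_int (m b) * form x b else 0)"
        using x(4) by (intro sum.cong) auto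
      also have "\<dots> = of_int (m b * q)" using B(1) b q by simp
      finally have "(m b * q)\<^sup>2 \<le> p * r"
        using B(3) by (intro lattice_cauchy_schwarz[OF x(1) _ p a]) auto
      moreover have "\<bar>m b\<bar> \<le> (m b * q)\<^sup>2"
      proof (cases "m b = 0")
        case False
        have "\<bar>m b\<bar> * 1 \<le> \<bar>m b\<bar> * \<bar>q\<bar>"
          using \<open>q \<noteq> 0\<close> by (intro mult_left_mono) auto
        also have "\<dots> = 1 * \<bar>m b * q\<bar>" by (simp add: abs_mult)
        also have "\<dots> \<le> \<bar>m b * q\<bar> * \<bar>m b * q\<bar>"
        proof (rule mult_right_mono)
          have "m b * q \<noteq> 0" using False \<open>q \<noteq> 0\<close> by simp
          then show "1 \<le> \<bar>m b * q\<bar>" by linarith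
        qed simp
        finally show ?thesis by (simp add: power2_eq_square)
      qed simp
      ultimately show "\<bar>m b\<bar> \<le> p * r" by simp
    qed
  qed
  then obtain C where C: "\<And>b (m :: 'h \<Rightarrow> int). b \<in> B \<Longrightarrow>
      form (\<Sum>b\<in>B. scale (of_int (m b)) b) (\<Sum>b\<in>B. scale (of_int (m b)) b) = of_int r \<Longrightarrow>
      \<bar>m b\<bar> \<le> C b"
    by metis
  let ?F = "\<lambda>m :: 'h \<Rightarrow> int. \<Sum>b\<in>B. scale (of_int (m b)) b"
  have "{\<alpha> \<in> L. form \<alpha> \<alpha> = of_int r} \<subseteq> ?F ` (PiE B (\<lambda>b. {- C b..C b}))"
  proof
    fix \<alpha> assume "\<alpha> \<in> {\<alpha> \<in> L. form \<alpha> \<alpha> = of_int r}"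
    then obtain m where m: "\<alpha> = ?F m" "form \<alpha> \<alpha> = of_int r" using B(4) by blast
    have "restrict m B \<in> PiE B (\<lambda>b. {- C b..C b})"
      using C[of _ m] m by (auto simp: abs_le_iff minus_le_iff)
    moreover have "\<alpha> = ?F (restrict m B)" unfolding m by (intro sum.cong) auto
    ultimately show "\<alpha> \<in> ?F ` (PiE B (\<lambda>b. {- C b..C b}))" by blast
  qed
  moreover have "finite (PiE B (\<lambda>b. {- C b..C b}))" using B(1) by (intro finite_PiE) auto
  ultimately show ?thesis by (meson finite_imageI finite_subset)
qed

lemma form_orthonormal_expand: "form x y = (\<Sum>i<d. form (h i) x * form (h i) y)"
proof -
  have inj: "inj_on h {..<d}"
  proof (rule inj_onI)
    fix i j assume ij: "i \<in> {..<d}" "j \<in> {..<d}" "h i = h j"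
    then show "i = j" using orthonormal[of i i] orthonormal[of i j] by (auto split: if_splits)
  qed
  have expand: "\<exists>r. z = (\<Sum>i<d. scale (r i) (h i))" for z
  proof -
    have "z \<in> span (h ` {..<d})" using orthonormal_span by simp
    then obtain u where "z = (\<Sum>v\<in>h ` {..<d}. scale (u v) v)"
      by (subst (asm) span_finite) auto
    then have "z = (\<Sum>i<d. scale (u (h i)) (h i))"
      by (simp add: sum.reindex[OF inj])
    then show ?thesis by (intro exI[of _ "\<lambda>i. u (h i)"])
  qed
  obtain r where r: "x = (\<Sum>i<d. scale (r i) (h i))" using expand by blast
  have "form (h i) x = r i" if "i < d" for i
  proof -
    have "form (h i) x = (\<Sum>j<d. r j * (if i = j then 1 else 0))"
      unfolding r form_sum_right form_scale_right
      using that by (intro sum.cong) (auto simp: orthonormal)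
    also have "\<dots> = (\<Sum>j<d. if i = j then r j else 0)" by (intro sum.cong) auto
    also have "\<dots> = r i" using that by simp
    finally show ?thesis .
  qed
  then have "(\<Sum>i<d. form (h i) x * form (h i) y) = (\<Sum>i<d. r i * form (h i) y)"
    by (intro sum.cong) auto
  also have "\<dots> = form x y" by (simp add: r form_sum form_scale)
  finally show ?thesis by simp
qed

end

section \<open>Heisenberg modes on the Fock space\<close>

global_interpretation fspace_lin: complex_vector_space
    "vscale :: complex \<Rightarrow> 'h fspace \<Rightarrow> 'h fspace"
  by unfold_locales

definition coef :: "'h fspace \<Rightarrow> 'h \<Rightarrow> (nat \<times> nat \<Rightarrow>\<^sub>0 nat) \<Rightarrow> complex" where
  "coef v \<beta> m = Poly_Mapping.lookup (Poly_Mapping.lookup v \<beta>) m"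

lemma fspace_eqI: "(\<And>\<beta> m. coef v \<beta> m = coef w \<beta> m) \<Longrightarrow> v = w"
  unfolding coef_def by (intro poly_mapping_eqI) auto

lemma coef_zero [simp]: "coef 0 \<beta> m = 0"
  by (simp add: coef_def)

lemma coef_add: "coef (v + w) \<beta> m = coef v \<beta> m + coef w \<beta> m"
  by (simp add: coef_def lookup_add)

lemma coef_sum: "coef (sum f A) \<beta> m = (\<Sum>x\<in>A. coef (f x) \<beta> m)"
  by (simp add: coef_def lookup_sum)

lemma coef_vscale [simp]: "coef (vscale a v) \<beta> m = a * coef v \<beta> m"
  by (simp add: coef_def)

definition fock_vec :: "'h \<Rightarrow> (nat \<times> nat \<Rightarrow>\<^sub>0 nat) \<Rightarrow> 'h fspace" where
  "fock_vec \<beta> m = Poly_Mapping.single \<beta> (Poly_Mapping.single m 1)"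

lemma coef_fock_vec: "coef (fock_vec \<beta> m) \<beta>' m' = (if \<beta> = \<beta>' \<and> m = m' then 1 else 0)"
  by (auto simp: coef_def fock_vec_def lookup_single when_def)

lemma keys_coef: "\<beta> \<in> Poly_Mapping.keys v \<longleftrightarrow> (\<exists>m. coef v \<beta> m \<noteq> 0)"
  by (simp add: in_keys_iff coef_def poly_mapping_eq_iff fun_eq_iff)

lemma lookup_pvar_mult:
  "Poly_Mapping.lookup (pvar x * u) m =
     (if Poly_Mapping.lookup m x = 0 then 0
      else Poly_Mapping.lookup u (m - Poly_Mapping.single x 1))"
proof -
  let ?e = "Poly_Mapping.single x 1 :: 'a \<Rightarrow>\<^sub>0 nat"
  have *: "m = ?e + q \<longleftrightarrow> Poly_Mapping.lookup m x \<noteq> 0 \<and> q = m - ?e" for q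
    using diff_single_add_single[of m x] by (auto simp: add.commute lookup_add)
  have "Poly_Mapping.lookup (pvar x * u) m =
      Sum_any (\<lambda>l. Sum_any (\<lambda>q. Poly_Mapping.lookup u q when m = l + q) when l = ?e)"
    unfolding lookup_mult pvar_def lookup_single
    by (intro Sum_any.cong) (auto simp: when_def)
  also have "\<dots> = Sum_any (\<lambda>q. Poly_Mapping.lookup u q when m = ?e + q)"
    by simp
  also have "\<dots> = (if Poly_Mapping.lookup m x = 0 then 0 else Poly_Mapping.lookup u (m - ?e))"
    unfolding * by (cases "Poly_Mapping.lookup m x = 0") auto
  finally show ?thesis .
qed

text \<open>Multiplication by \<open>x\<close> and \<open>\<partial>/\<partial>x\<close>, read off on coefficient functions of polynomials.\<close>

definition mult_coef :: "'x \<Rightarrow> (('x \<Rightarrow>\<^sub>0 nat) \<Rightarrow> complex) \<Rightarrow> ('x \<Rightarrow>\<^sub>0 nat) \<Rightarrow> complex" where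
  "mult_coef x f m =
     (if Poly_Mapping.lookup m x = 0 then 0 else f (m - Poly_Mapping.single x 1))"

definition diff_coef :: "'x \<Rightarrow> (('x \<Rightarrow>\<^sub>0 nat) \<Rightarrow> complex) \<Rightarrow> ('x \<Rightarrow>\<^sub>0 nat) \<Rightarrow> complex" where
  "diff_coef x f m = of_nat (Poly_Mapping.lookup m x + 1) * f (m + Poly_Mapping.single x 1)"

lemma mult_coef_scale: "mult_coef x (\<lambda>m. r * f m) m = r * mult_coef x f m"
  by (simp add: mult_coef_def)

lemma diff_coef_scale: "diff_coef x (\<lambda>m. r * f m) m = r * diff_coef x f m"
  by (simp add: diff_coef_def)

text \<open>The Leibniz rule, the one source of all nonzero commutators of modes.\<close>

lemma diff_mult_coef:
  "diff_coef x (mult_coef y f) m = mult_coef y (diff_coef x f) m + (if x = y then f m else 0)"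
proof (cases "x = y")
  case True
  then show ?thesis
    using diff_single_add_single[of m x]
    by (cases "Poly_Mapping.lookup m y")
      (auto simp: diff_coef_def mult_coef_def lookup_add lookup_minus algebra_simps)
next
  case False
  have "m + Poly_Mapping.single x 1 - Poly_Mapping.single y 1 =
      m - Poly_Mapping.single y 1 + Poly_Mapping.single x 1"
    using False by (intro poly_mapping_eqI) (auto simp: lookup_add lookup_minus lookup_single when_def)
  with False show ?thesis
    by (simp add: diff_coef_def mult_coef_def lookup_add lookup_minus lookup_single)
qed

lemma mult_coef_commute: "mult_coef x (mult_coef y f) m = mult_coef y (mult_coef x f) m"
proof (cases "x = y")
  case False
  have "m - Poly_Mapping.single x 1 - Poly_Mapping.single y 1 =
      m - Poly_Mapping.single y 1 - Poly_Mapping.single x 1"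
    by (rule poly_mapping_eqI) (auto simp: lookup_minus)
  with False show ?thesis
    by (simp add: mult_coef_def lookup_minus lookup_single)
qed simp

lemma diff_coef_commute: "diff_coef x (diff_coef y f) m = diff_coef y (diff_coef x f) m"
  by (cases "x = y") (auto simp: diff_coef_def lookup_add lookup_single ac_simps)

context lattice_voa
begin

text \<open>\<open>h\<^sub>i(n)\<close>, without the bound \<open>i < d\<close>.\<close>

definition osc :: "nat \<Rightarrow> int \<Rightarrow> 'h fspace \<Rightarrow> 'h fspace" where
  "osc i n v =
     (if n < 0 then Poly_Mapping.map (\<lambda>u. pvar (i, nat (- n)) * u) v
      else if n = 0 then Poly_Mapping.mapp (\<lambda>\<beta> u. pscale (form (h i) \<beta>) u) v
      else Poly_Mapping.map (\<lambda>u. pscale (of_int n) (pdiff (i, nat n) u)) v)"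

lemma coef_osc:
  "coef (osc i n v) \<beta> m =
     (if n < 0 then
        (if Poly_Mapping.lookup m (i, nat (- n)) = 0 then 0
         else coef v \<beta> (m - Poly_Mapping.single (i, nat (- n)) 1))
      else if n = 0 then form (h i) \<beta> * coef v \<beta> m
      else of_int n * of_nat (Poly_Mapping.lookup m (i, nat n) + 1) *
        coef v \<beta> (m + Poly_Mapping.single (i, nat n) 1))"
  by (auto simp: osc_def coef_def Poly_Mapping.map.rep_eq lookup_mapp when_def
      lookup_pvar_mult lookup_pdiff in_keys_iff)

lemma heis_osc:
  assumes "i < d"
  shows "heis (h i) n v = osc i n v"
proof -
  have 1: "(\<Sum>j<d. pscale (form (h i) (h j) * r) (f j)) = pscale r (f i)" for r and f :: "nat \<Rightarrow> fock"
  proof -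
    have "(\<Sum>j<d. pscale (form (h i) (h j) * r) (f j)) = (\<Sum>j<d. if j = i then pscale r (f i) else 0)"
      using assms by (intro sum.cong) (auto simp: orthonormal intro!: poly_mapping_eqI)
    then show ?thesis using assms by simp
  qed
  have 2: "(\<Sum>j<d. pscale (form (h i) (h j)) (f j)) = f i" for f :: "nat \<Rightarrow> fock"
    using 1[of 1 f] by (simp add: pscale_def poly_mapping_eq_iff Poly_Mapping.map.rep_eq when_def fun_eq_iff)
  have "fock_mode (h i) n = (if n < 0 then (\<lambda>u. pvar (i, nat (- n)) * u)
      else (\<lambda>u. pscale (of_int n) (pdiff (i, nat n) u)))"
    by (auto simp: fock_mode_def fun_eq_iff 1 2)
  then show ?thesis
    by (simp add: heis_def osc_def)
qed

lemma keys_osc: "Poly_Mapping.keys (osc i n v) \<subseteq> Poly_Mapping.keys v"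
proof
  fix \<beta> assume "\<beta> \<in> Poly_Mapping.keys (osc i n v)"
  then obtain m where "coef (osc i n v) \<beta> m \<noteq> 0" by (auto simp: keys_coef)
  then show "\<beta> \<in> Poly_Mapping.keys v"
    unfolding keys_coef coef_osc by (metis mult_eq_0_iff)
qed

text \<open>Only finitely many variables occur in \<open>v\<close>; a mode of larger index
  differentiates by an absent variable.\<close>

lemma osc_smooth: "\<exists>N. \<forall>n\<ge>N. osc i n v = 0"
proof -
  define X where "X = (\<Union>\<beta>\<in>Poly_Mapping.keys v. \<Union>m\<in>Poly_Mapping.keys (Poly_Mapping.lookup v \<beta>).
      Poly_Mapping.keys m)"
  have "finite X" by (auto simp: X_def)
  have "osc i n v = 0" if n: "n \<ge> int (Suc (Max (insert 0 (snd ` X))))" for n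
  proof (rule fspace_eqI)
    fix \<beta> and m :: "nat \<times> nat \<Rightarrow>\<^sub>0 nat"
    let ?x = "(i, nat n)"
    have "?x \<notin> X"
    proof
      assume "?x \<in> X"
      then have "nat n \<le> Max (insert 0 (snd ` X))"
        using \<open>finite X\<close> by (intro Max_ge) (auto simp: image_iff intro!: bexI[of _ ?x])
      with n show False by simp
    qed
    have "coef v \<beta> (m + Poly_Mapping.single ?x 1) = 0"
    proof (rule ccontr)
      assume *: "coef v \<beta> (m + Poly_Mapping.single ?x 1) \<noteq> 0"
      have "\<beta> \<in> Poly_Mapping.keys v" unfolding keys_coef using * by (rule exI)
      moreover have "m + Poly_Mapping.single ?x 1 \<in> Poly_Mapping.keys (Poly_Mapping.lookup v \<beta>)"
        using * by (simp add: coef_def in_keys_iff)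
      moreover have "?x \<in> Poly_Mapping.keys (m + Poly_Mapping.single ?x 1)"
        by (simp add: in_keys_iff lookup_add)
      ultimately have "?x \<in> X" unfolding X_def by blast
      with \<open>?x \<notin> X\<close> show False by simp
    qed
    then show "coef (osc i n v) \<beta> m = coef 0 \<beta> m"
      using n by (simp add: coef_osc)
  qed
  then show ?thesis by blast
qed

lemma osc_commutator:
  "osc i p (osc j q v) =
     osc j q (osc i p v) + (if i = j \<and> p + q = 0 then vscale (of_int p) v else 0)"
proof (rule fspace_eqI)
  fix \<beta> m
  let ?r = "\<lambda>i n f m. if n < 0 then mult_coef (i, nat (- n)) f m
      else if n = 0 then form (h i) \<beta> * f m else of_int n * diff_coef (i, nat n) f m"
  have r: "coef (osc i n w) \<beta> = ?r i n (coef w \<beta>)" for i n w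
    by (rule ext) (simp add: coef_osc mult_coef_def diff_coef_def mult.assoc)
  have *: "?r i p (?r j q f) m = ?r j q (?r i p f) m +
      (if i = j \<and> p + q = 0 then of_int p * f m else 0)" for f
  proof -
    consider "p < 0" "q < 0" | "p < 0" "q > 0" | "p > 0" "q < 0" | "p > 0" "q > 0" | "p = 0" | "q = 0"
      by linarith
    then show ?thesis
    proof cases
      case 1
      then show ?thesis
        by (simp add: mult_coef_commute[of "(i, nat (- p))" "(j, nat (- q))"])
    next
      case 2
      then have "(j, nat q) = (i, nat (- p)) \<longleftrightarrow> i = j \<and> p + q = 0" by auto
      \<comment> \<open>Here the Leibniz term arises on the right-hand side with the factor q and is
        cancelled because p = -q.\<close>
      moreover have "complex_of_int q = - of_int p" if "p + q = 0"
        using that by (simp add: add_eq_0_iff2)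
      ultimately show ?thesis
        using 2 by (auto simp: mult_coef_scale diff_mult_coef distrib_left)
    next
      case 3
      then have "(i, nat p) = (j, nat (- q)) \<longleftrightarrow> i = j \<and> p + q = 0" by auto
      with 3 show ?thesis
        by (auto simp: mult_coef_scale diff_mult_coef distrib_left)
    next
      case 4
      then show ?thesis
        by (simp add: diff_coef_scale diff_coef_commute[of "(i, nat p)" "(j, nat q)"])
    qed (auto simp: mult_coef_scale diff_coef_scale)
  qed
  have "coef (osc i p (osc j q v)) \<beta> m = ?r i p (?r j q (coef v \<beta>)) m"
    by (simp only: r)
  also note *
  also have "?r j q (?r i p (coef v \<beta>)) m = coef (osc j q (osc i p v)) \<beta> m"
    by (simp only: r)
  finally show "coef (osc i p (osc j q v)) \<beta> m =
    coef (osc j q (osc i p v) + (if i = j \<and> p + q = 0 then vscale (of_int p) v else 0)) \<beta> m"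
    by (auto simp: coef_add)
qed

sublocale osc: heisenberg_module vscale osc
proof unfold_locales
  show "osc i n (v + w) = osc i n v + osc i n w" for i n v w
    by (rule fspace_eqI) (simp add: coef_osc coef_add algebra_simps)
  show "osc i n (vscale r v) = vscale r (osc i n v)" for i n r v
    by (rule fspace_eqI) (simp add: coef_osc algebra_simps)
  show "osc i m (osc j n v) =
      osc j n (osc i m v) + (if i = j \<and> m + n = 0 then vscale (of_int m) v else 0)" for i m j n v
    by (rule osc_commutator)
  show "\<exists>N. \<forall>n\<ge>N. osc i n v = 0" for i v
    by (rule osc_smooth)
qed

end

section \<open>Vertex operators of vacuum descendants\<close>

lemma ex_word: "\<exists>w. \<forall>x. count_list w x = Poly_Mapping.lookup m x" for m :: "'x \<Rightarrow>\<^sub>0 nat"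
proof -
  have fin: "finite {x. Poly_Mapping.lookup m x > 0}"
    using finite_lookup[of m] by simp
  obtain w where "mset w = Abs_multiset (Poly_Mapping.lookup m)" using ex_mset by blast
  then have "count (mset w) = Poly_Mapping.lookup m" using fin by simp
  then show ?thesis by (intro exI[of _ w]) (metis count_mset)
qed

text \<open>The choice made by \<open>word_of\<close>, for variables of any type; the order is
  harmless by \<open>nord_mset\<close>.\<close>

definition mono_word :: "('x \<Rightarrow>\<^sub>0 nat) \<Rightarrow> 'x list" where
  "mono_word m = (SOME w. \<forall>x. count_list w x = Poly_Mapping.lookup m x)"

lemma count_mono_word [simp]: "count_list (mono_word m) x = Poly_Mapping.lookup m x"
  unfolding mono_word_def using someI_ex[OF ex_word[of m]] by blast

lemma set_mono_word: "set (mono_word m) = Poly_Mapping.keys m"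
  by (auto simp: in_keys_iff count_list_0_iff simp flip: count_mono_word)

lemma mset_eq_count_list: "mset w = mset w' \<longleftrightarrow> (\<forall>x. count_list w x = count_list w' x)"
  by (simp add: multiset_eq_iff count_mset)

lemma length_mono_word: "length (mono_word m) = msize m"
proof -
  have "length (mono_word m) = size (mset (mono_word m))" by simp
  also have "\<dots> = msize m"
    by (simp only: size_multiset_overloaded_eq count_mset set_mset_mset set_mono_word
        count_mono_word msize_def)
  finally show ?thesis .
qed

lemma mset_mono_word_Cons:
  assumes "Poly_Mapping.lookup m i > 0"
  shows "mset (mono_word m) = mset (i # mono_word (m - Poly_Mapping.single i 1))"
  unfolding mset_eq_count_list using assms
  by (auto simp: lookup_minus lookup_single when_def)

text \<open>The monomial of the \<open>h\<^sub>i(-1)\<close> obtained by substituting \<open>h\<^sub>i(-1)\<close> for \<open>x\<^sub>i\<close>.\<close>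

definition emb :: "(nat \<Rightarrow>\<^sub>0 nat) \<Rightarrow> (nat \<times> nat \<Rightarrow>\<^sub>0 nat)" where
  "emb m = (\<Sum>i\<in>Poly_Mapping.keys m. Poly_Mapping.single (i, 1) (Poly_Mapping.lookup m i))"

lemma lookup_emb: "Poly_Mapping.lookup (emb m) x = (if snd x = 1 then Poly_Mapping.lookup m (fst x) else 0)"
proof -
  have "Poly_Mapping.lookup (emb m) x = (\<Sum>i\<in>Poly_Mapping.keys m.
      if i = fst x then (if snd x = 1 then Poly_Mapping.lookup m (fst x) else 0) else 0)"
    unfolding emb_def lookup_sum lookup_single
    by (intro sum.cong) (auto simp: when_def prod_eq_iff)
  then show ?thesis by (auto simp: in_keys_iff)
qed

lemma emb_inject [simp]: "emb m = emb m' \<longleftrightarrow> m = m'"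
proof
  assume "emb m = emb m'"
  then have "Poly_Mapping.lookup (emb m) (i, 1) = Poly_Mapping.lookup (emb m') (i, 1)" for i by simp
  then show "m = m'" by (intro poly_mapping_eqI) (simp add: lookup_emb)
qed simp

lemma keys_emb: "Poly_Mapping.keys (emb m) = (\<lambda>i. (i, 1)) ` Poly_Mapping.keys m"
  by (auto simp: in_keys_iff lookup_emb image_iff split: if_splits)

lemma mdeg_emb: "mdeg snd (emb m) = msize m"
  unfolding mdeg_def keys_emb
  by (subst sum.reindex) (auto simp: inj_on_def lookup_emb msize_def)

lemma emb_diff_single: "emb (m - Poly_Mapping.single i 1) = emb m - Poly_Mapping.single (i, 1) 1"
  by (rule poly_mapping_eqI) (auto simp: lookup_emb lookup_minus lookup_single when_def prod_eq_iff)

lemma mset_word_emb: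
  assumes "\<And>x. count_list w x = Poly_Mapping.lookup (emb m) x"
  shows "w = map (\<lambda>i. (i, 1)) (map fst w)" "mset (map fst w) = mset (mono_word m)"
proof -
  have one: "snd x = 1" if "x \<in> set w" for x
    using assms[of x] that by (auto simp: lookup_emb count_list_0_iff split: if_splits)
  then show w: "w = map (\<lambda>i. (i, 1)) (map fst w)"
    by (auto simp: map_idI prod_eq_iff intro!: map_idI[symmetric])
  have "count_list (map (\<lambda>i. (i, 1 :: nat)) u) (i, 1) = count_list u i" for u :: "nat list" and i
    by (induction u) auto
  then have "count_list (map fst w) i = Poly_Mapping.lookup m i" for i
    using assms[of "(i, 1)"] w by (metis lookup_emb fst_conv snd_conv)
  then show "mset (map fst w) = mset (mono_word m)"
    by (simp only: mset_eq_count_list count_mono_word simp_thms)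
qed

text \<open>The state v_P. Its charge 0 is what frees the vertex operator from exponentials.\<close>

definition creation_state :: "nat cpoly \<Rightarrow> 'h::zero fspace" where
  "creation_state P = Poly_Mapping.single 0
     (\<Sum>m\<in>Poly_Mapping.keys P. Poly_Mapping.single (emb m) (Poly_Mapping.lookup P m))"

lemma creation_state_lin_ext:
  "creation_state P = fspace_lin.lin_ext (\<lambda>m. fock_vec 0 (emb m)) P"
  by (rule fspace_eqI)
    (auto simp: creation_state_def fspace_lin.lin_ext_def coef_sum fock_vec_def coef_def lookup_sum
      lookup_single when_def intro!: sum.cong)

lemma creation_state_zero [simp]: "creation_state 0 = 0"
  by (simp add: creation_state_lin_ext)

lemma creation_state_sum: "creation_state (sum f A) = (\<Sum>x\<in>A. creation_state (f x))"
  by (simp add: creation_state_lin_ext fspace_lin.lin_ext_sum)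

lemma creation_state_single: "creation_state (Poly_Mapping.single m c) = vscale c (fock_vec 0 (emb m))"
  by (simp add: creation_state_lin_ext)

lemma coef_creation_state:
  "coef (creation_state P) \<beta> m' \<noteq> 0 \<longleftrightarrow> \<beta> = 0 \<and> (\<exists>m\<in>Poly_Mapping.keys P. m' = emb m)"
proof -
  have "coef (creation_state P) \<beta> m' = (\<Sum>m\<in>Poly_Mapping.keys P.
      Poly_Mapping.lookup P m * (if 0 = \<beta> \<and> emb m = m' then 1 else 0))"
    by (simp add: creation_state_lin_ext fspace_lin.lin_ext_def coef_sum coef_fock_vec)
  also have "\<dots> = (if \<beta> = 0 then (\<Sum>m\<in>Poly_Mapping.keys P.
      if emb m = m' then Poly_Mapping.lookup P m else 0) else 0)"
    by (auto intro!: sum.cong)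
  finally have *: "coef (creation_state P) \<beta> m' = \<dots>" .
  show ?thesis
  proof (cases "\<exists>m\<in>Poly_Mapping.keys P. m' = emb m")
    case True
    then obtain m where m: "m \<in> Poly_Mapping.keys P" "m' = emb m" by blast
    then show ?thesis unfolding * by (auto simp: in_keys_iff)
  next
    case False
    then have "(\<Sum>m\<in>Poly_Mapping.keys P. if emb m = m' then Poly_Mapping.lookup P m else 0) = 0"
      by (intro sum.neutral) auto
    with False show ?thesis unfolding * by auto
  qed
qed

context lattice_voa
begin

lemma osc_pos_fock_vec:
  assumes "n > 0"
  shows "osc i n (fock_vec \<beta> m) = vscale (of_int n * of_nat (Poly_Mapping.lookup m (i, nat n)))
    (fock_vec \<beta> (m - Poly_Mapping.single (i, nat n) 1))"
proof (rule fspace_eqI)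
  fix \<beta>' m'
  let ?e = "Poly_Mapping.single (i, nat n) 1 :: nat \<times> nat \<Rightarrow>\<^sub>0 nat"
  have "m = m' + ?e \<longleftrightarrow> Poly_Mapping.lookup m (i, nat n) \<noteq> 0 \<and> m - ?e = m'"
    using diff_single_add_single[of m "(i, nat n)"] by (auto simp: lookup_add)
  then show "coef (osc i n (fock_vec \<beta> m)) \<beta>' m' =
    coef (vscale (of_int n * of_nat (Poly_Mapping.lookup m (i, nat n))) (fock_vec \<beta> (m - ?e))) \<beta>' m'"
    using assms by (auto simp: coef_osc coef_fock_vec lookup_add)
qed

lemma osc_zero_fock_vec: "osc i 0 (fock_vec \<beta> m) = vscale (form (h i) \<beta>) (fock_vec \<beta> m)"
  by (rule fspace_eqI) (auto simp: coef_osc coef_fock_vec)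

lemma osc_neg_fock_vec:
  assumes "n < 0"
  shows "osc i n (fock_vec \<beta> m) = fock_vec \<beta> (m + Poly_Mapping.single (i, nat (- n)) 1)"
proof (rule fspace_eqI)
  fix \<beta>' m'
  let ?e = "Poly_Mapping.single (i, nat (- n)) 1 :: nat \<times> nat \<Rightarrow>\<^sub>0 nat"
  have "m + ?e = m' \<longleftrightarrow> Poly_Mapping.lookup m' (i, nat (- n)) \<noteq> 0 \<and> m = m' - ?e"
    using diff_single_add_single[of m' "(i, nat (- n))"] by (auto simp: lookup_add)
  then show "coef (osc i n (fock_vec \<beta> m)) \<beta>' m' = coef (fock_vec \<beta> (m + ?e)) \<beta>' m'"
    using assms by (auto simp: coef_osc coef_fock_vec)
qed

text \<open>Zero modes act by the charge, which is 0, and only variables of index 1 occur, so higher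
  modes differentiate to 0.\<close>

lemma osc_creation_state:
  assumes "n \<ge> 0"
  shows "osc i n (creation_state P) = (if n = 1 then creation_state (pdiff i P) else 0)"
proof -
  have "osc i n (creation_state P) = (\<Sum>m\<in>Poly_Mapping.keys P.
      vscale (Poly_Mapping.lookup P m) (osc i n (fock_vec 0 (emb m))))"
    by (simp add: creation_state_lin_ext fspace_lin.lin_ext_def osc.a_sum osc.a_scale)
  also have "\<dots> = (if n = 1 then creation_state (pdiff i P) else 0)"
  proof -
    consider "n = 0" | "n = 1" | "n > 1" using assms by linarith
    then show ?thesis
    proof cases
      case 1
      then show ?thesis by (simp add: osc_zero_fock_vec)
    next
      case 2
      then show ?thesis
        by (simp add: osc_pos_fock_vec pdiff_def creation_state_sum creation_state_single
            emb_diff_single lookup_emb mult.commute flip: One_nat_def)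
    next
      case 3
      then have "osc i n (fock_vec 0 (emb m)) = 0" for m
        by (subst osc_pos_fock_vec) (auto simp: lookup_emb)
      then show ?thesis using 3 by simp
    qed
  qed
  finally show ?thesis .
qed

lemma heis_zero:
  assumes "n \<noteq> 0"
  shows "heis 0 n v = 0"
proof -
  have "fock_mode 0 n u = 0" for u
    by (rule poly_mapping_eqI) (auto simp: fock_mode_def lookup_sum)
  then show ?thesis
    using assms by (intro poly_mapping_eqI) (simp add: heis_def Poly_Mapping.map.rep_eq when_def)
qed

text \<open>A nonempty composition applies some \<open>X n\<close> with positive n; only the empty
  one, for j = 0, survives.\<close>

lemma exp_coeff_zero:
  assumes "\<And>n w. n > 0 \<Longrightarrow> X n w = 0"
  shows "exp_coeff X j v = (if j = 0 then v else 0)"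
proof -
  have "vscale (1 / fact (length ns)) (foldr X ns v) = 0"
    if "sum_list ns = j" "0 \<notin> set ns" "j \<noteq> 0" for ns
    using that assms by (cases ns) auto
  moreover have "{ns. sum_list ns = 0 \<and> 0 \<notin> set ns} = {[] :: nat list}"
    by (auto simp: neq_Nil_conv) (metis list.set_intros(1) neq_Nil_conv)
  ultimately show ?thesis
    by (auto simp: exp_coeff_def intro!: sum.neutral)
qed

text \<open>For charge 0 both exponentials are 1, and the lattice shift multiplies by the cocycle
  value at (0, beta), which the normalization makes 1 for beta in \<open>L\<close>.\<close>

lemma vertex_exp_zero:
  assumes "Poly_Mapping.keys v \<subseteq> L"
  shows "vertex_exp 0 j v = (if j = 0 then v else 0)"
proof -
  have cr: "exp_creation 0 i = (\<lambda>w. if i = 0 then w else 0)" for i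
    unfolding exp_creation_def fun_eq_iff
    by (auto simp: exp_coeff_zero heis_zero)
  have an: "exp_annihilation 0 i = (\<lambda>w. if i = 0 then w else 0)" for i
    unfolding exp_annihilation_def fun_eq_iff
    by (auto simp: exp_coeff_zero heis_zero)
  have zp: "z_power 0 i v = (if i = 0 then v else 0)" for i
    by (rule poly_mapping_eqI)
      (auto simp: z_power_def lookup_mapp when_def in_keys_iff)
  have shift: "lattice_shift 0 v = v"
  proof -
    have "lattice_shift 0 v = (\<Sum>\<beta>\<in>Poly_Mapping.keys v. Poly_Mapping.single \<beta> (Poly_Mapping.lookup v \<beta>))"
      unfolding lattice_shift_def
    proof (intro sum.cong refl)
      fix \<beta> assume "\<beta> \<in> Poly_Mapping.keys v"
      then have "c 0 \<beta> = 1" using assms cocycle_normalized by blast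
      then show "Poly_Mapping.single (0 + \<beta>) (pscale (c 0 \<beta>) (Poly_Mapping.lookup v \<beta>)) =
          Poly_Mapping.single \<beta> (Poly_Mapping.lookup v \<beta>)"
        by (simp add: pscale_def poly_mapping_eq_iff Poly_Mapping.map.rep_eq lookup_single
            when_def fun_eq_iff)
    qed
    also have "\<dots> = v"
      by (rule poly_mapping_eqI)
        (auto simp: lookup_sum lookup_single when_def in_keys_iff)
    finally show ?thesis .
  qed
  have shift0: "lattice_shift 0 0 = 0" by (simp add: lattice_shift_def)
  show ?thesis
    unfolding vertex_exp_def dist_mult_def cr an zp by (simp add: shift shift0 if_distrib cong: if_cong)
qed

text \<open>The support condition survives the recursion because modes do not change the charge; it
  is consumed by \<open>vertex_exp_zero\<close> at the empty word.\<close>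

lemma vertex_word_nord:
  assumes "set w \<subseteq> {..<d}" "Poly_Mapping.keys v \<subseteq> L"
  shows "vertex_word (map (\<lambda>i. (h i, 1)) w) 0 j v = osc.nord w j v"
  using assms
proof (induction w arbitrary: j v)
  case Nil
  then show ?case by (simp add: vertex_exp_zero)
next
  case (Cons i w)
  have i: "i < d" and w: "set w \<subseteq> {..<d}" using Cons.prems by auto
  have D: "dist_deriv (1 - 1) A = A" for A :: "'h fspace dist"
    by (simp add: dist_deriv_def)
  let ?V = "vertex_word (map (\<lambda>i. (h i, 1)) w) 0"
  have A: "dist_mult (current_creation (h i)) ?V j v =
      Sum_any (\<lambda>l. if l \<ge> 0 then osc i (- l - 1) (osc.nord w (j - l) v) else 0)"
    using Cons.IH[OF w Cons.prems(2)] by (simp add: dist_mult_def current_creation_def heis_osc[OF i] cong: if_cong)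
  have B: "dist_mult ?V (current_annihilation (h i)) j v =
      Sum_any (\<lambda>l. if j - l < 0 then osc.nord w l (osc i (- (j - l) - 1) v) else 0)"
  proof -
    have "?V l (current_annihilation (h i) (j - l) v) =
      (if j - l < 0 then osc.nord w l (osc i (- (j - l) - 1) v) else 0)" for l
    proof -
      have "Poly_Mapping.keys (current_annihilation (h i) (j - l) v) \<subseteq> L"
        using Cons.prems(2) keys_osc[of i "- (j - l) - 1" v]
        by (auto simp: current_annihilation_def heis_osc[OF i])
      then have "?V l (current_annihilation (h i) (j - l) v) =
          osc.nord w l (current_annihilation (h i) (j - l) v)"
        by (rule Cons.IH[OF w])
      then show ?thesis by (simp add: current_annihilation_def heis_osc[OF i])
    qed
    then show ?thesis by (simp only: dist_mult_def)
  qed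
  show ?case
    by (simp only: list.map vertex_word.simps D A B osc.nord.simps(2))
qed

text \<open>\<open>word_of\<close> and \<open>mono_word\<close> list the same factors in possibly
  different orders, which \<open>osc.nord_mset\<close> identifies.\<close>

lemma Y_creation_state:
  assumes "pvars P \<subseteq> {..<d}" "Poly_Mapping.keys w \<subseteq> L"
  shows "Y (creation_state P) j w = fspace_lin.lin_ext (\<lambda>m. osc.nord (mono_word m) j w) P"
proof -
  let ?u = "\<Sum>m\<in>Poly_Mapping.keys P. Poly_Mapping.single (emb m) (Poly_Mapping.lookup P m)"
  let ?V = "\<lambda>m. vertex_word (map (\<lambda>(i, n). (h i, n)) (word_of m)) 0 j w"
  have lookup_u: "Poly_Mapping.lookup ?u (emb m) = Poly_Mapping.lookup P m" for m
    by (simp add: lookup_sum lookup_single when_def in_keys_iff)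
  have keys_u: "Poly_Mapping.keys ?u = emb ` Poly_Mapping.keys P"
  proof (rule set_eqI)
    fix m'
    have "m' \<in> Poly_Mapping.keys ?u \<longleftrightarrow> coef (creation_state P :: 'h fspace) 0 m' \<noteq> 0"
      by (simp add: creation_state_def coef_def in_keys_iff)
    then show "m' \<in> Poly_Mapping.keys ?u \<longleftrightarrow> m' \<in> emb ` Poly_Mapping.keys P"
      by (auto simp: coef_creation_state)
  qed
  have V: "?V (emb m) = osc.nord (mono_word m) j w" if m: "m \<in> Poly_Mapping.keys P" for m
  proof -
    let ?w = "word_of (emb m)"
    have "count_list ?w x = Poly_Mapping.lookup (emb m) x" for x
      unfolding word_of_def using someI_ex[OF ex_word[of "emb m"]] by blast
    note w = mset_word_emb[OF this]
    have "map (\<lambda>(i, n). (h i, n)) ?w = map (\<lambda>i. (h i, 1)) (map fst ?w)"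
      by (subst w(1)) (simp only: map_map comp_def case_prod_conv)
    moreover have "set (map fst ?w) \<subseteq> {..<d}"
      using assms(1) m mset_eq_setD[OF w(2)] by (auto simp: set_mono_word pvars_def)
    ultimately have "?V (emb m) = osc.nord (map fst ?w) j w"
      by (simp only: vertex_word_nord assms(2))
    then show ?thesis by (simp only: osc.nord_mset[OF w(2)])
  qed
  have "Y (creation_state P) j w = (\<Sum>m\<in>Poly_Mapping.keys ?u. vscale (Poly_Mapping.lookup ?u m) (?V m))"
    unfolding Y_def creation_state_def by (cases "?u = 0") simp_all
  also have "\<dots> = (\<Sum>m\<in>Poly_Mapping.keys P. vscale (Poly_Mapping.lookup P m) (?V (emb m)))"
    unfolding keys_u by (subst sum.reindex) (auto simp: inj_on_def lookup_u)
  also have "\<dots> = (\<Sum>m\<in>Poly_Mapping.keys P. vscale (Poly_Mapping.lookup P m) (osc.nord (mono_word m) j w))"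
    by (intro sum.cong refl) (simp only: V)
  finally show ?thesis by (simp only: fspace_lin.lin_ext_def)
qed

end

section \<open>The Virasoro element and primary states\<close>

lemma emb_single: "emb (Poly_Mapping.single i n) = Poly_Mapping.single (i, 1) n"
  by (rule poly_mapping_eqI) (auto simp: lookup_emb lookup_single when_def prod_eq_iff)

context lattice_voa
begin

text \<open>\<open>omega\<close> is itself a creation state, of half the sum of the squares, so
  \<open>Y_creation_state\<close> yields the Virasoro modes too.\<close>

definition casimir :: "nat cpoly" where
  "casimir = (\<Sum>i<d. Poly_Mapping.single (Poly_Mapping.single i 2) (1 / 2))"

lemma omega_eq: "omega = creation_state casimir"
proof -
  have "heis (h i) (- 1) (heis (h i) (- 1) vacuum) = fock_vec 0 (emb (Poly_Mapping.single i 2))"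
    if "i < d" for i
  proof -
    have neg: "osc i (- 1) (fock_vec \<beta> m) = fock_vec \<beta> (m + Poly_Mapping.single (i, 1) 1)" for \<beta> m
      using osc_neg_fock_vec[of "- 1" i \<beta> m] by simp
    have "heis (h i) (- 1) (heis (h i) (- 1) vacuum) = osc i (- 1) (osc i (- 1) (fock_vec 0 0))"
      using that by (simp add: heis_osc vacuum_def fock_vec_def)
    also have "\<dots> = fock_vec 0 (emb (Poly_Mapping.single i 2))"
      by (simp only: neg emb_single add_0_left single_add[symmetric] one_add_one)
    finally show ?thesis .
  qed
  then show ?thesis
    by (simp add: omega_def casimir_def creation_state_sum creation_state_single fspace.scale_sum_right)
qed

lemma Vir_eq:
  assumes "Poly_Mapping.keys v \<subseteq> L"
  shows "Vir n v = vscale (1 / 2) (\<Sum>i<d. osc.nord [i, i] (- n - 2) v)"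
proof -
  have "pvars casimir \<subseteq> {..<d}"
  proof
    fix x assume "x \<in> pvars casimir"
    then obtain m where m: "m \<in> Poly_Mapping.keys casimir" "x \<in> Poly_Mapping.keys m"
      by (auto simp: pvars_def)
    then obtain i where "i < d" "m = Poly_Mapping.single i 2"
      unfolding casimir_def
      using Poly_Mapping.keys_sum[of "\<lambda>i. Poly_Mapping.single (Poly_Mapping.single i 2) (1 / 2)" "{..<d}"]
      by (fastforce split: if_splits)
    with m(2) show "x \<in> {..<d}" by (auto split: if_splits)
  qed
  note Y_creation_state[OF this assms]
  moreover have "osc.nord (mono_word (Poly_Mapping.single i 2)) = osc.nord [i, i]" for i :: nat
    by (rule osc.nord_mset, unfold mset_eq_count_list)
      (simp add: lookup_single when_def)
  moreover have "- (n + 1) - 1 = - n - 2" by simp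
  ultimately show ?thesis
    by (simp only: Vir_def mode_def omega_eq casimir_def fspace_lin.lin_ext_sum
        fspace_lin.lin_ext_single fspace.scale_sum_right)
qed

text \<open>These products are diagonal on monomials: h(-n) h(n) counts the factors h(-n) with
  weight n, and the square of h(0) reads off the charge.\<close>

lemma coef_osc_number:
  "coef (osc i (- int n) (osc i (int n) v)) \<beta> m =
     ((if n = 0 then (form (h i) \<beta>)\<^sup>2 else 0) + of_nat (n * Poly_Mapping.lookup m (i, n))) * coef v \<beta> m"
proof (cases "n = 0")
  case True
  then show ?thesis by (simp add: coef_osc power2_eq_square)
next
  case False
  show ?thesis
  proof (cases "Poly_Mapping.lookup m (i, n)")
    case 0
    then show ?thesis using False by (simp add: coef_osc)
  next
    case (Suc k)
    with False show ?thesis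
      using diff_single_add_single[of m "(i, n)"] by (simp add: coef_osc lookup_minus distrib_left)
  qed
qed

lemma eventually_sum_snd_keys:
  fixes m :: "nat \<times> nat \<Rightarrow>\<^sub>0 nat"
  shows "\<forall>\<^sub>F R in sequentially. (\<Sum>n\<le>R. n * Poly_Mapping.lookup m (i, n)) =
    (\<Sum>x\<in>{x \<in> Poly_Mapping.keys m. fst x = i}. snd x * Poly_Mapping.lookup m x)"
  using eventually_ge_at_top[of "Max (insert 0 (snd ` Poly_Mapping.keys m))"]
proof eventually_elim
  case (elim R)
  let ?X = "{x \<in> Poly_Mapping.keys m. fst x = i}"
  have "(\<Sum>x\<in>?X. snd x * Poly_Mapping.lookup m x) =
      (\<Sum>n\<in>snd ` ?X. n * Poly_Mapping.lookup m (i, n))"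
    by (subst sum.reindex) (auto simp: inj_on_def prod_eq_iff intro!: sum.cong)
  also have "\<dots> = (\<Sum>n\<le>R. n * Poly_Mapping.lookup m (i, n))"
  proof (rule sum.mono_neutral_left)
    show "snd ` ?X \<subseteq> {..R}"
    proof
      fix n assume "n \<in> snd ` ?X"
      then have "n \<le> Max (insert 0 (snd ` Poly_Mapping.keys m))" by (intro Max_ge) auto
      also note elim
      finally show "n \<in> {..R}" by simp
    qed
    show "\<forall>n\<in>{..R} - snd ` ?X. n * Poly_Mapping.lookup m (i, n) = 0"
      by (force simp: in_keys_iff image_iff)
  qed simp
  finally show ?case by simp
qed

text \<open>Both halves of the ordered square consist of terms h(-n) h(n), with n at least 1 in one
  half and at least 0 in the other. Oscillators are thus counted twice and the charge once; the
  factor 1/2 leaves weight n per variable and half the norm of beta.\<close>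

lemma coef_Vir_zero:
  assumes "Poly_Mapping.keys v \<subseteq> L"
  shows "coef (Vir 0 v) \<beta> m = (form \<beta> \<beta> / 2 + of_nat (\<Sum>i<d.
     \<Sum>x\<in>{x \<in> Poly_Mapping.keys m. fst x = i}. snd x * Poly_Mapping.lookup m x)) * coef v \<beta> m"
proof -
  let ?D = "\<lambda>i. \<Sum>x\<in>{x \<in> Poly_Mapping.keys m. fst x = i}. snd x * Poly_Mapping.lookup m x"
  let ?g = "\<lambda>i n. n * Poly_Mapping.lookup m (i, n)"
  have nord: "coef (osc.nord [i, i] (- 2) v) \<beta> m =
      (of_nat (?D i) + (of_nat (?D i) + (form (h i) \<beta>)\<^sup>2)) * coef v \<beta> m" for i
  proof -
    have "\<forall>\<^sub>F R in sequentially. (\<Sum>n\<le>Suc R. ?g i n) = ?D i"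
      using eventually_sum_snd_keys[of m i] by (subst eventually_sequentially_Suc)
    with osc.eventually_nord_pair[of i "- 2" v] eventually_sum_snd_keys[of m i]
    have "\<forall>\<^sub>F R in sequentially. coef (osc.nord [i, i] (- 2) v) \<beta> m =
      (of_nat (?D i) + (of_nat (?D i) + (form (h i) \<beta>)\<^sup>2)) * coef v \<beta> m"
    proof eventually_elim
      case (elim R)
      have "(\<Sum>n\<le>R. ?g i (Suc n)) = ?D i"
        using elim(3) by (simp add: sum.atMost_Suc_shift del: sum.atMost_Suc)
      then have 1: "(\<Sum>n\<le>R. coef (osc i (- int (Suc n)) (osc i (int (Suc n)) v)) \<beta> m) =
          of_nat (?D i) * coef v \<beta> m"
        by (simp only: coef_osc_number sum_distrib_right[symmetric] of_nat_sum[symmetric] nat.simps if_False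
            add_0_left)
      have "(\<Sum>n\<le>R. coef (osc i (- int n) (osc i (int n) v)) \<beta> m) =
          ((\<Sum>n\<le>R. if n = 0 then (form (h i) \<beta>)\<^sup>2 else 0) + of_nat (\<Sum>n\<le>R. ?g i n)) * coef v \<beta> m"
        by (simp only: coef_osc_number sum_distrib_right[symmetric] of_nat_sum sum.distrib)
      also have "(\<Sum>n\<le>R. if n = 0 then (form (h i) \<beta>)\<^sup>2 else 0) = (form (h i) \<beta>)\<^sup>2"
        by (simp add: sum.delta)
      finally have 2: "(\<Sum>n\<le>R. coef (osc i (- int n) (osc i (int n) v)) \<beta> m) =
          ((form (h i) \<beta>)\<^sup>2 + of_nat (?D i)) * coef v \<beta> m"
        by (simp only: elim(2))
      have "- int n - 1 = - int (Suc n)" "int n - (- 2) - 1 = int (Suc n)" "- (- 2) - 2 - int n = - int n" for n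
        by auto
      with elim(1) have "osc.nord [i, i] (- 2) v =
          (\<Sum>n\<le>R. osc i (- int (Suc n)) (osc i (int (Suc n)) v)) +
          (\<Sum>n\<le>R. osc i (- int n) (osc i (int n) v))"
        by (simp only:)
      then show ?case
        by (simp only: coef_add coef_sum 1 2) (simp only: algebra_simps)
    qed
    then show ?thesis by simp
  qed
  have "coef (Vir 0 v) \<beta> m = 1 / 2 * (\<Sum>i<d. coef (osc.nord [i, i] (- 2) v) \<beta> m)"
    using Vir_eq[OF assms, of 0] by (simp add: coef_sum)
  also have "\<dots> = 1 / 2 * ((\<Sum>i<d. of_nat (?D i) + (of_nat (?D i) + (form (h i) \<beta>)\<^sup>2)) * coef v \<beta> m)"
    by (simp only: nord sum_distrib_right)
  also have "\<dots> = (form \<beta> \<beta> / 2 + of_nat (\<Sum>i<d. ?D i)) * coef v \<beta> m"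
    unfolding form_orthonormal_expand[of \<beta> \<beta>] sum.distrib power2_eq_square of_nat_sum[of ?D]
    by (simp only: distrib_right distrib_left) simp
  finally show ?thesis .
qed

section \<open>Weight spaces, zero modes and primary states\<close>

lemma VL_iff:
  "v \<in> VL \<longleftrightarrow> (\<forall>\<beta> m. coef v \<beta> m \<noteq> 0 \<longrightarrow> \<beta> \<in> L \<and> Poly_Mapping.keys m \<subseteq> {..<d} \<times> {1..})"
proof -
  have 1: "Poly_Mapping.keys v \<subseteq> L \<longleftrightarrow> (\<forall>\<beta> m. coef v \<beta> m \<noteq> 0 \<longrightarrow> \<beta> \<in> L)"
    by (auto simp: subset_iff keys_coef)
  have 2: "pvars (Poly_Mapping.lookup v \<beta>) \<subseteq> A \<longleftrightarrow>
      (\<forall>m. coef v \<beta> m \<noteq> 0 \<longrightarrow> Poly_Mapping.keys m \<subseteq> A)" for \<beta> A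
    by (simp add: pvars_def UN_subset_iff Ball_def in_keys_iff coef_def)
  show ?thesis unfolding VL_def mem_Collect_eq 1 2 by blast
qed

text \<open>L(0) is diagonal on monomials, so homogeneity can be read off from each monomial of the
  vector.\<close>

lemma weight_space_iff:
  "v \<in> weight_space M \<longleftrightarrow> (\<forall>\<beta> m. coef v \<beta> m \<noteq> 0 \<longrightarrow> \<beta> \<in> L \<and>
     Poly_Mapping.keys m \<subseteq> {..<d} \<times> {1..} \<and> form \<beta> \<beta> / 2 + of_nat (mdeg snd m) = of_nat M)"
proof -
  have *: "Vir 0 v = vscale (of_nat M) v \<longleftrightarrow>
      (\<forall>\<beta> m. coef v \<beta> m \<noteq> 0 \<longrightarrow> form \<beta> \<beta> / 2 + of_nat (mdeg snd m) = of_nat M)"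
    if v: "v \<in> VL"
  proof -
    have "Poly_Mapping.keys v \<subseteq> L" using v by (simp add: VL_def)
    note Vir = coef_Vir_zero[OF this]
    have "(\<Sum>i<d. \<Sum>x\<in>{x \<in> Poly_Mapping.keys m. fst x = i}. snd x * Poly_Mapping.lookup m x) = mdeg snd m"
      if "coef v \<beta> m \<noteq> 0" for \<beta> m
    proof -
      have "Poly_Mapping.keys m \<subseteq> {..<d} \<times> {1..}" using that v by (simp add: VL_iff)
      then show ?thesis unfolding mdeg_def by (intro sum.group) auto
    qed
    then have Vir: "coef (Vir 0 v) \<beta> m = (form \<beta> \<beta> / 2 + of_nat (mdeg snd m)) * coef v \<beta> m" for \<beta> m
      unfolding Vir by (cases "coef v \<beta> m = 0") auto
    show ?thesis
    proof
      assume "Vir 0 v = vscale (of_nat M) v"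
      then have "coef (Vir 0 v) \<beta> m = of_nat M * coef v \<beta> m" for \<beta> m by simp
      then have "(form \<beta> \<beta> / 2 + of_nat (mdeg snd m)) * coef v \<beta> m = of_nat M * coef v \<beta> m" for \<beta> m
        by (simp only: Vir)
      then show "\<forall>\<beta> m. coef v \<beta> m \<noteq> 0 \<longrightarrow> form \<beta> \<beta> / 2 + of_nat (mdeg snd m) = of_nat M"
        unfolding mult_cancel_right by blast
    next
      assume *: "\<forall>\<beta> m. coef v \<beta> m \<noteq> 0 \<longrightarrow> form \<beta> \<beta> / 2 + of_nat (mdeg snd m) = of_nat M"
      show "Vir 0 v = vscale (of_nat M) v"
      proof (rule fspace_eqI)
        fix \<beta> m
        show "coef (Vir 0 v) \<beta> m = coef (vscale (of_nat M) v) \<beta> m"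
          using * unfolding Vir coef_vscale by (cases "coef v \<beta> m = 0") auto
      qed
    qed
  qed
  then show ?thesis unfolding weight_space_def VL_iff by blast
qed

text \<open>The definite description calls for uniqueness: components of different weights have
  disjoint supports, so nothing can cancel in the sum.\<close>

lemma zero_mode_homogeneous:
  assumes "v \<in> weight_space k"
  shows "zero_mode v w = Y v (- int k) w"
proof -
  have "homogeneous_parts v = Poly_Mapping.single k v"
    unfolding homogeneous_parts_def
  proof (rule the_equality, intro conjI allI)
    fix m
    show "Poly_Mapping.lookup (Poly_Mapping.single k v) m \<in> weight_space m"
      using assms by (auto simp: lookup_single when_def weight_space_iff)
    show "v = (\<Sum>m\<in>Poly_Mapping.keys (Poly_Mapping.single k v).
        Poly_Mapping.lookup (Poly_Mapping.single k v) m)"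
      by simp
  next
    fix f assume f: "(\<forall>m. Poly_Mapping.lookup f m \<in> weight_space m) \<and>
      v = (\<Sum>m\<in>Poly_Mapping.keys f. Poly_Mapping.lookup f m)"
    have zero: "Poly_Mapping.lookup f m = 0" if "m \<noteq> k" for m
    proof (rule fspace_eqI, rule ccontr)
      fix \<beta> x assume "coef (Poly_Mapping.lookup f m) \<beta> x \<noteq> coef 0 \<beta> x"
      then have nz: "coef (Poly_Mapping.lookup f m) \<beta> x \<noteq> 0" by simp
      then have "form \<beta> \<beta> / 2 + of_nat (mdeg snd x) = of_nat m"
        using f weight_space_iff by blast
      have *: "coef (Poly_Mapping.lookup f m') \<beta> x = 0" if "m' \<noteq> m" for m'
      proof (rule ccontr)
        assume "coef (Poly_Mapping.lookup f m') \<beta> x \<noteq> 0"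
        then have "form \<beta> \<beta> / 2 + of_nat (mdeg snd x) = of_nat m'"
          using f weight_space_iff by blast
        with \<open>form \<beta> \<beta> / 2 + of_nat (mdeg snd x) = of_nat m\<close> that show False by simp
      qed
      have "m \<in> Poly_Mapping.keys f" using nz by (auto simp: in_keys_iff)
      have "coef v \<beta> x = (\<Sum>m'\<in>Poly_Mapping.keys f. coef (Poly_Mapping.lookup f m') \<beta> x)"
        using arg_cong[OF conjunct2[OF f], of "\<lambda>v. coef v \<beta> x"] by (simp only: coef_sum)
      also have "\<dots> = (\<Sum>m'\<in>Poly_Mapping.keys f.
          if m' = m then coef (Poly_Mapping.lookup f m) \<beta> x else 0)"
        by (intro sum.cong refl) (use * in auto)
      also have "\<dots> = coef (Poly_Mapping.lookup f m) \<beta> x"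
        using \<open>m \<in> Poly_Mapping.keys f\<close> by simp
      finally have "coef v \<beta> x \<noteq> 0" using nz by simp
      then have "form \<beta> \<beta> / 2 + of_nat (mdeg snd x) = of_nat k"
        using assms weight_space_iff by blast
      with \<open>form \<beta> \<beta> / 2 + of_nat (mdeg snd x) = of_nat m\<close> \<open>m \<noteq> k\<close> show False
        by simp
    qed
    then have "Poly_Mapping.keys f \<subseteq> {k}" by (auto simp: in_keys_iff)
    then have "(\<Sum>m\<in>Poly_Mapping.keys f. Poly_Mapping.lookup f m) = (\<Sum>m\<in>{k}. Poly_Mapping.lookup f m)"
      by (intro sum.mono_neutral_left) (auto simp: in_keys_iff)
    with f have "Poly_Mapping.lookup f k = v" by simp
    with zero show "f = Poly_Mapping.single k v"
      by (intro poly_mapping_eqI) (auto simp: lookup_single when_def)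
  qed
  moreover have "- (int k - 1) - 1 = - int k" by simp
  \<comment> \<open>The zero vector is separate because \<open>Poly_Mapping.single k 0\<close> has
    no keys.\<close>
  ultimately show ?thesis
    by (cases "v = 0") (simp_all add: zero_mode_def mode_def Y_def)
qed

lemma creation_state_weight_space:
  assumes "spherical_harmonic d k P"
  shows "creation_state P \<in> weight_space k"
  unfolding weight_space_iff coef_creation_state
proof (intro allI impI)
  fix \<beta> :: 'h and m' assume "\<beta> = 0 \<and> (\<exists>m\<in>Poly_Mapping.keys P. m' = emb m)"
  then obtain m where m: "m \<in> Poly_Mapping.keys P" "m' = emb m" "\<beta> = 0" by blast
  have "Poly_Mapping.keys m \<subseteq> {..<d}" "msize m = k"
    using assms m(1) by (auto simp: spherical_harmonic_def pvars_def phomogeneous_iff)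
  with m(2,3) show "\<beta> \<in> L \<and> Poly_Mapping.keys m' \<subseteq> {..<d} \<times> {1..} \<and>
      form \<beta> \<beta> / 2 + of_nat (mdeg snd m') = of_nat k"
    by (auto simp: zero_in_L mdeg_emb keys_emb)
qed

lemma primary_creation_state:
  assumes "spherical_harmonic d k P"
  shows "primary (creation_state P)"
  unfolding primary_def
proof (intro conjI allI impI)
  show "\<exists>m. creation_state P \<in> weight_space m"
    using creation_state_weight_space[OF assms] by blast
  fix n :: int assume n: "n \<ge> 1"
  let ?v = "creation_state P :: 'h fspace"
  have pair: "osc.nord [i, i] (- n - 2) ?v = (if n = 2 then creation_state (pdiff i (pdiff i P)) else 0)" for i
  proof -
    have "\<forall>\<^sub>F R in sequentially. osc.nord [i, i] (- n - 2) ?v =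
        (if n = 2 then creation_state (pdiff i (pdiff i P)) else 0)"
      using osc.eventually_nord_pair[of i "- n - 2" ?v] eventually_ge_at_top[of 1]
    proof eventually_elim
      case (elim R)
      \<comment> \<open>The mode is m + n + 1, at least 2, so the creation half vanishes term by
        term.\<close>
      have 1: "osc i (int m - (- n - 2) - 1) ?v = 0" for m
        using n by (subst osc_creation_state) auto
      \<comment> \<open>The outer mode is n - m; only m = 1 leaves a nonzero vector, namely a first
        derivative.\<close>
      have 2: "osc i (- (- n - 2) - 2 - int m) (osc i (int m) ?v) =
          (if m = 1 then osc i (n - 1) (creation_state (pdiff i P)) else 0)" for m
        by (subst osc_creation_state) auto
      have 3: "osc i (n - 1) (creation_state (pdiff i P) :: 'h fspace) =
          (if n = 2 then creation_state (pdiff i (pdiff i P)) else 0)"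
        using n by (subst osc_creation_state) auto
      show ?case
        unfolding elim(1) 1 2 3 using elim(2) by (simp add: sum.delta)
    qed
    then show ?thesis by simp
  qed
  have "Poly_Mapping.keys ?v \<subseteq> L"
    using creation_state_weight_space[OF assms] by (simp add: weight_space_def VL_def)
  then have "Vir n ?v = vscale (1 / 2) (\<Sum>i<d. if n = 2 then creation_state (pdiff i (pdiff i P)) else 0)"
    by (simp only: Vir_eq pair)
  also have "\<dots> = (if n = 2 then vscale (1 / 2) (creation_state (\<Sum>i<d. pdiff i (pdiff i P))) else 0)"
    by (simp add: creation_state_sum)
  also have "\<dots> = 0" using assms by (simp add: spherical_harmonic_def)
  finally show "Vir n ?v = 0" .
qed

end

section \<open>Traces\<close>

context complex_vector_space
begin

text \<open>Expanding each basis in the other turns both traces into the same double sum of products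
  of coefficients.\<close>

lemma trace_basis_change:
  assumes T: "\<And>x y. T (x + y) = T x + T y" "\<And>r x. T (scale r x) = scale r (T x)"
    and B: "finite B" "independent B" "finite B'" "independent B'" "span B = span B'"
    and W: "\<And>x. x \<in> span B \<Longrightarrow> T x \<in> span B"
  shows "(\<Sum>b\<in>B'. representation B' (T b) b) = (\<Sum>b\<in>B. representation B (T b) b)"
proof -
  have T0: "T 0 = 0" using T(2)[of 0 0] by simp
  have T_sum: "T (sum f A) = (\<Sum>x\<in>A. T (f x))" for f :: "'c \<Rightarrow> 'b" and A
    by (induction A rule: infinite_finite_induct) (auto simp: T T0)
  have base: "x \<in> span B" if "x \<in> B'" for x using that B(5) span_base[of x B'] by simp
  have base': "T x \<in> span B'" "T x \<in> span B" if "x \<in> B" for x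
    using W[OF span_base[OF that]] B(5) by auto
  have "(\<Sum>b'\<in>B'. representation B' (T b') b') =
      (\<Sum>b'\<in>B'. \<Sum>b\<in>B. representation B b' b * representation B' (T b) b')"
  proof (intro sum.cong refl)
    fix b' assume "b' \<in> B'"
    then have "b' = (\<Sum>b\<in>B. scale (representation B b' b) b)"
      using sum_representation_eq[OF B(2) base B(1)] by simp
    then have "T b' = (\<Sum>b\<in>B. scale (representation B b' b) (T b))"
      by (metis (no_types, lifting) T(2) T_sum sum.cong)
    then show "representation B' (T b') b' = (\<Sum>b\<in>B. representation B b' b * representation B' (T b) b')"
      by (simp add: representation_sum[OF B(4)] representation_scale[OF B(4)] base' span_scale)
  qed
  also have "\<dots> = (\<Sum>b\<in>B. \<Sum>b'\<in>B'. representation B' (T b) b' * representation B b' b)"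
    by (subst sum.swap) (simp only: mult.commute)
  also have "\<dots> = (\<Sum>b\<in>B. representation B (T b) b)"
  proof (intro sum.cong refl)
    fix b assume b: "b \<in> B"
    have "T b = (\<Sum>b'\<in>B'. scale (representation B' (T b) b') b')"
      using sum_representation_eq[OF B(4) base'(1)[OF b] B(3)] by simp
    then have "representation B (T b) b =
        representation B (\<Sum>b'\<in>B'. scale (representation B' (T b) b') b') b" by simp
    also have "\<dots> = (\<Sum>b'\<in>B'. representation B' (T b) b' * representation B b' b)"
      by (simp add: representation_sum[OF B(2)] representation_scale[OF B(2)] base span_scale)
    finally show "(\<Sum>b'\<in>B'. representation B' (T b) b' * representation B b' b) =
        representation B (T b) b" by simp
  qed
  finally show ?thesis .
qed

text \<open>\<open>trace_on\<close> picks an unknown basis, and the formula for the operator is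
  known only on \<open>W\<close>; a globally linear \<open>S\<close> that agrees with
  \<open>T\<close> there takes its place.\<close>

lemma trace_on_eq:
  assumes S: "\<And>x y. S (x + y) = S x + S y" "\<And>r x. S (scale r x) = scale r (S x)"
    and B: "finite B" "independent B" "span B = W"
    and ST: "\<And>x. x \<in> W \<Longrightarrow> T x = S x" "\<And>x. x \<in> W \<Longrightarrow> S x \<in> W"
  shows "trace_on W T = (\<Sum>b\<in>B. representation B (S b) b)"
proof -
  define B' where "B' = (SOME B. independent B \<and> span B = W)"
  have B': "independent B'" "span B' = W"
    using someI[of "\<lambda>B. independent B \<and> span B = W" B] B by (auto simp: B'_def)
  then have "finite B'"
    using independent_span_bound[OF B(1), of B'] span_superset[of B'] B(3) by auto
  have "trace_on W T = (\<Sum>b\<in>B'. representation B' (T b) b)"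
    by (simp add: trace_on_def B'_def Let_def)
  also have "\<dots> = (\<Sum>b\<in>B'. representation B' (S b) b)"
    using B'(2) by (intro sum.cong refl) (metis ST(1) span_base)
  also have "\<dots> = (\<Sum>b\<in>B. representation B (S b) b)"
    by (rule trace_basis_change) (use S B B' ST(2) \<open>finite B'\<close> in auto)
  finally show ?thesis .
qed

end

text \<open>As \<open>F\<close> vanishes on monomials without \<open>x\<close>, the sum lives on
  multiples of \<open>x\<close>, and dividing by \<open>x\<close> lowers the weight. This is the
  source of the factor q^n in the trace.\<close>

lemma sum_mons_shift:
  assumes "x \<in> K" "finite (mons wt K N)" "\<And>m. Poly_Mapping.lookup m x = 0 \<Longrightarrow> F m = 0"
  shows "(\<Sum>m\<in>mons wt K N. F m) =
    (if wt x \<le> N then \<Sum>m\<in>mons wt K (N - wt x). F (m + Poly_Mapping.single x 1) else 0)"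
proof -
  let ?S = "if wt x \<le> N then (\<lambda>m. m + Poly_Mapping.single x 1) ` mons wt K (N - wt x) else {}"
  have *: "mons wt K N = mons wt (K - {x}) N \<union> ?S" by (rule mons_split[OF assms(1)])
  have "(\<Sum>m\<in>mons wt K N. F m) = (\<Sum>m\<in>?S. F m)"
  proof (rule sum.mono_neutral_right[OF assms(2)])
    show "?S \<subseteq> mons wt K N" using * by blast
    show "\<forall>m\<in>mons wt K N - ?S. F m = 0"
    proof
      fix m assume "m \<in> mons wt K N - ?S"
      then have "m \<in> mons wt (K - {x}) N" using * by blast
      then show "F m = 0" by (intro assms(3)) (auto simp: mons_def in_keys_iff)
    qed
  qed
  also have "\<dots> = (if wt x \<le> N then \<Sum>m\<in>mons wt K (N - wt x). F (m + Poly_Mapping.single x 1) else 0)"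
    by (auto simp: sum.reindex inj_on_def)
  finally show ?thesis .
qed

context lattice_voa
begin

section \<open>A basis of each weight space\<close>

abbreviation fock_mons :: "nat \<Rightarrow> (nat \<times> nat \<Rightarrow>\<^sub>0 nat) set" where
  "fock_mons N \<equiv> mons snd ({..<d} \<times> {1..}) N"

definition shell :: "nat \<Rightarrow> 'h set" where
  "shell j = {\<alpha>. \<alpha> \<in> L \<and> form \<alpha> \<alpha> / 2 = of_nat j}"

lemma finite_shell: "finite (shell j)"
proof -
  have "shell j = {\<alpha> \<in> L. form \<alpha> \<alpha> = of_int (2 * int j)}"
    by (auto simp: shell_def field_simps)
  then show ?thesis by (simp only: finite_lattice_norm)
qed

text \<open>Evenness makes half the norm an integer, positivity makes it nonnegative.\<close>

lemma lattice_shell: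
  assumes "\<alpha> \<in> L"
  shows "\<exists>j. \<alpha> \<in> shell j"
proof -
  obtain k :: int where k: "form \<alpha> \<alpha> = of_int (2 * k)" using form_even[OF assms] by blast
  have "0 \<le> Re (form \<alpha> \<alpha>)" using positive_definite[OF assms] by (cases "\<alpha> = 0") auto
  also have "Re (form \<alpha> \<alpha>) = of_int (2 * k)" unfolding k by (rule complex_Re_of_int)
  finally have "k \<ge> 0" by (simp only: of_int_0_le_iff)
  then have "form \<alpha> \<alpha> / 2 = of_nat (nat k)" using k by simp
  with assms show ?thesis by (auto simp: shell_def)
qed

definition weight_index :: "nat \<Rightarrow> ('h \<times> (nat \<times> nat \<Rightarrow>\<^sub>0 nat)) set" where
  "weight_index M = (\<Union>j\<le>M. shell j \<times> fock_mons (M - j))"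

lemma finite_weight_index: "finite (weight_index M)"
  unfolding weight_index_def using finite_shell finite_fock_mons by blast

lemma weight_index_iff:
  "(\<beta>, m) \<in> weight_index M \<longleftrightarrow> \<beta> \<in> L \<and> Poly_Mapping.keys m \<subseteq> {..<d} \<times> {1..} \<and>
     form \<beta> \<beta> / 2 + of_nat (mdeg snd m) = of_nat M"
proof
  assume "(\<beta>, m) \<in> weight_index M"
  then obtain j where "j \<le> M" "\<beta> \<in> shell j" "m \<in> fock_mons (M - j)"
    by (auto simp: weight_index_def)
  then show "\<beta> \<in> L \<and> Poly_Mapping.keys m \<subseteq> {..<d} \<times> {1..} \<and>
     form \<beta> \<beta> / 2 + of_nat (mdeg snd m) = of_nat M"
    by (auto simp: shell_def mons_def of_nat_diff)
next
  assume *: "\<beta> \<in> L \<and> Poly_Mapping.keys m \<subseteq> {..<d} \<times> {1..} \<and>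
     form \<beta> \<beta> / 2 + of_nat (mdeg snd m) = of_nat M"
  then obtain j where j: "\<beta> \<in> shell j" using lattice_shell by blast
  then have "of_nat (j + mdeg snd m) = (of_nat M :: complex)" using * by (simp add: shell_def)
  then have "j + mdeg snd m = M" by (simp only: of_nat_eq_iff)
  with j * show "(\<beta>, m) \<in> weight_index M"
    by (auto simp: weight_index_def mons_def intro!: bexI[of _ j])
qed

lemma weight_space_index:
  "v \<in> weight_space M \<longleftrightarrow> (\<forall>\<beta> m. coef v \<beta> m \<noteq> 0 \<longrightarrow> (\<beta>, m) \<in> weight_index M)"
  by (simp only: weight_space_iff weight_index_iff)

lemma trace_on_weight_space:
  assumes S: "\<And>x y. S (x + y) = S x + S y" "\<And>r x. S (vscale r x) = vscale r (S x)"
    and ST: "\<And>x. x \<in> weight_space M \<Longrightarrow> T x = S x"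
      "\<And>x. x \<in> weight_space M \<Longrightarrow> S x \<in> weight_space M"
  shows "fspace.trace_on (weight_space M) T =
    (\<Sum>(\<beta>, m)\<in>weight_index M. coef (S (fock_vec \<beta> m)) \<beta> m)"
proof -
  define B where "B = (\<lambda>(\<beta>, m). fock_vec \<beta> m) ` weight_index M"
  have inj: "inj_on (\<lambda>(\<beta>, m). fock_vec \<beta> m) A" for A :: "('h \<times> (nat \<times> nat \<Rightarrow>\<^sub>0 nat)) set"
  proof (rule inj_onI, clarify)
    fix \<beta> \<beta>' :: 'h and m m' assume "fock_vec \<beta> m = fock_vec \<beta>' m'"
    then have "coef (fock_vec \<beta> m) \<beta>' m' = coef (fock_vec \<beta>' m') \<beta>' m'" by simp
    then show "\<beta> = \<beta>' \<and> m = m'" by (auto simp: coef_fock_vec split: if_splits)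
  qed
  have "finite B" by (simp add: B_def finite_weight_index)
  have coef_B: "coef y \<beta> m = (if y = fock_vec \<beta> m then 1 else 0)" if "y \<in> B" for y \<beta> m
    using that by (auto simp: B_def coef_fock_vec)
  have coef_sum_B: "coef (\<Sum>y\<in>B. vscale (f y) y) \<beta> m =
      (if fock_vec \<beta> m \<in> B then f (fock_vec \<beta> m) else 0)" for f \<beta> m
  proof -
    have "coef (\<Sum>y\<in>B. vscale (f y) y) \<beta> m = (\<Sum>y\<in>B. if y = fock_vec \<beta> m then f y else 0)"
      by (auto simp: coef_sum coef_B intro!: sum.cong)
    then show ?thesis using \<open>finite B\<close> by simp
  qed
  have mem_B: "fock_vec \<beta> m \<in> B \<longleftrightarrow> (\<beta>, m) \<in> weight_index M" for \<beta> m
    using inj[of UNIV] by (auto simp: B_def inj_on_def)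
  have indep: "fspace.independent B"
  proof (rule fspace.independent_if_scalars_zero[OF \<open>finite B\<close>])
    fix f x assume eq: "(\<Sum>x\<in>B. vscale (f x) x) = 0" and x: "x \<in> B"
    then obtain \<beta> m where "x = fock_vec \<beta> m" by (auto simp: B_def)
    with coef_sum_B[of f \<beta> m] eq x show "f x = 0" by simp
  qed
  have span: "fspace.span B = weight_space M"
  proof (intro equalityI subsetI)
    fix v assume "v \<in> fspace.span B"
    then obtain f where "v = (\<Sum>y\<in>B. vscale (f y) y)"
      unfolding fspace.span_finite[OF \<open>finite B\<close>] by blast
    then show "v \<in> weight_space M"
      by (auto simp: weight_space_index coef_sum_B mem_B split: if_splits)
  next
    fix v assume v: "v \<in> weight_space M"
    have "v = (\<Sum>(\<beta>, m)\<in>weight_index M. vscale (coef v \<beta> m) (fock_vec \<beta> m))"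
    proof (rule fspace_eqI)
      fix \<beta> m
      have "coef (\<Sum>(\<beta>, m)\<in>weight_index M. vscale (coef v \<beta> m) (fock_vec \<beta> m)) \<beta> m =
        (\<Sum>x\<in>weight_index M. if x = (\<beta>, m) then coef v \<beta> m else 0)"
        unfolding coef_sum
        by (intro sum.cong refl) (auto simp: coef_fock_vec split: if_splits)
      also have "\<dots> = coef v \<beta> m"
        using v finite_weight_index by (auto simp: weight_space_index)
      finally show "coef v \<beta> m =
          coef (\<Sum>(\<beta>, m)\<in>weight_index M. vscale (coef v \<beta> m) (fock_vec \<beta> m)) \<beta> m" by simp
    qed
    also have "\<dots> \<in> fspace.span B"
      by (rule fspace.span_sum)
        (auto simp: mem_B intro: fspace.span_scale[OF fspace.span_base])
    finally show "v \<in> fspace.span B" .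
  qed
  have "fspace.trace_on (weight_space M) T = (\<Sum>b\<in>B. fspace.representation B (S b) b)"
    by (rule fspace_lin.trace_on_eq) (use S ST \<open>finite B\<close> indep span in auto)
  also have "\<dots> = (\<Sum>(\<beta>, m)\<in>weight_index M. fspace.representation B (S (fock_vec \<beta> m)) (fock_vec \<beta> m))"
    unfolding B_def by (subst sum.reindex[OF inj]) (simp add: case_prod_unfold)
  also have "\<dots> = (\<Sum>(\<beta>, m)\<in>weight_index M. coef (S (fock_vec \<beta> m)) \<beta> m)"
  proof (intro sum.cong refl, clarify)
    fix \<beta> m assume \<beta>m: "(\<beta>, m) \<in> weight_index M"
    then have "fock_vec \<beta> m \<in> B" by (simp add: mem_B)
    then have "S (fock_vec \<beta> m) \<in> fspace.span B"
      unfolding span by (intro ST(2)) (use fspace.span_base span in blast)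
    then have "S (fock_vec \<beta> m) =
        (\<Sum>b\<in>B. vscale (fspace.representation B (S (fock_vec \<beta> m)) b) b)"
      using fspace.sum_representation_eq[OF indep _ \<open>finite B\<close>] by simp
    with coef_sum_B[of "fspace.representation B (S (fock_vec \<beta> m))" \<beta> m] \<open>fock_vec \<beta> m \<in> B\<close>
    show "fspace.representation B (S (fock_vec \<beta> m)) (fock_vec \<beta> m) = coef (S (fock_vec \<beta> m)) \<beta> m"
      by simp
  qed
  finally show ?thesis .
qed

text \<open>The trace over oscillator degree \<open>N\<close> at charge beta, written through
  diagonal coefficients so that it makes sense for every \<open>A\<close>, also one that shifts the
  degree.\<close>

definition fock_trace :: "'h \<Rightarrow> nat \<Rightarrow> ('h fspace \<Rightarrow> 'h fspace) \<Rightarrow> complex" where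
  "fock_trace \<beta> N A = (\<Sum>m\<in>fock_mons N. coef (A (fock_vec \<beta> m)) \<beta> m)"

section \<open>Cyclicity of the trace and contractions\<close>

lemma fock_trace_add: "fock_trace \<beta> N (\<lambda>v. A v + B v) = fock_trace \<beta> N A + fock_trace \<beta> N B"
  by (simp add: fock_trace_def coef_add sum.distrib)

lemma fock_trace_vscale: "fock_trace \<beta> N (\<lambda>v. vscale r (A v)) = r * fock_trace \<beta> N A"
  by (simp add: fock_trace_def sum_distrib_left)

text \<open>The coefficient of h(-n) A at m is that of A at m with one factor (i,n) removed. Writing
  m as m' times this factor, the basis vector of m is h(-n) applied to that of m'.\<close>

lemma fock_trace_creation:
  assumes "i < d" "n \<ge> 1"
  shows "fock_trace \<beta> N (\<lambda>v. osc i (- int n) (A v)) =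
    (if n \<le> N then fock_trace \<beta> (N - n) (\<lambda>v. A (osc i (- int n) v)) else 0)"
  unfolding fock_trace_def using assms
  by (subst sum_mons_shift[of "(i, n)"])
    (auto simp: finite_fock_mons coef_osc osc_neg_fock_vec lookup_add simp del: One_nat_def)

text \<open>Differentiating the basis vector of m' times (i,n), and extracting the coefficient of m'
  after a derivative, produce the same factor: n times one more than the exponent of (i,n) in
  m'.\<close>

lemma fock_trace_annihilation:
  assumes "i < d" "n \<ge> 1" and A: "\<And>r v. A (vscale r v) = vscale r (A v)"
  shows "fock_trace \<beta> N (\<lambda>v. A (osc i (int n) v)) =
    (if n \<le> N then fock_trace \<beta> (N - n) (\<lambda>v. osc i (int n) (A v)) else 0)"
proof -
  have "A 0 = 0" using A[of 0 0] by simp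
  then show ?thesis
    unfolding fock_trace_def using assms(1,2)
    by (subst sum_mons_shift[of "(i, n)"])
      (auto simp: finite_fock_mons coef_osc osc_pos_fock_vec lookup_add A simp del: One_nat_def)
qed

text \<open>The exponent -length w selects the zero mode. The series records only the oscillator
  degree; the power of q given by half the norm of beta enters through the sum over
  \<open>shell\<close>.\<close>

definition word_trace :: "'h \<Rightarrow> nat list \<Rightarrow> complex fps" where
  "word_trace \<beta> w = Abs_fps (\<lambda>N. fock_trace \<beta> N (osc.nord w (- int (length w))))"

definition contraction_factor :: "nat \<Rightarrow> complex fps" where
  "contraction_factor n = fps_const (of_nat n) * fps_X ^ n * inverse (1 - fps_X ^ n)"

text \<open>The operator \<open>K\<close>, multiplication by the sum of 2 n q^n/(1 - q^n). Terms
  with n above N do not reach q^N, so each coefficient is a finite sum; the 2 stands for the two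
  halves of a current.\<close>

definition contraction :: "complex fps \<Rightarrow> complex fps" where
  "contraction f = Abs_fps (\<lambda>N. \<Sum>n=1..N. 2 * (contraction_factor n * f) $ N)"

lemma contraction_add: "contraction (f + g) = contraction f + contraction g"
  by (rule fps_ext) (simp add: contraction_def algebra_simps sum.distrib)

lemma contraction_scale: "contraction (fps_const r * f) = fps_const r * contraction f"
proof (rule fps_ext)
  fix N
  have *: "contraction_factor n * (fps_const r * f) = fps_const r * (contraction_factor n * f)" for n
    by (simp only: ac_simps)
  then show "contraction (fps_const r * f) $ N = (fps_const r * contraction f) $ N"
    unfolding contraction_def fps_nth_Abs_fps fps_mult_left_const_nth * sum_distrib_left
    by (simp only: ac_simps)
qed

text \<open>The hypothesis reads F = q^n F + r n q^n f as power series, and 1 - q^n is invertible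
  for n at least 1.\<close>

lemma solve_contraction:
  assumes "n \<ge> 1"
    and "\<And>N. F N = (if n \<le> N then F (N - n) + r * (of_nat n * f $ (N - n)) else 0)"
  shows "F N = r * (contraction_factor n * f) $ N"
proof -
  let ?F = "Abs_fps F"
  have unit: "(1 - fps_X ^ n :: complex fps) $ 0 \<noteq> 0" using assms(1) by simp
  have "?F = fps_X ^ n * ?F + fps_X ^ n * (fps_const (r * of_nat n) * f)"
  proof (rule fps_ext)
    fix N show "?F $ N = (fps_X ^ n * ?F + fps_X ^ n * (fps_const (r * of_nat n) * f)) $ N"
      using assms(2)[of N] by (simp add: fps_X_power_mult_nth)
  qed
  then have "(1 - fps_X ^ n) * ?F = fps_X ^ n * (fps_const (r * of_nat n) * f)"
    by (simp add: algebra_simps)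
  then have "inverse (1 - fps_X ^ n) * ((1 - fps_X ^ n) * ?F) =
      inverse (1 - fps_X ^ n) * (fps_X ^ n * (fps_const (r * of_nat n) * f))" by simp
  then have "?F = fps_const r * (contraction_factor n * f)"
    unfolding mult.assoc[symmetric] inverse_mult_eq_1[OF unit] contraction_factor_def
    by (simp only: fps_const_mult[symmetric] mult_1_left ac_simps)
  then have "?F $ N = (fps_const r * (contraction_factor n * f)) $ N" by simp
  then show ?thesis by simp
qed

text \<open>Cyclicity of the trace moves \<open>h\<^sub>i(\<plusminus>n)\<close> around the normally ordered product at the cost of a
  shift of the weight by \<open>n\<close> and of a contraction.\<close>

lemma fock_trace_nord_creation:
  fixes w :: "nat list"
  assumes "i < d" "n \<ge> 1"
  shows "fock_trace \<beta> N (\<lambda>v. osc i (- int n) (osc.nord w (- int (length w) - int n) v)) =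
    of_nat (count_list w i) * (contraction_factor n * word_trace \<beta> (remove1 i w)) $ N"
proof (rule solve_contraction[OF assms(2)])
  fix N
  let ?j = "- int (length w) - int n"
  \<comment> \<open>The commutator with the mode -n carries the factor -n, so returning the mode to
    the left adds a term with +n.\<close>
  have *: "osc.nord w ?j (osc i (- int n) v) = osc i (- int n) (osc.nord w ?j v) +
      vscale (of_nat (count_list w i) * of_nat n) (osc.nord (remove1 i w) (- int (length (remove1 i w))) v)" for v
  proof (cases "i \<in> set w")
    case True
    then have "length (remove1 i w) + 1 = length w"
      using length_pos_if_in_set[OF True] by (simp add: length_remove1)
    \<comment> \<open>The shifted exponent is that of the zero mode of the word with one letter
      removed.\<close>
    then have "?j - - int n + 1 = - int (length (remove1 i w))" by linarith
    then show ?thesis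
      using osc.commutator_nord[of i "- int n" w ?j v] by (simp add: mult.commute)
  next
    case False
    then show ?thesis
      using osc.commutator_nord[of i "- int n" w ?j v] by (simp add: count_notin)
  qed
  show "fock_trace \<beta> N (\<lambda>v. osc i (- int n) (osc.nord w ?j v)) =
    (if n \<le> N then fock_trace \<beta> (N - n) (\<lambda>v. osc i (- int n) (osc.nord w ?j v)) +
       of_nat (count_list w i) * (of_nat n * word_trace \<beta> (remove1 i w) $ (N - n)) else 0)"
    by (subst fock_trace_creation[OF assms])
      (simp only: * fock_trace_add fock_trace_vscale word_trace_def fps_nth_Abs_fps mult.assoc)
qed

text \<open>The mode now travels the other way and its commutator has the factor +n, so the result
  equals that of \<open>fock_trace_nord_creation\<close>: the origin of the 2 in
  \<open>contraction\<close>.\<close>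

lemma fock_trace_nord_annihilation:
  fixes w :: "nat list"
  assumes "i < d" "n \<ge> 1"
  shows "fock_trace \<beta> N (\<lambda>v. osc.nord w (- int (length w) + int n) (osc i (int n) v)) =
    of_nat (count_list w i) * (contraction_factor n * word_trace \<beta> (remove1 i w)) $ N"
proof (rule solve_contraction[OF assms(2)])
  fix N
  let ?j = "- int (length w) + int n"
  have *: "osc i (int n) (osc.nord w ?j v) = osc.nord w ?j (osc i (int n) v) +
      vscale (of_nat (count_list w i) * of_nat n) (osc.nord (remove1 i w) (- int (length (remove1 i w))) v)" for v
  proof (cases "i \<in> set w")
    case True
    then have "length (remove1 i w) + 1 = length w"
      using length_pos_if_in_set[OF True] by (simp add: length_remove1)
    then have "?j - int n + 1 = - int (length (remove1 i w))" by linarith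
    then show ?thesis
      using osc.commutator_nord[of i "int n" w ?j v] by (simp add: mult.commute)
  next
    case False
    then show ?thesis
      using osc.commutator_nord[of i "int n" w ?j v] by (simp add: count_notin)
  qed
  show "fock_trace \<beta> N (\<lambda>v. osc.nord w ?j (osc i (int n) v)) =
    (if n \<le> N then fock_trace \<beta> (N - n) (\<lambda>v. osc.nord w ?j (osc i (int n) v)) +
       of_nat (count_list w i) * (of_nat n * word_trace \<beta> (remove1 i w) $ (N - n)) else 0)"
    by (subst fock_trace_annihilation[OF assms osc.nord_scale])
      (simp only: * fock_trace_add fock_trace_vscale word_trace_def fps_nth_Abs_fps mult.assoc)
qed

lemma sum_Suc_truncate:
  fixes g :: "nat \<Rightarrow> complex"
  assumes "R \<ge> N" "\<And>n. n > N \<Longrightarrow> g n = 0"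
  shows "(\<Sum>n\<le>R. g (Suc n)) = (\<Sum>n=1..N. g n)"
proof -
  have "(\<Sum>n\<le>R. g (Suc n)) = (\<Sum>n=1..Suc R. g n)"
    by (rule sum.reindex_bij_witness[of _ "\<lambda>n. n - 1" Suc]) auto
  also have "\<dots> = (\<Sum>n=1..N. g n)"
    using assms by (intro sum.mono_neutral_right) auto
  finally show ?thesis .
qed

lemma contraction_factor_nth_eq_0:
  assumes "n > N"
  shows "(contraction_factor n * f) $ N = 0"
proof -
  have "contraction_factor n * f = fps_X ^ n * (fps_const (of_nat n) * inverse (1 - fps_X ^ n) * f)"
    by (simp only: contraction_factor_def ac_simps)
  then show ?thesis using assms by (simp only: fps_X_power_mult_nth if_True)
qed

text \<open>In the first current the zero mode acts as the scalar \<open>form (h i) \<beta>\<close>,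
  while the creation modes and the positive annihilation modes give equal contraction terms.\<close>

lemma word_trace_Cons:
  fixes w :: "nat list"
  assumes i: "i < d"
  shows "word_trace \<beta> (i # w) = fps_const (form (h i) \<beta>) * word_trace \<beta> w +
    fps_const (of_nat (count_list w i)) * contraction (word_trace \<beta> (remove1 i w))"
proof (rule fps_ext)
  fix N
  let ?l = "int (length w)"
  let ?k = "of_nat (count_list w i) :: complex"
  let ?E = "\<lambda>n. (contraction_factor n * word_trace \<beta> (remove1 i w)) $ N"
  let ?C = "\<lambda>n v. osc i (- int n) (osc.nord w (- ?l - int n) v)"
  let ?A = "\<lambda>n v. osc.nord w (- ?l + int n) (osc i (int n) v)"
  have "\<forall>\<^sub>F R in sequentially. \<forall>m\<in>fock_mons N.
      osc.nord (i # w) (- int (length (i # w))) (fock_vec \<beta> m) =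
      (\<Sum>n\<le>R. ?C (Suc n) (fock_vec \<beta> m)) + (\<Sum>n\<le>R. ?A n (fock_vec \<beta> m))"
  \<comment> \<open>One cutoff serves all basis vectors of degree \<open>N\<close>, there being
    finitely many.\<close>
  proof (rule eventually_ball_finite[OF finite_fock_mons], rule ballI)
    fix m
    have "- int n - 1 = - int (Suc n)" "- int (length (i # w)) - int n = - ?l - int (Suc n)"
      "- int (length (i # w)) + 1 + int n = - ?l + int n" for n
      by auto
    with osc.eventually_nord_Cons[of i w "- int (length (i # w))" "fock_vec \<beta> m"]
    show "\<forall>\<^sub>F R in sequentially. osc.nord (i # w) (- int (length (i # w))) (fock_vec \<beta> m) =
      (\<Sum>n\<le>R. ?C (Suc n) (fock_vec \<beta> m)) + (\<Sum>n\<le>R. ?A n (fock_vec \<beta> m))"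
      by (simp only:)
  qed
  then have "\<forall>\<^sub>F R in sequentially. word_trace \<beta> (i # w) $ N =
      (fps_const (form (h i) \<beta>) * word_trace \<beta> w + fps_const ?k * contraction (word_trace \<beta> (remove1 i w))) $ N"
    \<comment> \<open>One more than \<open>N\<close>, because n = 0 is split off the annihilation
      half.\<close>
    using eventually_ge_at_top[of "Suc N"]
  proof eventually_elim
    case (elim R)
    have Suc_ge_1: "Suc n \<ge> 1" for n by simp
    have trC: "fock_trace \<beta> N (?C n) = ?k * ?E n" if "n \<ge> 1" for n
      using fock_trace_nord_creation[OF i that] .
    have trA: "fock_trace \<beta> N (?A n) = ?k * ?E n" if "n \<ge> 1" for n
      using fock_trace_nord_annihilation[OF i that] .
    have trA0: "fock_trace \<beta> N (?A 0) = form (h i) \<beta> * word_trace \<beta> w $ N"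
      by (simp add: fock_trace_def word_trace_def osc_zero_fock_vec osc.nord_scale sum_distrib_left)
    have "word_trace \<beta> (i # w) $ N =
        (\<Sum>m\<in>fock_mons N. \<Sum>n\<le>R. coef (?C (Suc n) (fock_vec \<beta> m)) \<beta> m) +
        (\<Sum>m\<in>fock_mons N. \<Sum>n\<le>R. coef (?A n (fock_vec \<beta> m)) \<beta> m)"
      unfolding word_trace_def fps_nth_Abs_fps fock_trace_def sum.distrib[symmetric]
      by (intro sum.cong refl) (simp only: elim(1)[rule_format] coef_add coef_sum sum.distrib)
    also have "\<dots> = (\<Sum>n\<le>R. fock_trace \<beta> N (?C (Suc n))) + (\<Sum>n\<le>R. fock_trace \<beta> N (?A n))"
      unfolding fock_trace_def by (intro arg_cong2[of _ _ _ _ "(+)"] sum.swap)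
    also have "(\<Sum>n\<le>R. fock_trace \<beta> N (?C (Suc n))) = (\<Sum>n=1..N. ?k * ?E n)"
      unfolding trC[OF Suc_ge_1] using elim(2)
      by (intro sum_Suc_truncate) (simp_all add: contraction_factor_nth_eq_0)
    also have "(\<Sum>n\<le>R. fock_trace \<beta> N (?A n)) =
        form (h i) \<beta> * word_trace \<beta> w $ N + (\<Sum>n=1..N. ?k * ?E n)"
    proof -
      obtain R' where R: "R = Suc R'" "N \<le> R'" using elim(2) by (cases R) auto
      have "(\<Sum>n\<le>R. fock_trace \<beta> N (?A n)) =
          fock_trace \<beta> N (?A 0) + (\<Sum>n\<le>R'. fock_trace \<beta> N (?A (Suc n)))"
        unfolding R by (rule sum.atMost_Suc_shift)
      also have "(\<Sum>n\<le>R'. fock_trace \<beta> N (?A (Suc n))) = (\<Sum>n=1..N. ?k * ?E n)"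
        unfolding trA[OF Suc_ge_1] using R(2)
        by (intro sum_Suc_truncate) (simp_all add: contraction_factor_nth_eq_0)
      finally show ?thesis unfolding trA0 .
    qed
    finally show ?case
      by (simp add: contraction_def sum_distrib_left algebra_simps flip: sum.distrib)
  qed
  then show "word_trace \<beta> (i # w) $ N =
      (fps_const (form (h i) \<beta>) * word_trace \<beta> w + fps_const ?k * contraction (word_trace \<beta> (remove1 i w))) $ N"
    by simp
qed

lemma word_trace_mset:
  assumes "mset w = mset w'"
  shows "word_trace \<beta> w = word_trace \<beta> w'"
  using osc.nord_mset[OF assms] mset_eq_length[OF assms] by (simp add: word_trace_def)

lemma word_trace_Nil: "word_trace \<beta> [] = Abs_fps (\<lambda>N. of_nat (card (fock_mons N)))"
  by (rule fps_ext) (simp add: word_trace_def fock_trace_def coef_fock_vec)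

text \<open>Brings the recursion into the form required by \<open>lin_ext_euler\<close>. If the
  exponent is 1, the shorter word contains no further \<open>i\<close> and the factor 0 removes the
  contraction term.\<close>

lemma word_trace_mono_word:
  assumes "i < d" "Poly_Mapping.lookup m i > 0"
  shows "word_trace \<beta> (mono_word m) =
    fps_const (form (h i) \<beta>) * word_trace \<beta> (mono_word (m - Poly_Mapping.single i 1)) +
    fps_const (of_nat (Poly_Mapping.lookup m i - 1)) *
      contraction (word_trace \<beta> (mono_word (m - Poly_Mapping.single i 1 - Poly_Mapping.single i 1)))"
proof -
  let ?m = "m - Poly_Mapping.single i 1"
  have count: "count_list (mono_word ?m) i = Poly_Mapping.lookup m i - 1"
    by (simp add: lookup_minus)
  have mset: "mset (remove1 i (mono_word ?m)) = mset (mono_word (?m - Poly_Mapping.single i 1))"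
    if "Poly_Mapping.lookup m i - 1 > 0"
    using mset_mono_word_Cons[of ?m i] that by (simp add: lookup_minus)
  have "fps_const (of_nat (Poly_Mapping.lookup m i - 1)) *
      contraction (word_trace \<beta> (remove1 i (mono_word ?m))) =
    fps_const (of_nat (Poly_Mapping.lookup m i - 1)) *
      contraction (word_trace \<beta> (mono_word (?m - Poly_Mapping.single i 1)))"
  proof (cases "Poly_Mapping.lookup m i - 1 = 0")
    case False
    then have "Poly_Mapping.lookup m i - 1 > 0" by blast
    then show ?thesis by (simp only: word_trace_mset[OF mset])
  qed simp
  then show ?thesis
    unfolding word_trace_mset[OF mset_mono_word_Cons[OF assms(2)]] word_trace_Cons[OF assms(1)] count
    by simp
qed

section \<open>Assembling the trace function\<close>

lemma vector_space_fps: "complex_vector_space (\<lambda>r (f :: complex fps). fps_const r * f)"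
  by unfold_locales (auto simp: algebra_simps simp flip: fps_const_mult fps_const_add)

lemma lin_ext_word_trace:
  assumes "spherical_harmonic d k P"
  shows "complex_vector_space.lin_ext (\<lambda>r f. fps_const r * f) (\<lambda>m. word_trace \<beta> (mono_word m)) P =
    fps_const (peval (\<lambda>i. form (h i) \<beta>) P) * Abs_fps (\<lambda>N. of_nat (card (fock_mons N)))"
proof -
  have "mono_word (0 :: nat \<Rightarrow>\<^sub>0 nat) = []"
    using length_mono_word[of "0 :: nat \<Rightarrow>\<^sub>0 nat"] by (simp add: msize_def)
  then show ?thesis
    using lin_ext_spherical_harmonic[OF vector_space_fps contraction_add contraction_scale
        word_trace_mono_word assms, of \<beta>] by (simp add: word_trace_Nil)
qed

text \<open>Single modes change the weight, possibly to a negative value, so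
  \<open>osc.nord_graded\<close> is applied to an integer-indexed grading that extends
  \<open>weight_space\<close>.\<close>

lemma nord_weight_space:
  assumes "set w \<subseteq> {..<d}" "v \<in> weight_space M"
  shows "osc.nord w (- int (length w)) v \<in> weight_space M"
proof -
  define G where "G s = {v. \<forall>\<beta> m. coef v \<beta> m \<noteq> 0 \<longrightarrow> \<beta> \<in> L \<and>
     Poly_Mapping.keys m \<subseteq> {..<d} \<times> {1..} \<and> form \<beta> \<beta> / 2 + of_nat (mdeg snd m) = of_int s}" for s
  have G: "weight_space M = G (int M)"
    by (rule set_eqI) (simp only: weight_space_iff G_def mem_Collect_eq of_int_of_nat_eq)
  have sub: "fspace.subspace (G s)" for s
  proof (rule fspace.subspaceI)
    fix x y assume "x \<in> G s" "y \<in> G s"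
    moreover have "coef x \<beta> m \<noteq> 0 \<or> coef y \<beta> m \<noteq> 0" if "coef (x + y) \<beta> m \<noteq> 0" for \<beta> m
      using that by (auto simp: coef_add)
    ultimately show "x + y \<in> G s" unfolding G_def mem_Collect_eq by blast
  next
    fix r x assume "x \<in> G s"
    moreover have "coef x \<beta> m \<noteq> 0" if "coef (vscale r x) \<beta> m \<noteq> 0" for \<beta> m
      using that by auto
    ultimately show "vscale r x \<in> G s" unfolding G_def mem_Collect_eq by blast
  qed (simp add: G_def)
  have osc: "osc i n v \<in> G (s - n)" if i: "i \<in> {..<d}" and v: "v \<in> G s" for i n s v
    unfolding G_def mem_Collect_eq
  proof (intro allI impI)
    fix \<beta> m assume nz: "coef (osc i n v) \<beta> m \<noteq> 0"
    consider "n < 0" | "n = 0" | "n > 0" by linarith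
    then show "\<beta> \<in> L \<and> Poly_Mapping.keys m \<subseteq> {..<d} \<times> {1..} \<and>
        form \<beta> \<beta> / 2 + of_nat (mdeg snd m) = of_int (s - n)"
    proof cases
      case 1
      let ?x = "(i, nat (- n))"
      define m' where "m' = m - Poly_Mapping.single ?x 1"
      have "Poly_Mapping.lookup m ?x > 0" "coef v \<beta> m' \<noteq> 0"
        using nz 1 by (auto simp: coef_osc m'_def split: if_splits)
      then have m: "m = m' + Poly_Mapping.single ?x 1"
        using diff_single_add_single[of m ?x] by (simp add: m'_def)
      have "\<beta> \<in> L \<and> Poly_Mapping.keys m' \<subseteq> {..<d} \<times> {1..} \<and>
          form \<beta> \<beta> / 2 + of_nat (mdeg snd m') = of_int s"
        using v \<open>coef v \<beta> m' \<noteq> 0\<close> unfolding G_def mem_Collect_eq by blast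
      moreover have "complex_of_nat (nat (- n)) = - of_int n" using 1 by simp
      ultimately show ?thesis
        unfolding m using i 1 by (simp add: keys_add_nat mdeg_add algebra_simps)
    next
      case 2
      then have "coef v \<beta> m \<noteq> 0" using nz by (simp add: coef_osc)
      then show ?thesis using v 2 unfolding G_def mem_Collect_eq by simp
    next
      case 3
      let ?m = "m + Poly_Mapping.single (i, nat n) 1"
      have "coef v \<beta> ?m \<noteq> 0" using nz 3 by (auto simp: coef_osc)
      then have "\<beta> \<in> L \<and> Poly_Mapping.keys ?m \<subseteq> {..<d} \<times> {1..} \<and>
          form \<beta> \<beta> / 2 + of_nat (mdeg snd ?m) = of_int s"
        using v unfolding G_def mem_Collect_eq by blast
      moreover have "complex_of_nat (nat n) = of_int n" using 3 by simp
      ultimately show ?thesis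
        by (simp add: keys_add_nat mdeg_add algebra_simps eq_diff_eq)
    qed
  qed
  have "osc.nord w (- int (length w)) v \<in> G (int M + - int (length w) + int (length w))"
    by (rule osc.nord_graded[of G "{..<d}"]) (use sub osc assms G in auto)
  then show ?thesis by (simp add: G)
qed

lemma trace_zero_mode:
  assumes P: "spherical_harmonic d k P"
  shows "fspace.trace_on (weight_space M) (zero_mode (creation_state P)) =
    (\<Sum>j\<le>M. (\<Sum>\<beta>\<in>shell j. peval (\<lambda>i. form (h i) \<beta>) P) * of_nat (card (fock_mons (M - j))))"
proof -
  \<comment> \<open>The closed form of the zero mode: linear everywhere, and equal to it on vectors
    supported on \<open>L\<close>.\<close>
  let ?S = "\<lambda>v. fspace_lin.lin_ext (\<lambda>m. osc.nord (mono_word m) (- int k) v) P"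
  have pv: "pvars P \<subseteq> {..<d}" using P by (simp add: spherical_harmonic_def)
  have length: "length (mono_word m) = k" if "m \<in> Poly_Mapping.keys P" for m
    using P that by (simp add: length_mono_word spherical_harmonic_def phomogeneous_iff)
  have "fspace.trace_on (weight_space M) (zero_mode (creation_state P)) =
      (\<Sum>(\<beta>, m)\<in>weight_index M. coef (?S (fock_vec \<beta> m)) \<beta> m)"
  proof (rule trace_on_weight_space)
    show "?S (x + y) = ?S x + ?S y" for x y
      by (simp add: fspace_lin.lin_ext_def osc.nord_add fspace.scale_right_distrib sum.distrib)
    show "?S (vscale r x) = vscale r (?S x)" for r x
      by (simp add: fspace_lin.lin_ext_def osc.nord_scale fspace.scale_sum_right mult.commute)
    fix x assume x: "x \<in> weight_space M"
    then have "Poly_Mapping.keys x \<subseteq> L" by (simp add: weight_space_def VL_def)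
    then show "zero_mode (creation_state P) x = ?S x"
      by (simp only: zero_mode_homogeneous[OF creation_state_weight_space[OF P]] Y_creation_state[OF pv])
    have sub: "fspace.subspace (weight_space M)"
    proof (rule fspace.subspaceI)
      fix x y assume "x \<in> weight_space M" "y \<in> weight_space M"
      moreover have "coef x \<beta> m \<noteq> 0 \<or> coef y \<beta> m \<noteq> 0" if "coef (x + y) \<beta> m \<noteq> 0" for \<beta> m
        using that by (auto simp: coef_add)
      ultimately show "x + y \<in> weight_space M" unfolding weight_space_index by blast
    qed (auto simp: weight_space_index)
    have "osc.nord (mono_word m) (- int k) x \<in> weight_space M" if m: "m \<in> Poly_Mapping.keys P" for m
    proof -
      have "set (mono_word m) \<subseteq> {..<d}" using pv m by (auto simp: set_mono_word pvars_def)
      from nord_weight_space[OF this x] show ?thesis by (simp only: length[OF m])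
    qed
    then show "?S x \<in> weight_space M"
      unfolding fspace_lin.lin_ext_def
      by (intro fspace.subspace_sum[OF sub] fspace.subspace_scale[OF sub])
  qed
  \<comment> \<open>Weight \<open>M\<close> splits into half the norm of beta, \<open>j\<close>, and
    oscillator degree \<open>M - j\<close>; different shells are disjoint.\<close>
  also have "\<dots> = (\<Sum>j\<le>M. \<Sum>\<beta>\<in>shell j. \<Sum>m\<in>fock_mons (M - j). coef (?S (fock_vec \<beta> m)) \<beta> m)"
  proof -
    have "(\<Sum>(\<beta>, m)\<in>weight_index M. coef (?S (fock_vec \<beta> m)) \<beta> m) =
        (\<Sum>j\<le>M. \<Sum>(\<beta>, m)\<in>shell j \<times> fock_mons (M - j). coef (?S (fock_vec \<beta> m)) \<beta> m)"
      unfolding weight_index_def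
    proof (rule sum.UNION_disjoint)
      show "\<forall>j\<in>{..M}. finite (shell j \<times> fock_mons (M - j))"
        using finite_shell finite_fock_mons by blast
    qed (auto simp: shell_def)
    then show ?thesis by (simp only: sum.cartesian_product)
  qed
  also have "\<dots> = (\<Sum>j\<le>M. \<Sum>\<beta>\<in>shell j. peval (\<lambda>i. form (h i) \<beta>) P * of_nat (card (fock_mons (M - j))))"
  proof (intro sum.cong refl)
    fix j \<beta>
    interpret fps: complex_vector_space "\<lambda>r (f :: complex fps). fps_const r * f"
      by (rule vector_space_fps)
    have "(\<Sum>m\<in>fock_mons (M - j). coef (?S (fock_vec \<beta> m)) \<beta> m) =
        (\<Sum>p\<in>Poly_Mapping.keys P. Poly_Mapping.lookup P p *
          fock_trace \<beta> (M - j) (osc.nord (mono_word p) (- int k)))"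
      unfolding fspace_lin.lin_ext_def fock_trace_def coef_sum coef_vscale sum_distrib_left
      by (rule sum.swap)
    also have "\<dots> = (\<Sum>p\<in>Poly_Mapping.keys P. (fps_const (Poly_Mapping.lookup P p) *
          word_trace \<beta> (mono_word p)) $ (M - j))"
      by (intro sum.cong refl) (simp add: word_trace_def length)
    also have "\<dots> = fps.lin_ext (\<lambda>m. word_trace \<beta> (mono_word m)) P $ (M - j)"
      by (simp only: fps.lin_ext_def fps_sum_nth)
    also have "\<dots> = peval (\<lambda>i. form (h i) \<beta>) P * of_nat (card (fock_mons (M - j)))"
      unfolding lin_ext_word_trace[OF P] by simp
    finally show "(\<Sum>m\<in>fock_mons (M - j). coef (?S (fock_vec \<beta> m)) \<beta> m) =
      peval (\<lambda>i. form (h i) \<beta>) P * of_nat (card (fock_mons (M - j)))" .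
  qed
  finally show ?thesis by (simp only: sum_distrib_right)
qed

lemma Z_creation_state:
  assumes "spherical_harmonic d k P"
  shows "Z (creation_state P) = theta P / eta ^ d"
proof -
  let ?T = "Abs_fps (\<lambda>j. \<Sum>\<beta>\<in>shell j. peval (\<lambda>i. form (h i) \<beta>) P)"
  \<comment> \<open>The sum over \<open>j\<close> is a Cauchy product of theta coefficients with
    numbers of oscillator monomials.\<close>
  have "Abs_fps (\<lambda>M. fspace.trace_on (weight_space M) (zero_mode (creation_state P))) =
      ?T * Abs_fps (\<lambda>N. of_nat (card (fock_mons N)))"
    by (rule fps_ext) (simp add: trace_zero_mode[OF assms] fps_mult_nth atMost_atLeast0)
  then show ?thesis
    unfolding Z_def theta_def shell_def[symmetric] by (simp only: q_series_fock_gf_eta)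
qed

end

theorem theorem3:
  fixes scale :: "complex \<Rightarrow> 'h::ab_group_add \<Rightarrow> 'h"
    and form :: "'h \<Rightarrow> 'h \<Rightarrow> complex"
    and L :: "'h set"
    and d k :: nat
    and h :: "nat \<Rightarrow> 'h"
    and c :: "'h \<Rightarrow> 'h \<Rightarrow> complex"
    and P :: "nat cpoly"
  assumes "lattice_voa scale form L d h c"
    and "spherical_harmonic d k P"
  shows "\<exists>v. lattice_voa.primary form L d h c v \<and>
             lattice_voa.Z form L d h c v = lattice_voa.theta form L h P / eta ^ d"
proof -
  interpret lattice_voa scale form L d h c by fact
  show ?thesis
    using primary_creation_state[OF assms(2)] Z_creation_state[OF assms(2)] by blast
qed

end
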